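(* Let $\{a_k\}\subset\mathbb{C}$ be a sequence without finite limit points (each point may occur with finite multiplicity). Then $\{a_k\}$ is the zero set of some entire function of exponential type that is bounded on the real axis if and only if all of the following hold: (i) the limit $\lim_{R\to\infty}\sum_{0<|a_k|<R} a_k^{-1}$ exists; (ii) $n(0,t)=O(t)$ as $t\to\infty$; (iii) $n(0,t+1)-n(0,t)=o(t)$ as $t\to\infty$; (iv) for some point $b\in\mathbb{R}\setminus\{a_k\}$, $$\sup_{x\in\mathbb{R}}\int_0^\infty [n(b,t)-n(x,t)]\,t^{-1}\,dt<\infty .$$
   Context: For $c\in\mathbb{C}$ and $t\ge 0$, $n(c,t)=\mathrm{card}\{a_k:\,|a_k-c|\le t\}$, counted with multiplicity. A sequence $\{a_k\}$ is the zero set of an entire function $f$ if $f(a)\ne 0$ for $a\notin\{a_k\}$ and, for each $a$ occurring in $\{a_k\}$ with multiplicity $p$, $f(a)=f'(a)=\dots=f^{(p-1)}(a)=0$ and $f^{(p)}(a)\ne0$. An entire function $f$ is of exponential type if $|f(z)|\le Ae^{B|z|}$ for some constants $A,B$. *)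

theory Defs
  imports "HOL-Complex_Analysis.Complex_Analysis" "HOL-Library.Landau_Symbols"
begin

text \<open>A sequence of complex points counted with multiplicity is represented by its
  multiplicity function m :: complex => nat (m z = number of k with a_k = z).
  "No finite limit points" means every closed disc contains only finitely many
  points of the support.\<close>

definition no_finite_limit_points :: "(complex \<Rightarrow> nat) \<Rightarrow> bool" where
  "no_finite_limit_points m \<longleftrightarrow> (\<forall>r::real. finite {z. 0 < m z \<and> norm z \<le> r})"

definition cnt :: "(complex \<Rightarrow> nat) \<Rightarrow> complex \<Rightarrow> real \<Rightarrow> nat" where
  "cnt m c t = (\<Sum>z\<in>{z. 0 < m z \<and> dist z c \<le> t}. m z)"

definition is_zero_set :: "(complex \<Rightarrow> nat) \<Rightarrow> (complex \<Rightarrow> complex) \<Rightarrow> bool" where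
  "is_zero_set m f \<longleftrightarrow>
     (\<forall>a. (\<forall>j<m a. (deriv ^^ j) f a = 0) \<and> (deriv ^^ m a) f a \<noteq> 0)"

definition exponential_type :: "(complex \<Rightarrow> complex) \<Rightarrow> bool" where
  "exponential_type f \<longleftrightarrow> (\<exists>A B. \<forall>z. norm (f z) \<le> A * exp (B * norm z))"

end

theory Submission
  imports Defs "HOL-Real_Asymp.Real_Asymp"
begin

text \<open>
  Write \<open>n(r)\<close> for the number of zeros \<open>a\<close> with \<open>0 < |a| < r\<close> and \<open>N(r) = \<Sum> log (r / |a|)\<close>
  for the sum over these zeros.

  Sufficiency. By (i) and (ii) the partial products \<open>z^k \<Prod>\<^bsub>0<|a|<R\<^esub> (1 - z / a)\<close> converge to an entire
  function \<open>F\<close> of exponential type (Lindelof). The integral of \<open>n(c,t) / t\<close> over \<open>[0,T]\<close> is the sum of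
  \<open>log (T / |a - c|)\<close> over \<open>|a - c| \<le> T\<close>. By (iii) the disc about \<open>c\<close> may be replaced by the disc about 0
  at the cost of \<open>o(1)\<close>, so the integral in (iv) equals \<open>log |F(x) / F(b)|\<close>, and (iv) says that \<open>F\<close> is
  bounded on the real axis.

  Necessity. By Phragmen--Lindelof, and after division by a power of \<open>z\<close>, a constant and a factor
  \<open>exp (i \<kappa> z)\<close>, one has \<open>|f(z)| \<le> exp (\<sigma> |Im z|)\<close> with \<open>\<sigma>\<close> best possible in both half-planes.
  In \<open>|z| < R\<close> divide \<open>f\<close> by its Blaschke factors and by an outer function whose modulus on the circle is
  \<open>exp (\<sigma> |Im z|)\<close>: minus the logarithm of the result has nonnegative real part, and its value at 0 is the
  defect \<open>2 \<sigma> R / \<pi> - log |f(0)| - N(R)\<close>. The core is that the defect is \<open>o(R)\<close>. Harnack's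
  inequality in discs tangent to the real axis carries the sharpness of \<open>\<sigma>\<close> from a single point to all large
  heights \<open>y\<close> and gives \<open>\<Sum> log (1 + y\<^sup>2 / |a|\<^sup>2) \<ge> (2 \<sigma> - \<epsilon>) y - O(1)\<close>. The left side is an
  average of \<open>N\<close> against a positive kernel for which the upper bound \<open>N(s) \<le> 2 \<sigma> s / \<pi> + O(1)\<close>
  gives exactly \<open>2 \<sigma> y + O(1)\<close>, so \<open>N\<close> cannot fall short of that bound at any scale. A small defect yields
  \<open>n(R) / R \<rightarrow> 2 \<sigma> / \<pi>\<close> and, by the gradient bound for positive harmonic functions at 0, the
  convergence of \<open>\<Sum> 1 / a\<close> and \<open>f(z) = f(0) lim \<Prod>\<^bsub>|a|<R\<^esub> (1 - z / a)\<close>.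
\<close>

section \<open>Zeros with multiplicity\<close>

text \<open>The constant \<open>2 / \<pi>\<close> is the mean of \<open>|Im z|\<close> over the unit
  circle, so the upper bound for \<open>N\<close> is Jensen's inequality and the defect is its
  slack. The obstacle is that Jensen bounds \<open>N\<close> only from above, while sharpness of
  \<sigma> speaks of single points over which there is no control. The two meet on the imaginary
  axis: the upper bound for \<open>N\<close> and the sharp lower bound for \<open>f\<close> have the
  same main term \<open>2 \<sigma> y\<close>, and since \<open>N\<close> increases, a shortfall
  \<open>\<delta> t\<close> at \<open>t\<close> persists on an interval below \<open>t\<close> of
  length proportional to \<open>t\<close>, where it would be seen. At that stage only the crude
  bound \<open>O(R)\<close> for the defect is known. Using the disc representation at
  \<open>iy\<close> and \<open>-iy\<close> together removes the terms linear in \<open>y\<close>,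
  and the error left over is \<open>O(defect / R^2)\<close>. Zeros off the real axis are harmless
  because the slack that bounds the growth also bounds the sum of their imaginary parts. For the sum
  of \<open>1 / a\<close> a small defect gives convergence only up to a conjugate sum coming from
  the Blaschke factors; removing it needs the regular density \<open>n(R) / R\<close> as well. Until
  the last limit everything happens in discs with finitely many zeros.\<close>

lemma higher_deriv_shifted_power:
  fixes a :: complex
  shows "(deriv ^^ j) (\<lambda>w. (w - a) ^ k) = (\<lambda>w. (\<Prod>i<j. of_nat (k - i)) * (w - a) ^ (k - j))"
proof (induction j)
  case (Suc j)
  \<comment> \<open>For \<open>j >= k\<close> truncated subtraction makes the new factor
    \<open>k - j\<close> vanish, as the derivative of a constant must.\<close>
  have "deriv (\<lambda>w. (\<Prod>i<j. of_nat (k - i)) * (w - a) ^ (k - j)) w =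
        (\<Prod>i<Suc j. of_nat (k - i)) * (w - a) ^ (k - Suc j)" for w
    by (rule DERIV_imp_deriv) (auto intro!: derivative_eq_intros simp: algebra_simps)
  then show ?case using Suc by auto
qed simp

text \<open>Local factors can be multiplied, divided and glued, while lists of derivatives cannot;
  most later statements on zero sets are proved in this form.\<close>

lemma is_zero_set_iff_local_factor:
  assumes "f holomorphic_on UNIV"
  shows "is_zero_set m f \<longleftrightarrow>
    (\<forall>a. \<exists>g. g analytic_on {a} \<and> g a \<noteq> 0 \<and> eventually (\<lambda>z. f z = (z - a) ^ m a * g z) (nhds a))"
proof -
  have "((\<forall>j<m a. (deriv ^^ j) f a = 0) \<and> (deriv ^^ m a) f a \<noteq> 0) \<longleftrightarrow>
     (\<exists>g. g analytic_on {a} \<and> g a \<noteq> 0 \<and> eventually (\<lambda>z. f z = (z - a) ^ m a * g z) (nhds a))"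
    (is "?L \<longleftrightarrow> ?R") for a
  proof
    assume L: ?L
    show ?R
    proof (cases "m a = 0")
      case True
      then show ?thesis using L assms
        by (intro exI[of _ f]) (auto intro: holomorphic_on_imp_analytic_at)
    next
      case False
      then have f0: "f a = 0" using L by force
      have "0 < m a" "(deriv ^^ m a) f a \<noteq> 0" "\<And>i. 0 < i \<Longrightarrow> i < m a \<Longrightarrow> (deriv ^^ i) f a = 0"
        using L False by auto
      then have "\<exists>g r. 0 < r \<and> g holomorphic_on ball a r \<and> (\<forall>w\<in>ball a r. f w - f a = (w - a) ^ m a * g w)
          \<and> (\<forall>w\<in>ball a r. g w \<noteq> 0)"
        using holomorphic_factor_order_of_zero[OF assms open_UNIV UNIV_I, of "m a" a] by metis
      then obtain g r where g: "0 < r" "g holomorphic_on ball a r"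
          "\<And>w. w \<in> ball a r \<Longrightarrow> f w - f a = (w - a) ^ m a * g w"
          "\<And>w. w \<in> ball a r \<Longrightarrow> g w \<noteq> 0" by blast
      have "eventually (\<lambda>z. z \<in> ball a r) (nhds a)"
        using g(1) by (intro eventually_nhds_in_open) auto
      then have "eventually (\<lambda>z. f z = (z - a) ^ m a * g z) (nhds a)"
        by eventually_elim (use g(3) f0 in auto)
      then show ?thesis using g
        by (intro exI[of _ g]) (auto simp: analytic_at_ball intro: analytic_at)
    qed
  next
    assume ?R
    then obtain g where g: "g analytic_on {a}" "g a \<noteq> 0"
      "eventually (\<lambda>z. f z = (z - a) ^ m a * g z) (nhds a)" by blast
    have p: "(\<lambda>z. (z - a) ^ m a) analytic_on {a}" by (intro analytic_intros)
    have *: "(deriv ^^ j) f a =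
      (\<Sum>i=0..j. of_nat (j choose i) * (deriv ^^ i) (\<lambda>z. (z - a) ^ m a) a * (deriv ^^ (j - i)) g a)" for j
      unfolding higher_deriv_mult_at[OF p g(1), symmetric]
      by (rule higher_deriv_cong_ev[OF g(3) refl])
    have z: "(deriv ^^ i) (\<lambda>z. (z - a) ^ m a) a = 0" if "i < m a" for i
      using that by (simp add: higher_deriv_shifted_power)
    \<comment> \<open>In the Leibniz sum at \<open>a\<close> every derivative of the power of order
      below \<open>m a\<close> vanishes, which leaves the single index
      \<open>i = m a\<close>.\<close>
    have "(deriv ^^ m a) f a = (\<Sum>i\<in>{m a}. of_nat (m a choose i) * (deriv ^^ i) (\<lambda>z. (z - a) ^ m a) a * (deriv ^^ (m a - i)) g a)"
      unfolding * by (rule sum.mono_neutral_right) (auto simp: z)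
    also have "\<dots> \<noteq> 0" using g(2) by (simp add: higher_deriv_shifted_power)
    finally show ?L using z by (auto simp: * intro!: sum.neutral)
  qed
  then show ?thesis unfolding is_zero_set_def by blast
qed

lemma is_zero_set_zero_iff: "is_zero_set m f \<Longrightarrow> f z = 0 \<longleftrightarrow> 0 < m z"
  unfolding is_zero_set_def by (metis bot_nat_0.not_eq_extremum funpow_0)

text \<open>The quotient has a removable singularity at \<open>a\<close>; the local factor of
  \<open>f\<close> at \<open>a\<close> supplies the missing value and shows that it is
  nonzero.\<close>

lemma is_zero_set_divide:
  assumes f: "f holomorphic_on UNIV" and m: "is_zero_set m f"
  obtains h where "h holomorphic_on UNIV" "\<And>z. f z = (z - a) ^ m a * h z" "is_zero_set (m(a := 0)) h"
proof -
  have loc: "\<exists>g. g analytic_on {b} \<and> g b \<noteq> 0 \<and> eventually (\<lambda>z. f z = (z - b) ^ m b * g z) (nhds b)" for b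
    using m is_zero_set_iff_local_factor[OF f] by blast
  obtain g where g: "g analytic_on {a}" "g a \<noteq> 0" "eventually (\<lambda>z. f z = (z - a) ^ m a * g z) (nhds a)"
    using loc[of a] by blast
  define h where "h z = (if z = a then g a else f z / (z - a) ^ m a)" for z
  have ev: "eventually (\<lambda>z. h z = g z) (nhds a)"
    using g(3) by eventually_elim (auto simp: h_def)
  have feq: "f z = (z - a) ^ m a * h z" for z
    using eventually_nhds_x_imp_x[OF g(3)] by (auto simp: h_def)
  have an: "h analytic_on {b}" for b
  proof (cases "b = a")
    case True then show ?thesis using g(1) analytic_at_cong[OF ev refl] by simp
  next
    case False
    have "eventually (\<lambda>z. z \<in> -{a}) (nhds b)" using False by (intro eventually_nhds_in_open) auto
    then have "eventually (\<lambda>z. h z = f z / (z - a) ^ m a) (nhds b)"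
      by eventually_elim (auto simp: h_def)
    moreover have "(\<lambda>z. f z / (z - a) ^ m a) analytic_on {b}"
      using f False by (intro analytic_intros holomorphic_on_imp_analytic_at[of _ UNIV]) auto
    ultimately show ?thesis by (simp add: analytic_at_cong)
  qed
  then have h: "h holomorphic_on UNIV"
    by (meson analytic_imp_holomorphic analytic_on_analytic_at)
  have "\<exists>g. g analytic_on {b} \<and> g b \<noteq> 0 \<and> eventually (\<lambda>z. h z = (z - b) ^ (m(a := 0)) b * g z) (nhds b)" for b
  proof (cases "b = a")
    case True then show ?thesis using an[of a] g(2) by (intro exI[of _ h]) (auto simp: h_def)
  next
    case False
    obtain k where k: "k analytic_on {b}" "k b \<noteq> 0" "eventually (\<lambda>z. f z = (z - b) ^ m b * k z) (nhds b)"
      using loc[of b] by blast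
    have "eventually (\<lambda>z. z \<in> -{a}) (nhds b)" using False by (intro eventually_nhds_in_open) auto
    with k(3) have "eventually (\<lambda>z. h z = (z - b) ^ (m(a := 0)) b * (k z / (z - a) ^ m a)) (nhds b)"
      by eventually_elim (use False in \<open>auto simp: h_def\<close>)
    moreover have "(\<lambda>z. k z / (z - a) ^ m a) analytic_on {b}"
      using k False by (intro analytic_intros) auto
    ultimately show ?thesis using k(2) False by (intro exI[of _ "\<lambda>z. k z / (z - a) ^ m a"]) auto
  qed
  then have "is_zero_set (m(a := 0)) h" using is_zero_set_iff_local_factor[OF h] by blast
  with h feq show thesis by (rule that)
qed

lemma is_zero_set_divide_finite:
  assumes f: "f holomorphic_on UNIV" and m: "is_zero_set m f" and "finite A"
  obtains h where "h holomorphic_on UNIV" "\<And>z. f z = (\<Prod>a\<in>A. (z - a) ^ m a) * h z"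
    "is_zero_set (\<lambda>z. if z \<in> A then 0 else m z) h"
proof -
  have "\<exists>h. h holomorphic_on UNIV \<and> (\<forall>z. f z = (\<Prod>a\<in>A. (z - a) ^ m a) * h z) \<and>
    is_zero_set (\<lambda>z. if z \<in> A then 0 else m z) h"
    using \<open>finite A\<close>
  proof (induction A)
    case empty then show ?case using f m by auto
  next
    case (insert b A)
    then obtain h where h: "h holomorphic_on UNIV" "\<And>z. f z = (\<Prod>a\<in>A. (z - a) ^ m a) * h z"
      "is_zero_set (\<lambda>z. if z \<in> A then 0 else m z) h" by blast
    obtain k where k: "k holomorphic_on UNIV"
      "\<And>z. h z = (z - b) ^ (if b \<in> A then 0 else m b) * k z"
      "is_zero_set ((\<lambda>z. if z \<in> A then 0 else m z)(b := 0)) k"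
      using is_zero_set_divide[OF h(1,3), of b] by blast
    have "(\<lambda>z. if z \<in> A then 0 else m z)(b := 0) = (\<lambda>z. if z \<in> insert b A then 0 else m z)"
      by auto
    with k h(2) insert.hyps show ?case by (intro exI[of _ k]) (auto simp: mult_ac)
  qed
  then show thesis using that by blast
qed

lemma is_zero_set_mult_nonvanishing:
  assumes f: "f holomorphic_on UNIV" and g: "g holomorphic_on UNIV" and nz: "\<And>z. g z \<noteq> 0"
    and m: "is_zero_set m f"
  shows "is_zero_set m (\<lambda>z. g z * f z)"
proof -
  have "\<exists>k. k analytic_on {a} \<and> k a \<noteq> 0 \<and> eventually (\<lambda>z. g z * f z = (z - a) ^ m a * k z) (nhds a)" for a
  proof -
    obtain k where k: "k analytic_on {a}" "k a \<noteq> 0" "eventually (\<lambda>z. f z = (z - a) ^ m a * k z) (nhds a)"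
      using m is_zero_set_iff_local_factor[OF f] by blast
    have "(\<lambda>z. g z * k z) analytic_on {a}"
      using k g by (intro analytic_intros holomorphic_on_imp_analytic_at[of g UNIV]) auto
    moreover have "eventually (\<lambda>z. g z * f z = (z - a) ^ m a * (g z * k z)) (nhds a)"
      using k(3) by eventually_elim auto
    ultimately show ?thesis using k(2) nz by (intro exI[of _ "\<lambda>z. g z * k z"]) auto
  qed
  moreover have "(\<lambda>z. g z * f z) holomorphic_on UNIV" by (intro holomorphic_intros f g)
  ultimately show ?thesis using is_zero_set_iff_local_factor by blast
qed

lemma is_zero_set_reflect:
  assumes f: "f holomorphic_on UNIV" and m: "is_zero_set m f"
  shows "is_zero_set (\<lambda>z. m (- z)) (\<lambda>z. f (- z))"
proof -
  have "(deriv ^^ j) (\<lambda>w. f ((-1) * w)) z = (-1) ^ j * (deriv ^^ j) f ((-1) * z)" for j z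
    by (rule higher_deriv_compose_linear[OF f open_UNIV open_UNIV]) auto
  then show ?thesis using m by (auto simp: is_zero_set_def)
qed

section \<open>Holomorphic functions with nonnegative real part\<close>

text \<open>The Schwarz lemma for the Cayley transform of \<open>W\<close> that sends
  \<open>W 0\<close> to 0; \<open>v\<close> is the value of this transform at \<open>z\<close>.
  Solving for \<open>W z\<close> gives both estimates of \<open>Harnack_unit\<close>.\<close>

lemma Cayley_Schwarz:
  assumes W: "W holomorphic_on ball 0 1" and pos: "\<And>z. norm z < 1 \<Longrightarrow> 0 < Re (W z)" and z: "norm z < 1"
  obtains v where "norm v \<le> norm z" "W z * (1 - v) = W 0 + v * cnj (W 0)"
proof -
  define \<phi> where "\<phi> u = (W u - W 0) / (W u + cnj (W 0))" for u
  have W0: "0 < Re (W 0)" using pos[of 0] by simp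
  have nz: "W u + cnj (W 0) \<noteq> 0" if "norm u < 1" for u
    using pos[OF that] W0 by (auto simp: complex_eq_iff)
  have lt: "norm (\<phi> u) < 1" if "norm u < 1" for u
  proof -
    have "(norm (W u - W 0))\<^sup>2 = (norm (W u + cnj (W 0)))\<^sup>2 - 4 * (Re (W u) * Re (W 0))"
      unfolding cmod_power2 by (simp add: power2_eq_square algebra_simps)
    moreover have "0 < Re (W u) * Re (W 0)" using pos[OF that] W0 by simp
    ultimately have "(norm (W u - W 0))\<^sup>2 < (norm (W u + cnj (W 0)))\<^sup>2" by linarith
    then have "norm (W u - W 0) < norm (W u + cnj (W 0))" by (simp add: power2_less_imp_less)
    then show ?thesis using nz[OF that] by (simp add: \<phi>_def norm_divide)
  qed
  have "\<phi> holomorphic_on ball 0 1"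
    unfolding \<phi>_def using nz by (intro holomorphic_intros W) auto
  moreover have "\<phi> 0 = 0" by (simp add: \<phi>_def)
  ultimately have "norm (\<phi> z) \<le> norm z" using lt z by (intro Schwarz_Lemma) auto
  moreover have "\<phi> z * (W z + cnj (W 0)) = W z - W 0" using nz[OF z] by (simp add: \<phi>_def)
  then have "W z * (1 - \<phi> z) = W 0 + \<phi> z * cnj (W 0)" by (simp add: algebra_simps)
  ultimately show thesis by (rule that)
qed

lemma Harnack_unit:
  assumes W: "W holomorphic_on ball 0 1" and pos: "\<And>z. norm z < 1 \<Longrightarrow> 0 < Re (W z)" and z: "norm z < 1"
  shows "norm (W z - W 0) \<le> 2 * Re (W 0) * norm z / (1 - norm z)"
    and "Re (W 0) * (1 - norm z) \<le> (1 + norm z) * Re (W z)"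
proof -
  obtain v where v: "norm v \<le> norm z" "W z * (1 - v) = W 0 + v * cnj (W 0)"
    by (rule Cayley_Schwarz[OF W pos z])
  have p: "0 < Re (W 0)" using pos[of 0] by simp
  have n1: "1 - norm z \<le> norm (1 - v)" using norm_triangle_ineq2[of 1 v] v(1) by simp
  have n2: "norm (1 - v) \<le> 1 + norm z" using norm_triangle_ineq4[of 1 v] v(1) by simp
  have v1: "1 - v \<noteq> 0" using n1 z by auto
  have "(W z - W 0) * (1 - v) = W 0 + v * cnj (W 0) - W 0 * (1 - v)"
    using v(2) by (simp add: algebra_simps)
  also have "\<dots> = v * (W 0 + cnj (W 0))" by (simp add: algebra_simps)
  also have "\<dots> = v * of_real (2 * Re (W 0))" by (simp add: complex_add_cnj)
  finally have e: "(W z - W 0) * (1 - v) = v * of_real (2 * Re (W 0))" .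
  have "norm (W z - W 0) * (1 - norm z) \<le> norm (W z - W 0) * norm (1 - v)"
    by (intro mult_left_mono n1) auto
  also have "\<dots> = norm ((W z - W 0) * (1 - v))" by (simp add: norm_mult)
  also have "\<dots> = norm v * (2 * Re (W 0))" unfolding e using p by (simp add: norm_mult)
  also have "\<dots> \<le> norm z * (2 * Re (W 0))" using v(1) p by (intro mult_right_mono) auto
  finally show "norm (W z - W 0) \<le> 2 * Re (W 0) * norm z / (1 - norm z)"
    using z by (simp add: field_simps)
  \<comment> \<open>Multiplying by the conjugate of \<open>1 - v\<close> makes the factor of
    \<open>W z\<close> real, so that taking real parts gives an exact formula for
    \<open>Re (W z)\<close>.\<close>
  have "W z * (1 - v) * cnj (1 - v) = (W 0 + v * cnj (W 0)) * cnj (1 - v)" by (simp add: v(2))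
  then have "W z * of_real ((norm (1 - v))\<^sup>2) = (W 0 + v * cnj (W 0)) * cnj (1 - v)"
    unfolding complex_norm_square by (simp only: mult.assoc)
  then have "Re (W z * of_real ((norm (1 - v))\<^sup>2)) = Re ((W 0 + v * cnj (W 0)) * cnj (1 - v))"
    by (rule arg_cong)
  also have "\<dots> = Re (W 0) * (1 - (norm v)\<^sup>2)"
    unfolding cmod_power2 by (simp add: power2_eq_square algebra_simps)
  finally have re: "Re (W z) * (norm (1 - v))\<^sup>2 = Re (W 0) * (1 - (norm v)\<^sup>2)" by simp
  have "Re (W 0) * (1 - (norm z)\<^sup>2) \<le> Re (W 0) * (1 - (norm v)\<^sup>2)"
    using p v(1) by (intro mult_left_mono) (auto simp: power_mono)
  also have "\<dots> \<le> Re (W z) * (1 + norm z)\<^sup>2"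
    unfolding re[symmetric] using pos[OF z] n2 by (intro mult_left_mono power_mono) auto
  finally have "(1 + norm z) * (Re (W 0) * (1 - norm z)) \<le> (1 + norm z) * ((1 + norm z) * Re (W z))"
    by (simp add: power2_eq_square algebra_simps)
  then show "Re (W 0) * (1 - norm z) \<le> (1 + norm z) * Re (W z)"
    by (rule mult_left_le_imp_le) (simp add: add_pos_nonneg)
qed

text \<open>The unit disc version wants a strictly positive real part, but the real part may vanish
  here. So a constant \<eta> is added and then sent to 0 from the right.\<close>

lemma nonneg_Re_ball:
  assumes W: "W holomorphic_on ball c \<rho>" and pos: "\<And>z. z \<in> ball c \<rho> \<Longrightarrow> 0 \<le> Re (W z)"
    and z: "z \<in> ball c \<rho>"
  shows Borel_Caratheodory_nonneg: "norm (W z - W c) \<le> 2 * Re (W c) * norm (z - c) / (\<rho> - norm (z - c))"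
    and Harnack_centre_le: "Re (W c) * (\<rho> - norm (z - c)) \<le> (\<rho> + norm (z - c)) * Re (W z)"
proof -
  have lt: "norm (z - c) < \<rho>" using z by (simp add: dist_norm norm_minus_commute)
  then have r: "0 < \<rho>" using norm_ge_zero[of "z - c"] by linarith
  define s where "s = norm (z - c)"
  have s: "0 \<le> s" "s < \<rho>" using lt by (auto simp: s_def)
  have step: "norm (W z - W c) \<le> 2 * (Re (W c) + \<eta>) * s / (\<rho> - s)"
      "(Re (W c) + \<eta>) * (\<rho> - s) \<le> (\<rho> + s) * (Re (W z) + \<eta>)" if "0 < \<eta>" for \<eta> :: real
  proof -
    define V where "V u = W (c + of_real \<rho> * u) + of_real \<eta>" for u
    have inb: "c + of_real \<rho> * u \<in> ball c \<rho>" if "norm u < 1" for u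
      using that r by (simp add: dist_norm norm_mult)
    have "(W \<circ> (\<lambda>u. c + of_real \<rho> * u)) holomorphic_on ball 0 1"
      by (rule holomorphic_on_compose_gen[OF _ W]) (use inb in \<open>auto intro!: holomorphic_intros\<close>)
    then have V: "V holomorphic_on ball 0 1"
      unfolding V_def o_def by (intro holomorphic_intros)
    have Vpos: "0 < Re (V u)" if "norm u < 1" for u
      using pos[OF inb[OF that]] \<open>0 < \<eta>\<close> by (simp add: V_def)
    define u where "u = (z - c) / of_real \<rho>"
    have u: "norm u = s / \<rho>" "V u = W z + of_real \<eta>" "norm u < 1"
      using r lt by (simp_all add: u_def V_def s_def norm_divide)
    have V0: "V 0 = W c + of_real \<eta>" by (simp add: V_def)
    have eq: "2 * (Re (W c) + \<eta>) * (s / \<rho>) / (1 - s / \<rho>) = 2 * (Re (W c) + \<eta>) * s / (\<rho> - s)"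
      using r s by (simp add: divide_simps)
    show "norm (W z - W c) \<le> 2 * (Re (W c) + \<eta>) * s / (\<rho> - s)"
      using Harnack_unit(1)[OF V Vpos u(3)] unfolding eq[symmetric] by (simp add: u V0)
    have e: "\<rho> * (1 - s / \<rho>) = \<rho> - s" "\<rho> * (1 + s / \<rho>) = \<rho> + s"
      using r by (simp_all add: algebra_simps)
    have "\<rho> * ((Re (W c) + \<eta>) * (1 - s / \<rho>)) \<le> \<rho> * ((1 + s / \<rho>) * (Re (W z) + \<eta>))"
      using Harnack_unit(2)[OF V Vpos u(3)] r by (intro mult_left_mono) (auto simp: u V0)
    then show "(Re (W c) + \<eta>) * (\<rho> - s) \<le> (\<rho> + s) * (Re (W z) + \<eta>)"
      unfolding mult.left_commute[of \<rho> "Re (W c) + \<eta>"] mult.assoc[symmetric, of \<rho> "1 + s / \<rho>"] e .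
  qed
  have "((\<lambda>\<eta>. 2 * (Re (W c) + \<eta>) * s / (\<rho> - s)) \<longlongrightarrow> 2 * (Re (W c) + 0) * s / (\<rho> - s)) (at_right 0)"
    using s by (intro tendsto_intros) auto
  moreover have "eventually (\<lambda>\<eta>. norm (W z - W c) \<le> 2 * (Re (W c) + \<eta>) * s / (\<rho> - s)) (at_right 0)"
    by (rule eventually_mono[OF eventually_at_right_less]) (rule step(1))
  ultimately have "norm (W z - W c) \<le> 2 * (Re (W c) + 0) * s / (\<rho> - s)"
    by (rule tendsto_lowerbound) auto
  then show "norm (W z - W c) \<le> 2 * Re (W c) * norm (z - c) / (\<rho> - norm (z - c))"
    by (simp add: s_def)
  have "((\<lambda>\<eta>. (\<rho> + s) * (Re (W z) + \<eta>) - (Re (W c) + \<eta>) * (\<rho> - s)) \<longlongrightarrow> (\<rho> + s) * (Re (W z) + 0) - (Re (W c) + 0) * (\<rho> - s)) (at_right 0)"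
    by (intro tendsto_intros)
  moreover have "eventually (\<lambda>\<eta>. 0 \<le> (\<rho> + s) * (Re (W z) + \<eta>) - (Re (W c) + \<eta>) * (\<rho> - s)) (at_right 0)"
    by (rule eventually_mono[OF eventually_at_right_less]) (use step(2) in simp)
  ultimately have "0 \<le> (\<rho> + s) * (Re (W z) + 0) - (Re (W c) + 0) * (\<rho> - s)"
    by (rule tendsto_lowerbound) auto
  then show "Re (W c) * (\<rho> - norm (z - c)) \<le> (\<rho> + norm (z - c)) * Re (W z)"
    by (simp add: s_def)
qed

text \<open>On the disc of half the radius \<open>W - W c\<close> is at most
  \<open>2 * Re (W c)\<close>. Cauchy's inequality with radius \<open>\<rho> / 2\<close> at the
  centre gives the factor 4; with radius \<open>\<rho> / 4\<close> for second derivatives it gives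
  \<open>2 * 2 * 16 = 64\<close>.\<close>

lemma nonneg_Re_near_centre:
  assumes W: "W holomorphic_on ball c \<rho>" and pos: "\<And>z. z \<in> ball c \<rho> \<Longrightarrow> 0 \<le> Re (W z)" and r: "0 < \<rho>"
  shows deriv_centre_le: "norm (deriv W c) \<le> 4 * Re (W c) / \<rho>"
    and Taylor1_centre_le: "norm (z - c) \<le> \<rho> / 4 \<Longrightarrow>
      norm (W z - W c - deriv W c * (z - c)) \<le> 64 * Re (W c) / \<rho>\<^sup>2 * (norm (z - c))\<^sup>2"
proof -
  have p: "0 \<le> Re (W c)" using pos[of c] r by simp
  have half: "norm (W u - W c) \<le> 2 * Re (W c)" if "norm (u - c) \<le> \<rho> / 2" for u
  proof -
    have "norm (u - c) < \<rho>" using that r by linarith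
    then have "norm (W u - W c) \<le> 2 * Re (W c) * norm (u - c) / (\<rho> - norm (u - c))"
      by (intro nonneg_Re_ball[OF W pos]) (auto simp: dist_norm norm_minus_commute)
    also have "\<dots> = 2 * Re (W c) * (norm (u - c) / (\<rho> - norm (u - c)))" by simp
    also have "\<dots> \<le> 2 * Re (W c) * 1" using that r p by (intro mult_left_mono) auto
    finally show ?thesis by simp
  qed
  define V where "V u = W u - W c" for u
  have V: "V holomorphic_on ball c \<rho>" unfolding V_def by (intro holomorphic_intros W)
  have dV: "(V has_field_derivative deriv V u) (at u)" if "u \<in> ball c \<rho>" for u
    using holomorphic_derivI[OF V _ that] by auto
  have deriv_eq: "deriv V u = deriv W u" if "u \<in> ball c \<rho>" for u
  proof -
    have "(W has_field_derivative deriv W u) (at u)" using holomorphic_derivI[OF W _ that] by auto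
    then have "(V has_field_derivative deriv W u) (at u)" unfolding V_def by (auto intro!: derivative_eq_intros)
    then show ?thesis by (rule DERIV_imp_deriv)
  qed
  have Cauchy: "norm ((deriv ^^ n) V u) \<le> fact n * (2 * Re (W c)) / s ^ n"
    if "0 < s" "norm (u - c) + s \<le> \<rho> / 2" for n u s
  proof (rule Cauchy_inequality)
    have sub: "cball u s \<subseteq> ball c \<rho>"
    proof
      fix x assume "x \<in> cball u s"
      then have "dist u x \<le> s" by simp
      moreover have "dist c x \<le> dist c u + dist u x" by (rule dist_triangle)
      ultimately show "x \<in> ball c \<rho>" using that r by (simp add: dist_norm norm_minus_commute)
    qed
    show "V holomorphic_on ball u s" by (rule holomorphic_on_subset[OF V]) (use sub in auto)
    show "continuous_on (cball u s) V"
      by (rule holomorphic_on_imp_continuous_on[OF holomorphic_on_subset[OF V sub]])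
    show "0 < s" by fact
    fix x assume "norm (u - x) = s"
    then have "norm (x - c) \<le> \<rho> / 2"
      using norm_triangle_ineq[of "x - u" "u - c"] that by (simp add: norm_minus_commute)
    then show "norm (V x) \<le> 2 * Re (W c)" unfolding V_def by (rule half)
  qed
  have c: "c \<in> ball c \<rho>" using r by simp
  show "norm (deriv W c) \<le> 4 * Re (W c) / \<rho>"
    using Cauchy[of "\<rho> / 2" c 1] r deriv_eq[OF c] by (simp add: field_simps)
  assume z: "norm (z - c) \<le> \<rho> / 4"
  have "norm ((deriv ^^ 0) V z - (\<Sum>i\<le>1. (deriv ^^ i) V c * (z - c) ^ i / fact i))
      \<le> 64 * Re (W c) / \<rho>\<^sup>2 * norm (z - c) ^ Suc 1 / fact 1"
  proof (rule complex_Taylor)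
    show "convex (cball c (\<rho> / 4))" by simp
    show "c \<in> cball c (\<rho> / 4)" "z \<in> cball c (\<rho> / 4)"
      using r z by (auto simp: dist_norm norm_minus_commute)
    fix x assume x: "x \<in> cball c (\<rho> / 4)"
    then have "norm (x - c) + \<rho> / 4 \<le> \<rho> / 2" by (simp add: dist_norm norm_minus_commute)
    from Cauchy[OF _ this, of 2] r
    show "norm ((deriv ^^ Suc 1) V x) \<le> 64 * Re (W c) / \<rho>\<^sup>2"
      by (simp add: numeral_2_eq_2 field_simps power2_eq_square)
    fix i :: nat
    have "x \<in> ball c \<rho>" using x r by auto
    with holomorphic_higher_deriv[OF V open_ball]
    have "((deriv ^^ i) V has_field_derivative deriv ((deriv ^^ i) V) x) (at x)"
      by (rule holomorphic_derivI[OF _ open_ball])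
    then show "((deriv ^^ i) V has_field_derivative (deriv ^^ Suc i) V x) (at x within cball c (\<rho> / 4))"
      by (simp add: has_field_derivative_at_within)
  qed
  then show "norm (W z - W c - deriv W c * (z - c)) \<le> 64 * Re (W c) / \<rho>\<^sup>2 * (norm (z - c))\<^sup>2"
    using deriv_eq[OF c] by (simp add: V_def power2_eq_square)
qed

section \<open>A Phragmen--Lindelof theorem\<close>

text \<open>The comparison function for the quadrant grows like the power 3/2 of
  \<open>norm z\<close>: more than exponential type, less than the critical exponent 2.
  Multiplication by \<open>1 - \<i>\<close> turns the quadrant into the sector
  \<open>|arg| \<le> \<pi> / 4\<close>, the 1 keeps away from the branch point, and the argument of
  the cube of the root stays within \<open>3 \<pi> / 8\<close>.\<close>

lemma quadrant_csqrt_cube: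
  assumes "0 \<le> Re z" "0 \<le> Im z"
  shows "norm z * sqrt (norm z) / 4 \<le> Re (csqrt (z * (1 - \<i>) + 1) ^ 3)"
proof -
  define w where "w = csqrt (z * (1 - \<i>) + 1)"
  define a b where "a = Re w" and "b = Im w"
  have w2: "w\<^sup>2 = z * (1 - \<i>) + 1" unfolding w_def by (rule power2_csqrt)
  have re: "a\<^sup>2 - b\<^sup>2 = Re z + Im z + 1" using arg_cong[OF w2, of Re]
    by (simp add: a_def b_def power2_eq_square)
  have im: "2 * (a * b) = Im z - Re z" using arg_cong[OF w2, of Im]
    by (simp add: a_def b_def power2_eq_square mult.commute)
  have a0: "0 \<le> a" unfolding a_def w_def by (rule Re_csqrt)
  have ab: "2 * (a * \<bar>b\<bar>) \<le> a\<^sup>2 - b\<^sup>2"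
  proof -
    have "2 * (a * \<bar>b\<bar>) = \<bar>Im z - Re z\<bar>" unfolding im[symmetric] using a0 by (simp add: abs_mult)
    then show ?thesis using re assms by linarith
  qed
  \<comment> \<open>By \<open>ab\<close> the argument of \<open>w\<close> is at most
    \<open>\<pi> / 8\<close>; \<open>1 / 2\<close> is a rough bound for the tangent, good enough to
    keep \<open>a^2 - 3 * b^2\<close> positive.\<close>
  have "\<bar>b\<bar> \<le> a / 2"
  proof (rule ccontr)
    assume "\<not> \<bar>b\<bar> \<le> a / 2"
    then have "a * a \<le> a * (2 * \<bar>b\<bar>)" using a0 by (intro mult_left_mono) auto
    with ab have "b\<^sup>2 \<le> 0" by (simp add: power2_eq_square)
    then show False using \<open>\<not> \<bar>b\<bar> \<le> a / 2\<close> a0 by auto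
  qed
  then have "\<bar>b\<bar>\<^sup>2 \<le> (a / 2)\<^sup>2" by (rule power_mono) simp
  then have b2: "b\<^sup>2 \<le> a\<^sup>2 / 4" by (simp add: power_divide)
  have "norm z \<le> Re z + Im z" using assms cmod_le[of z] by simp
  then have nz: "norm z \<le> a\<^sup>2" using re zero_le_power2[of b] by linarith
  then have "sqrt (norm z) \<le> a" using a0 real_le_lsqrt by blast
  then have "norm z * sqrt (norm z) / 4 \<le> a\<^sup>2 * a / 4"
    using nz a0 by (intro divide_right_mono mult_mono) auto
  also have "\<dots> = a * (a\<^sup>2 - 3 * (a\<^sup>2 / 4))" by (simp add: algebra_simps)
  also have "\<dots> \<le> a * (a\<^sup>2 - 3 * b\<^sup>2)" using a0 b2 by (intro mult_left_mono) auto
  also have "\<dots> = Re (w ^ 3)" by (simp add: a_def b_def power2_eq_square power3_eq_cube algebra_simps)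
  finally show ?thesis by (simp add: w_def)
qed

text \<open>The function \<open>g\<close> is damped by \<open>exp (- \<epsilon> * w)\<close>, the
  maximum principle is applied on a large quarter disc, and \<epsilon> goes to 0 at the fixed point
  \<open>z\<close>.\<close>

lemma Phragmen_Lindelof_quadrant:
  assumes g: "g holomorphic_on UNIV"
    and growth: "\<And>z. 0 \<le> Re z \<Longrightarrow> 0 \<le> Im z \<Longrightarrow> norm (g z) \<le> A * exp (B * norm z)"
    and edges: "\<And>z. 0 \<le> Re z \<Longrightarrow> 0 \<le> Im z \<Longrightarrow> Re z = 0 \<or> Im z = 0 \<Longrightarrow> norm (g z) \<le> M"
    and z: "0 \<le> Re z" "0 \<le> Im z"
  shows "norm (g z) \<le> M"
proof -
  define w where "w u = csqrt (u * (1 - \<i>) + 1) ^ 3" for u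
  have cube: "norm u * sqrt (norm u) / 4 \<le> Re (w u)" if "0 \<le> Re u" "0 \<le> Im u" for u
    using quadrant_csqrt_cube[OF that] by (simp add: w_def)
  have wpos: "0 \<le> Re (w u)" if "0 \<le> Re u" "0 \<le> Im u" for u
    by (rule order_trans[OF _ cube[OF that]]) simp
  have eps: "norm (g z) * exp (- \<epsilon> * Re (w z)) \<le> M + \<epsilon>" if e: "0 < \<epsilon>" for \<epsilon>
  proof -
    \<comment> \<open>The exponent 3/2 beats \<open>B * R\<close> once \<open>sqrt R\<close> is
      large; the extra 1 leaves a factor \<open>exp (- R)\<close> on the arc, which absorbs
      \<open>A\<close>.\<close>
    have "eventually (\<lambda>R. \<bar>B\<bar> + 1 \<le> \<epsilon> * sqrt R / 4) at_top"
      using e by real_asymp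
    moreover have "eventually (\<lambda>R. \<bar>A\<bar> * exp (- R) \<le> \<epsilon>) at_top"
    proof -
      have "((\<lambda>R. \<bar>A\<bar> * exp (- R)) \<longlongrightarrow> 0) at_top" by real_asymp
      then show ?thesis using e by (auto dest!: order_tendstoD(2) elim: eventually_mono)
    qed
    ultimately have "eventually (\<lambda>R. \<bar>B\<bar> + 1 \<le> \<epsilon> * sqrt R / 4 \<and> \<bar>A\<bar> * exp (- R) \<le> \<epsilon> \<and> norm z \<le> R \<and> 0 < R) at_top"
      using eventually_ge_at_top[of "norm z"] eventually_gt_at_top[of 0] by eventually_elim auto
    then obtain R where R: "\<bar>B\<bar> + 1 \<le> \<epsilon> * sqrt R / 4" "\<bar>A\<bar> * exp (- R) \<le> \<epsilon>" "norm z \<le> R" "0 < R"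
      by (auto simp: eventually_at_top_linorder)
    define S where "S = {u. 0 \<le> Re u \<and> 0 \<le> Im u \<and> norm u \<le> R}"
    define T where "T = {u. 0 < Re (u * (1 - \<i>) + 1)}"
    define F where "F u = g u * exp (- of_real \<epsilon> * w u)" for u
    have nF: "norm (F u) = norm (g u) * exp (- \<epsilon> * Re (w u))" for u
      by (simp add: F_def norm_mult)
    have FT: "F holomorphic_on T" unfolding F_def w_def T_def
      by (intro holomorphic_intros holomorphic_on_subset[OF g]) (auto simp: complex_nonpos_Reals_iff)
    have ST: "S \<subseteq> T" by (auto simp: S_def T_def)
    have clS: "closed S" unfolding S_def
      by (intro closed_Collect_conj closed_Collect_le continuous_intros)
    have "norm (F z) \<le> M + \<epsilon>"
    proof (rule maximum_modulus_frontier[where S = S and f = F])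
      show "F holomorphic_on interior S"
        by (rule holomorphic_on_subset[OF FT]) (use ST interior_subset[of S] in auto)
      show "continuous_on (closure S) F"
        using holomorphic_on_imp_continuous_on[OF holomorphic_on_subset[OF FT ST]] clS by simp
      show "bounded S" by (rule boundedI[of _ R]) (auto simp: S_def)
      show "z \<in> S" using z R by (simp add: S_def)
      fix u assume "u \<in> frontier S"
      then have uS: "u \<in> S" and ui: "u \<notin> interior S" using clS by (auto simp: frontier_def)
      have u: "0 \<le> Re u" "0 \<le> Im u" "norm u \<le> R" using uS by (auto simp: S_def)
      have "\<not> (0 < Re u \<and> 0 < Im u \<and> norm u < R)"
      proof
        assume *: "0 < Re u \<and> 0 < Im u \<and> norm u < R"
        have "open {u. 0 < Re u \<and> 0 < Im u \<and> norm u < R}"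
          by (intro open_Collect_conj open_Collect_less continuous_intros)
        moreover have "{u. 0 < Re u \<and> 0 < Im u \<and> norm u < R} \<subseteq> S" by (auto simp: S_def)
        ultimately have "{u. 0 < Re u \<and> 0 < Im u \<and> norm u < R} \<subseteq> interior S"
          by (intro interior_maximal)
        then show False using * ui by auto
      qed
      then consider "Re u = 0 \<or> Im u = 0" | "norm u = R" using u by linarith
      then show "norm (F u) \<le> M + \<epsilon>"
      proof cases
        case 1
        have "norm (F u) \<le> norm (g u) * 1" unfolding nF
          using e wpos[OF u(1,2)] by (intro mult_left_mono) auto
        then show ?thesis using edges[OF u(1,2) 1] e by simp
      next
        case 2
        have "R * (\<bar>B\<bar> + 1) \<le> R * (\<epsilon> * sqrt R / 4)" using R by (intro mult_left_mono) auto
        also have "\<dots> \<le> \<epsilon> * Re (w u)"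
          using mult_left_mono[OF cube[OF u(1,2)], of \<epsilon>] e by (simp add: 2 mult_ac)
        finally have "\<bar>B\<bar> * R + R \<le> \<epsilon> * Re (w u)" by (simp add: algebra_simps)
        moreover have "B * R \<le> \<bar>B\<bar> * R" using R(4) by (intro mult_right_mono) auto
        ultimately have exponent: "B * R - \<epsilon> * Re (w u) \<le> - R" by linarith
        have "norm (F u) \<le> (A * exp (B * R)) * exp (- \<epsilon> * Re (w u))" unfolding nF
          using growth[OF u(1,2)] by (intro mult_right_mono) (auto simp: 2)
        also have "\<dots> = A * exp (B * R - \<epsilon> * Re (w u))" by (simp add: mult.assoc exp_add[symmetric])
        also have "\<dots> \<le> \<bar>A\<bar> * exp (- R)" using exponent by (intro mult_mono) auto
        also have "\<dots> \<le> M + \<epsilon>"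
          using R(2) order_trans[OF norm_ge_zero edges[of 0]] by simp
        finally show ?thesis .
      qed
    qed
    then show ?thesis by (simp add: nF)
  qed
  have "((\<lambda>\<epsilon>. M + \<epsilon> - norm (g z) * exp (- \<epsilon> * Re (w z))) \<longlongrightarrow> M + 0 - norm (g z) * exp (- 0 * Re (w z))) (at_right 0)"
    by (intro tendsto_intros)
  moreover have "eventually (\<lambda>\<epsilon>. 0 \<le> M + \<epsilon> - norm (g z) * exp (- \<epsilon> * Re (w z))) (at_right 0)"
    by (rule eventually_mono[OF eventually_at_right_less]) (use eps in simp)
  ultimately have "0 \<le> M + 0 - norm (g z) * exp (- 0 * Re (w z))"
    by (rule tendsto_lowerbound) auto
  then show ?thesis by simp
qed

text \<open>The factor \<open>exp (\<i> * B * u)\<close> has modulus 1 on the real axis and cancels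
  the allowed growth on the positive imaginary axis, so \<open>g\<close> is bounded on the edges of
  both upper quadrants. The rotation \<open>u -> \<i> * u\<close> reduces the second quadrant to the
  first.\<close>

lemma exponential_type_bounded_upper_half:
  assumes f: "f holomorphic_on UNIV" and growth: "\<And>z. norm (f z) \<le> A * exp (B * norm z)"
    and bdd: "\<And>x::real. norm (f (of_real x)) \<le> M" and z: "0 \<le> Im z"
  shows "norm (f z) \<le> max A M * exp (B * Im z)"
proof -
  define g where "g u = f u * exp (\<i> * of_real B * u)" for u
  have ng: "norm (g u) = norm (f u) * exp (- B * Im u)" for u by (simp add: g_def norm_mult)
  have A0: "0 \<le> A" using order_trans[OF norm_ge_zero growth[of 0]] by simp
  have g: "g holomorphic_on UNIV" unfolding g_def by (intro holomorphic_intros f)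
  have g_growth: "norm (g u) \<le> A * exp ((2 * \<bar>B\<bar>) * norm u)" for u
  proof -
    have "- B * Im u \<le> \<bar>B\<bar> * \<bar>Im u\<bar>" by (metis abs_ge_self abs_minus_cancel abs_mult)
    also have "\<dots> \<le> \<bar>B\<bar> * norm u" by (intro mult_left_mono abs_Im_le_cmod) auto
    finally have "B * norm u + - B * Im u \<le> (2 * \<bar>B\<bar>) * norm u"
      using mult_right_mono[OF abs_ge_self[of B] norm_ge_zero[of u]] by linarith
    then have "A * exp (B * norm u + - B * Im u) \<le> A * exp ((2 * \<bar>B\<bar>) * norm u)"
      using A0 by (intro mult_left_mono) auto
    moreover have "norm (g u) \<le> (A * exp (B * norm u)) * exp (- B * Im u)" unfolding ng
      by (intro mult_right_mono growth) auto
    moreover have "(A * exp (B * norm u)) * exp (- B * Im u) = A * exp (B * norm u + - B * Im u)"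
      by (simp only: mult.assoc exp_add)
    ultimately show ?thesis by linarith
  qed
  have imag: "norm (g u) \<le> max A M" if "Re u = 0" "0 \<le> Im u" for u
  proof -
    have "norm u = Im u" using that by (simp add: cmod_def)
    then have "norm (g u) \<le> (A * exp (B * Im u)) * exp (- B * Im u)" unfolding ng
      using growth[of u] by (intro mult_right_mono) auto
    then show ?thesis by (simp add: mult.assoc exp_add[symmetric])
  qed
  have real: "norm (g u) \<le> max A M" if "Im u = 0" for u
  proof -
    have "u = of_real (Re u)" using that by (simp add: complex_eq_iff)
    then have "norm (f u) \<le> M" using bdd[of "Re u"] by simp
    then show ?thesis using that by (simp add: ng)
  qed
  have "norm (g z) \<le> max A M"
  proof (cases "0 \<le> Re z")
    case True
    show ?thesis by (rule Phragmen_Lindelof_quadrant[OF g g_growth _ True z]) (use imag real in auto)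
  next
    case False
    define k where "k u = g (\<i> * u)" for u
    have "(g \<circ> (\<lambda>u. \<i> * u)) holomorphic_on UNIV"
      by (rule holomorphic_on_compose_gen[OF _ g]) (auto intro!: holomorphic_intros)
    then have k: "k holomorphic_on UNIV" by (simp add: k_def[abs_def] o_def)
    have kg: "norm (k u) \<le> A * exp ((2 * \<bar>B\<bar>) * norm u)" for u
      using g_growth[of "\<i> * u"] by (simp add: k_def norm_mult)
    have "norm (k (- \<i> * z)) \<le> max A M"
      by (rule Phragmen_Lindelof_quadrant[OF k kg]) (use imag real z False in \<open>auto simp: k_def\<close>)
    then show ?thesis by (simp add: k_def)
  qed
  then have "norm (f z) * exp (- B * Im z) * exp (B * Im z) \<le> max A M * exp (B * Im z)"
    unfolding ng by (intro mult_right_mono) auto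
  then show ?thesis by (simp add: mult.assoc exp_add[symmetric])
qed

lemma exponential_type_bounded_on_reals:
  assumes f: "f holomorphic_on UNIV" and "exponential_type f"
    and bdd: "\<And>x::real. norm (f (of_real x)) \<le> M"
  obtains C B where "0 < C" "\<And>z. norm (f z) \<le> C * exp (B * \<bar>Im z\<bar>)"
proof -
  obtain A B where growth: "\<And>z. norm (f z) \<le> A * exp (B * norm z)"
    using assms(2) unfolding exponential_type_def by blast
  define h where "h u = f (- u)" for u
  have "(f \<circ> uminus) holomorphic_on UNIV"
    by (rule holomorphic_on_compose_gen[OF _ f]) (auto intro!: holomorphic_intros)
  then have h: "h holomorphic_on UNIV" by (simp add: h_def[abs_def] o_def)
  have hg: "norm (h u) \<le> A * exp (B * norm u)" for u using growth[of "- u"] by (simp add: h_def)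
  have hb: "norm (h (of_real x)) \<le> M" for x :: real using bdd[of "- x"] by (simp add: h_def)
  define C where "C = max A M + 1"
  have "0 \<le> M" using bdd[of 0] norm_ge_zero order_trans by blast
  then have C0: "0 < C" by (simp add: C_def)
  have "norm (f z) \<le> C * exp (B * \<bar>Im z\<bar>)" for z
  proof -
    have "norm (f z) \<le> max A M * exp (B * \<bar>Im z\<bar>)"
    proof (cases "0 \<le> Im z")
      case True then show ?thesis using exponential_type_bounded_upper_half[OF f growth bdd True] by simp
    next
      case False then show ?thesis
        using exponential_type_bounded_upper_half[OF h hg hb, of "- z"] by (simp add: h_def)
    qed
    also have "\<dots> \<le> C * exp (B * \<bar>Im z\<bar>)" by (intro mult_right_mono) (auto simp: C_def)
    finally show ?thesis .
  qed
  with C0 show thesis by (rule that)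
qed

section \<open>Blaschke factorization in a disc\<close>

text \<open>\<open>- W\<close> is a logarithm of \<open>f\<close> divided by its Blaschke product
  and by \<open>exp q\<close>. This quotient has no zeros in the disc and modulus at most 1 on the
  circle, hence inside. The identity is stated without division so that it also holds at the zeros.
  Only continuity of \<open>q\<close> is asked for on the circle, since the outer function used
  later is not holomorphic there.\<close>

lemma disc_Blaschke_factorization:
  fixes c :: complex and m :: "complex \<Rightarrow> nat"
  defines "A \<rho> \<equiv> {a. 0 < m a \<and> a \<in> ball c \<rho>}"
  assumes f: "f holomorphic_on UNIV" and m: "is_zero_set m f" and r: "0 < \<rho>" and fin: "finite (A \<rho>)"
    and q: "q holomorphic_on ball c \<rho>" "continuous_on (cball c \<rho>) q"
    and le: "\<And>z. norm (z - c) = \<rho> \<Longrightarrow> norm (f z) \<le> exp (Re (q z))"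
  obtains W where "W holomorphic_on ball c \<rho>" "\<And>z. z \<in> ball c \<rho> \<Longrightarrow> 0 \<le> Re (W z)"
    "\<And>z. z \<in> ball c \<rho> \<Longrightarrow> f z * (\<Prod>a\<in>A \<rho>. ((of_real (\<rho>\<^sup>2) - cnj (a - c) * (z - c)) / of_real \<rho>) ^ m a) =
       exp (q z - W z) * (\<Prod>a\<in>A \<rho>. (z - a) ^ m a)"
proof -
  obtain h where h: "h holomorphic_on UNIV" "\<And>z. f z = (\<Prod>a\<in>A \<rho>. (z - a) ^ m a) * h z"
    "is_zero_set (\<lambda>z. if z \<in> A \<rho> then 0 else m z) h"
    using is_zero_set_divide_finite[OF f m fin] by blast
  define P where "P z = (\<Prod>a\<in>A \<rho>. ((of_real (\<rho>\<^sup>2) - cnj (a - c) * (z - c)) / of_real \<rho>) ^ m a)" for z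
  define g where "g z = h z * P z * exp (- q z)" for z
  have P: "P holomorphic_on S" for S unfolding P_def by (intro holomorphic_intros) (use r in auto)
  have g: "g holomorphic_on ball c \<rho>" unfolding g_def
    by (intro holomorphic_intros P q holomorphic_on_subset[OF h(1)]) auto
  have gc: "continuous_on (cball c \<rho>) g" unfolding g_def
    by (intro continuous_intros q holomorphic_on_imp_continuous_on P holomorphic_on_subset[OF h(1)]) auto
  have bd: "norm (g z) \<le> 1" if z: "norm (z - c) = \<rho>" for z
  proof -
    have "norm ((of_real (\<rho>\<^sup>2) - cnj (a - c) * (z - c)) / of_real \<rho>) = norm (z - a)" for a
    proof -
      \<comment> \<open>On the circle \<open>\<rho>^2\<close> equals
        \<open>(z - c) * cnj (z - c)\<close>, which turns the Blaschke denominator into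
        \<open>z - c\<close> times the conjugate of \<open>z - a\<close>.\<close>
      have "complex_of_real (\<rho>\<^sup>2) = (z - c) * cnj (z - c)"
        using complex_norm_square[of "z - c"] z by simp
      then have "of_real (\<rho>\<^sup>2) - cnj (a - c) * (z - c) = (z - c) * cnj (z - a)"
        by (simp add: algebra_simps)
      then have "norm (of_real (\<rho>\<^sup>2) - cnj (a - c) * (z - c)) = \<rho> * norm (z - a)"
        by (metis complex_mod_cnj norm_mult z)
      then show ?thesis using r by (simp add: norm_divide)
    qed
    then have "norm (P z) = norm (\<Prod>a\<in>A \<rho>. (z - a) ^ m a)"
      by (simp add: P_def prod_norm[symmetric] norm_power)
    then have "norm (g z) = norm (f z) * exp (- Re (q z))"
      by (simp add: g_def h(2) norm_mult)
    also have "\<dots> \<le> exp (Re (q z)) * exp (- Re (q z))" by (intro mult_right_mono le z) auto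
    finally show ?thesis by (simp add: exp_add[symmetric])
  qed
  have g1: "norm (g z) \<le> 1" if "z \<in> cball c \<rho>" for z
    by (rule maximum_modulus_frontier[of g "cball c \<rho>"])
      (use g gc bd that r in \<open>auto simp: dist_norm norm_minus_commute\<close>)
  have Pnz: "P z \<noteq> 0" if z: "z \<in> ball c \<rho>" for z
  proof -
    have "of_real (\<rho>\<^sup>2) - cnj (a - c) * (z - c) \<noteq> 0" if a: "a \<in> A \<rho>" for a
    proof
      assume "of_real (\<rho>\<^sup>2) - cnj (a - c) * (z - c) = 0"
      then have "norm (complex_of_real (\<rho>\<^sup>2)) = norm (cnj (a - c) * (z - c))" by simp
      then have "\<rho> * \<rho> = norm (a - c) * norm (z - c)"
        unfolding norm_mult complex_mod_cnj norm_of_real by (simp add: power2_eq_square)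
      moreover have "norm (a - c) * norm (z - c) < \<rho> * \<rho>"
        using a z by (intro mult_strict_mono') (auto simp: A_def dist_norm norm_minus_commute)
      ultimately show False by simp
    qed
    then show ?thesis using fin r by (simp add: P_def)
  qed
  have hnz: "h z \<noteq> 0" if "z \<in> ball c \<rho>" for z
    using is_zero_set_zero_iff[OF h(3), of z] that by (auto simp: A_def)
  have gnz: "g z \<noteq> 0" if "z \<in> ball c \<rho>" for z using Pnz hnz that by (simp add: g_def)
  obtain l where l: "l holomorphic_on ball c \<rho>" "\<And>z. z \<in> ball c \<rho> \<Longrightarrow> g z = exp (l z)"
    using contractible_imp_holomorphic_log[OF g _ gnz] by (metis convex_ball convex_imp_contractible)
  show thesis
  proof (rule that[of "\<lambda>z. - l z"])
    show "(\<lambda>z. - l z) holomorphic_on ball c \<rho>" by (intro holomorphic_intros l)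
    fix z assume z: "z \<in> ball c \<rho>"
    show "0 \<le> Re (- l z)" using g1[of z] l(2)[OF z] z by simp
    have "exp (q z - - l z) = exp (q z) * g z" using l(2)[OF z] by (simp add: exp_add)
    also have "\<dots> = h z * P z" by (simp add: g_def exp_minus)
    finally show "f z * (\<Prod>a\<in>A \<rho>. ((of_real (\<rho>\<^sup>2) - cnj (a - c) * (z - c)) / of_real \<rho>) ^ m a) =
        exp (q z - - l z) * (\<Prod>a\<in>A \<rho>. (z - a) ^ m a)"
      by (simp add: h(2) P_def mult_ac)
  qed
qed

section \<open>The holomorphic extension of |Im z| from the circle\<close>

text \<open>The Schwarz integral of \<open>|Im z|\<close> over the unit circle, summed from its Taylor series
  \<open>2 / \<pi> - (4 / \<pi>) \<Sum> z\<^bsup>2k\<^esup> / (4 k\<^sup>2 - 1)\<close>. At \<open>z = 1\<close> and \<open>z = -1\<close> the formula gives the right value 0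
  only through the junk values of division and \<open>Ln\<close>.\<close>
definition abs_Im_ext :: "complex \<Rightarrow> complex" where
  "abs_Im_ext z = (if z = 0 then 2 / pi else (1 / z - z) * Ln ((1 + z) / (1 - z)) / pi)"

lemma abs_Im_ext_0 [simp]: "abs_Im_ext 0 = 2 / pi"
  by (simp add: abs_Im_ext_def)

lemma Re_Cayley: "Re ((1 + z) / (1 - z)) = (1 - (norm z)\<^sup>2) / (norm (1 - z))\<^sup>2"
  and Im_Cayley: "Im ((1 + z) / (1 - z)) = 2 * Im z / (norm (1 - z))\<^sup>2"
  unfolding cmod_power2 by (simp_all add: Re_divide Im_divide power2_eq_square algebra_simps)

lemma Cayley_nonpos_Reals:
  fixes z :: complex
  assumes "norm z \<le> 1" "z \<noteq> 1" "z \<noteq> -1"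
  shows "(1 + z) / (1 - z) \<notin> \<real>\<^sub>\<le>\<^sub>0"
proof
  assume "(1 + z) / (1 - z) \<in> \<real>\<^sub>\<le>\<^sub>0"
  then have "Re ((1 + z) / (1 - z)) \<le> 0" "Im ((1 + z) / (1 - z)) = 0"
    by (auto simp: complex_nonpos_Reals_iff)
  moreover have "0 \<le> Re ((1 + z) / (1 - z))"
    unfolding Re_Cayley using assms(1) by (intro divide_nonneg_nonneg) (auto simp: power_le_one)
  ultimately have "(1 + z) / (1 - z) = 0" by (simp add: complex_eq_iff)
  then show False using assms by (auto simp: add_eq_0_iff)
qed

text \<open>On the circle \<open>1 / z - z\<close> equals \<open>-2 * \<i> * Im z\<close> and the
  Cayley quotient is purely imaginary with the sign of \<open>Im z\<close>, so the imaginary part of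
  its logarithm is \<open>\<pi> / 2\<close> with that sign.\<close>

lemma Re_abs_Im_ext:
  assumes "norm z = 1"
  shows "Re (abs_Im_ext z) = \<bar>Im z\<bar>"
proof (cases "Im z = 0")
  case True
  then have "z = 1 \<or> z = -1" using assms by (auto simp: complex_eq_iff cmod_def abs_if split: if_splits)
  then show ?thesis by (auto simp: abs_Im_ext_def)
next
  case False
  then have ne: "z \<noteq> 0" "1 - z \<noteq> 0" by auto
  define t where "t = 2 * Im z / (norm (1 - z))\<^sup>2"
  have t: "(1 + z) / (1 - z) = of_real t * \<i>"
    by (rule complex_eqI) (use assms in \<open>simp_all only: Re_Cayley Im_Cayley t_def\<close>, simp_all)
  have sg: "t > 0 \<longleftrightarrow> Im z > 0" "t \<noteq> 0" using False ne by (auto simp: t_def zero_less_divide_iff)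
  have "z * cnj z = 1" using complex_norm_square[of z] assms by simp
  then have "1 / z = cnj z" using ne by (simp add: field_simps)
  then have e: "1 / z - z = - 2 * of_real (Im z) * \<i>" by (simp add: complex_eq_iff)
  have Im_Ln: "Im (Ln (of_real t * \<i>)) = (if Im z > 0 then pi / 2 else - pi / 2)"
  proof (cases "Im z > 0")
    case True
    then have "0 < t" using sg by simp
    then show ?thesis using True by (simp add: Ln_times_of_real)
  next
    case False
    then have "0 < - t" using sg by linarith
    then show ?thesis using False Ln_times_of_real[of "- t" "- \<i>"] Ln_of_real[of "- t"] by simp
  qed
  have "abs_Im_ext z = - 2 * of_real (Im z) * \<i> * Ln (of_real t * \<i>) / pi"
    using ne by (simp only: abs_Im_ext_def e t) simp
  then have "Re (abs_Im_ext z) = 2 * Im z * Im (Ln (of_real t * \<i>)) / pi" by simp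
  then show ?thesis unfolding Im_Ln by (simp add: abs_if)
qed

text \<open>At 1 and -1 the simple zero of \<open>1 - z^2\<close> has to beat the logarithm; for
  this a bound by any power weaker than \<open>1 / x\<close> is enough.\<close>

lemma abs_ln_le_sqrt:
  assumes "0 < x" "x \<le> 2"
  shows "\<bar>ln x\<bar> \<le> 2 / sqrt x"
proof -
  have "ln (1 / sqrt x) \<le> 1 / sqrt x - 1" using assms by (intro ln_le_minus_one) auto
  moreover have "ln (1 / sqrt x) = - ln x / 2" using assms by (simp add: ln_div ln_sqrt)
  ultimately have "- ln x \<le> 2 / sqrt x" by simp
  moreover have "ln x \<le> 2 / sqrt x"
  proof -
    have "ln x \<le> 1" using ln_le_minus_one[of x] assms by simp
    also have "sqrt x \<le> 2" using assms real_sqrt_le_mono[of x 4] by simp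
    then have "1 \<le> 2 / sqrt x" using assms by simp
    finally show ?thesis .
  qed
  ultimately show ?thesis by linarith
qed

lemma norm_abs_Im_ext_le:
  assumes z: "norm z \<le> 1" "1 / 2 \<le> norm z"
  shows "norm (abs_Im_ext z) \<le> 28 * sqrt (norm (1 - z\<^sup>2))"
proof (cases "z = 1 \<or> z = -1")
  case True then show ?thesis by (auto simp: abs_Im_ext_def)
next
  case False
  define a b where "a = norm (1 - z)" and "b = norm (1 + z)"
  have ab: "0 < a" "a \<le> 2" "0 < b" "b \<le> 2"
    using False norm_triangle_ineq4[of 1 z] norm_triangle_ineq[of 1 z] z
    by (auto simp: a_def b_def add_eq_0_iff)
  define w where "w = (1 + z) / (1 - z)"
  have w0: "w \<noteq> 0" using ab by (auto simp: w_def a_def b_def)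
  have "norm (Ln w) \<le> \<bar>Re (Ln w)\<bar> + \<bar>Im (Ln w)\<bar>" by (rule cmod_le)
  also have "Re (Ln w) = ln b - ln a" using w0 ab by (simp add: w_def norm_divide ln_div a_def b_def)
  also have "\<bar>Im (Ln w)\<bar> \<le> 4"
    using Im_Ln_le_pi[OF w0] mpi_less_Im_Ln[OF w0] pi_less_4 by linarith
  finally have "norm (Ln w) \<le> \<bar>ln a\<bar> + \<bar>ln b\<bar> + 4" by linarith
  also have "\<dots> \<le> 2 / sqrt a + 2 / sqrt b + 4"
    using abs_ln_le_sqrt[of a] abs_ln_le_sqrt[of b] ab by linarith
  finally have L: "norm (Ln w) \<le> 2 / sqrt a + 2 / sqrt b + 4" .
  have "1 - z\<^sup>2 = (1 - z) * (1 + z)" by (simp add: power2_eq_square algebra_simps)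
  then have n: "norm (1 - z\<^sup>2) = a * b" by (simp add: norm_mult a_def b_def)
  have "1 / z - z = (1 - z\<^sup>2) / z" 
    using z by (cases "z = 0") (simp_all add: diff_divide_distrib power2_eq_square)
  then have "norm (1 / z - z) = a * b / norm z" by (simp add: norm_divide n)
  also have "\<dots> \<le> a * b / (1 / 2)" using z ab by (intro divide_left_mono) auto
  finally have n2: "norm (1 / z - z) \<le> 2 * (a * b)" by simp
  have "z \<noteq> 0" using z by auto
  then have "norm (abs_Im_ext z) = norm (1 / z - z) * norm (Ln w) / pi"
    by (simp add: abs_Im_ext_def w_def norm_mult norm_divide)
  also have "\<dots> \<le> norm (1 / z - z) * norm (Ln w) / 1"
    using pi_gt3 by (intro divide_left_mono) auto
  also have "\<dots> \<le> (2 * (a * b)) * (2 / sqrt a + 2 / sqrt b + 4)"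
    using n2 L by (simp add: mult_mono')
  also have "\<dots> = sqrt (a * b) * (4 * (sqrt b + sqrt a + 2 * sqrt (a * b)))"
  proof -
    define s t where "s = sqrt a" and "t = sqrt b"
    have st: "s * s = a" "t * t = b" "s \<noteq> 0" "t \<noteq> 0" using ab by (auto simp: s_def t_def)
    have "(2 * (a * b)) * (2 / s + 2 / t + 4) = s * t * (4 * (t + s + 2 * (s * t)))"
      unfolding st(1,2)[symmetric] using st(3,4) by (simp add: field_simps)
    then show ?thesis by (simp add: s_def t_def real_sqrt_mult)
  qed
  finally have A: "norm (abs_Im_ext z) \<le> sqrt (a * b) * (4 * (sqrt b + sqrt a + 2 * sqrt (a * b)))" .
  \<comment> \<open>With these bounds the bracket is at most
    \<open>4 * (3/2 + 3/2 + 2 * 2) = 28\<close>.\<close>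
  have "sqrt a \<le> 3 / 2" "sqrt b \<le> 3 / 2"
    using ab by (auto intro!: real_le_lsqrt simp: power_divide simp del: le_divide_eq_numeral1)
  moreover have "sqrt (a * b) \<le> 2"
    using mult_mono[of a 2 b 2] ab by (auto intro!: real_le_lsqrt)
  moreover have "4 * (t + s + 2 * p) \<le> 28" if "s \<le> 3 / 2" "t \<le> 3 / 2" "p \<le> 2" for s t p :: real
    using add_mono[OF add_mono[OF that(2,1)] mult_left_mono[OF that(3), of 2]] by simp
  ultimately have "4 * (sqrt b + sqrt a + 2 * sqrt (a * b)) \<le> 28" by blast
  then have "sqrt (a * b) * (4 * (sqrt b + sqrt a + 2 * sqrt (a * b))) \<le> sqrt (a * b) * 28"
    using ab by (intro mult_left_mono) auto
  with A show ?thesis by (simp add: n)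
qed

text \<open>At 0 the logarithm has a simple zero with derivative 2, which cancels the pole of
  \<open>1 / z - z\<close> and explains the value \<open>2 / \<pi>\<close>.\<close>

lemma holomorphic_abs_Im_ext: "abs_Im_ext holomorphic_on ball 0 1"
proof -
  define L where "L z = Ln ((1 + z) / (1 - z))" for z :: complex
  have ne: "z \<noteq> 1" "z \<noteq> -1" if "z \<in> ball 0 1" for z :: complex using that by auto
  have L: "L holomorphic_on ball 0 1" unfolding L_def
    by (intro holomorphic_intros Cayley_nonpos_Reals) (use ne in auto)
  have "(L has_field_derivative 2) (at 0)"
    unfolding L_def by (rule derivative_eq_intros refl | simp)+
  then have d: "deriv L 0 = 2" by (rule DERIV_imp_deriv)
  have "(\<lambda>z. if z = 0 then deriv L 0 else (L z - L 0) / (z - 0)) holomorphic_on ball 0 1"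
    by (rule pole_lemma[OF L]) simp
  then have "(\<lambda>z. (1 - z\<^sup>2) * (if z = 0 then deriv L 0 else (L z - L 0) / (z - 0)) / pi) holomorphic_on ball 0 1"
    by (intro holomorphic_intros) auto
  moreover have "(1 - z\<^sup>2) * (if z = 0 then deriv L 0 else (L z - L 0) / (z - 0)) / pi = abs_Im_ext z" for z
    by (auto simp: d L_def abs_Im_ext_def field_simps power2_eq_square)
  ultimately show ?thesis by simp
qed

lemma continuous_on_abs_Im_ext: "continuous_on (cball 0 1) abs_Im_ext"
  unfolding continuous_on_eq_continuous_within
proof
  fix z :: complex assume z: "z \<in> cball 0 1"
  show "continuous (at z within cball 0 1) abs_Im_ext"
  proof (cases "norm z = 1")
    case False
    then have "z \<in> ball 0 1" using z by auto
    then have "isCont abs_Im_ext z"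
      using holomorphic_on_imp_continuous_on[OF holomorphic_abs_Im_ext] by (simp add: continuous_on_eq_continuous_at)
    then show ?thesis by (rule continuous_at_imp_continuous_at_within)
  next
    case True
    show ?thesis
    proof (cases "z = 1 \<or> z = -1")
      case False
      define S where "S = cball 0 1 \<inter> - {0, 1, -1 :: complex}"
      have "continuous_on S (\<lambda>z. (1 / z - z) * Ln ((1 + z) / (1 - z)) / pi)"
        by (intro continuous_intros Cayley_nonpos_Reals) (auto simp: S_def)
      then have "continuous_on S abs_Im_ext"
        by (rule continuous_on_eq) (auto simp: S_def abs_Im_ext_def)
      moreover have "z \<in> S" using False True by (auto simp: S_def)
      ultimately have "continuous (at z within S) abs_Im_ext"
        by (simp add: continuous_on_eq_continuous_within)
      moreover have "at z within cball 0 1 = at z within S" unfolding S_def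
        by (rule at_within_nhd[of z "- {0, 1, -1}"]) (use False True in auto)
      ultimately show ?thesis by (simp add: continuous_within)
    next
      case one: True
      then have z2: "z\<^sup>2 = 1" and q0: "abs_Im_ext z = 0" by (auto simp: abs_Im_ext_def)
      have "((\<lambda>w. 28 * sqrt (norm (1 - w\<^sup>2))) \<longlongrightarrow> 28 * sqrt (norm (1 - z\<^sup>2))) (at z within cball 0 1)"
        by (intro tendsto_intros)
      then have lim: "((\<lambda>w. 28 * sqrt (norm (1 - w\<^sup>2))) \<longlongrightarrow> 0) (at z within cball 0 1)"
        by (simp add: z2)
      have "((\<lambda>w. norm w) \<longlongrightarrow> norm z) (at z within cball 0 1)" by (intro tendsto_intros)
      then have "eventually (\<lambda>w. 1 / 2 < norm w) (at z within cball 0 1)"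
        by (rule order_tendstoD) (simp add: True)
      moreover have "eventually (\<lambda>w. w \<in> cball 0 1) (at z within cball 0 1)"
        by (simp add: eventually_at_filter)
      ultimately have "eventually (\<lambda>w. norm (abs_Im_ext w) \<le> 28 * sqrt (norm (1 - w\<^sup>2))) (at z within cball 0 1)"
        by eventually_elim (rule norm_abs_Im_ext_le, auto)
      then have "(abs_Im_ext \<longlongrightarrow> 0) (at z within cball 0 1)"
        by (rule Lim_null_comparison[OF _ lim])
      then show ?thesis by (simp add: continuous_within q0)
    qed
  qed
qed

text \<open>The function is even: \<open>z -> - z\<close> inverts the Cayley quotient and changes
  the sign of both factors. So the derivative at 0 equals its own negative.\<close>

lemma DERIV_abs_Im_ext_0: "(abs_Im_ext has_field_derivative 0) (at 0)"
proof -
  define d where "d = deriv abs_Im_ext 0"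
  have d: "(abs_Im_ext has_field_derivative d) (at 0)"
    unfolding d_def using holomorphic_derivI[OF holomorphic_abs_Im_ext, of 0] by simp
  have "((\<lambda>z. abs_Im_ext (- z)) has_field_derivative - d) (at 0)"
    using DERIV_chain2[of abs_Im_ext d uminus 0 "-1" UNIV] d DERIV_minus[OF DERIV_ident] by auto
  moreover have "abs_Im_ext (- z) = abs_Im_ext z" if "z \<in> ball 0 1" for z
  proof -
    have "Ln (inverse ((1 + z) / (1 - z))) = - Ln ((1 + z) / (1 - z))"
      by (intro Ln_inverse Cayley_nonpos_Reals) (use that in auto)
    then have "Ln ((1 - z) / (1 + z)) = - Ln ((1 + z) / (1 - z))" by simp
    then show ?thesis by (auto simp: abs_Im_ext_def algebra_simps)
  qed
  then have "((\<lambda>z. abs_Im_ext (- z)) has_field_derivative - d) (at 0) \<longleftrightarrow> (abs_Im_ext has_field_derivative - d) (at 0)"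
    by (intro DERIV_cong_ev refl eventually_mono[OF eventually_nhds_in_open[of "ball 0 1"]]) auto
  ultimately have "(abs_Im_ext has_field_derivative - d) (at 0)" by simp
  then have "d = - d" using d DERIV_unique by blast
  then have "d = 0" by simp
  with d show ?thesis by simp
qed

section \<open>Counting zeros\<close>

lemma finite_zeros_ball:
  assumes "no_finite_limit_points m"
  shows "finite {a. 0 < m a \<and> a \<in> ball c r}"
proof (rule finite_subset)
  show "{a. 0 < m a \<and> a \<in> ball c r} \<subseteq> {z. 0 < m z \<and> norm z \<le> norm c + r}"
  proof
    fix a assume a: "a \<in> {a. 0 < m a \<and> a \<in> ball c r}"
    then have "norm a \<le> norm c + norm (a - c)" "norm (a - c) < r"
      using norm_triangle_sub[of a c] by (auto simp: dist_norm norm_minus_commute)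
    then show "a \<in> {z. 0 < m z \<and> norm z \<le> norm c + r}" using a by auto
  qed
qed (use assms in \<open>auto simp: no_finite_limit_points_def\<close>)

definition zeros_in :: "(complex \<Rightarrow> nat) \<Rightarrow> real \<Rightarrow> complex set" where
  "zeros_in m r = {z. 0 < m z \<and> 0 < norm z \<and> norm z < r}"

definition num_zeros :: "(complex \<Rightarrow> nat) \<Rightarrow> real \<Rightarrow> real" where
  "num_zeros m r = (\<Sum>a\<in>zeros_in m r. real (m a))"

definition log_zeros :: "(complex \<Rightarrow> nat) \<Rightarrow> real \<Rightarrow> real" where
  "log_zeros m r = (\<Sum>a\<in>zeros_in m r. real (m a) * ln (r / norm a))"

lemma finite_zeros_in [simp]: "no_finite_limit_points m \<Longrightarrow> finite (zeros_in m r)"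
  by (rule finite_subset[OF _ finite_zeros_ball[of m 0 r]]) (auto simp: zeros_in_def)

lemma zeros_in_mono: "r \<le> s \<Longrightarrow> zeros_in m r \<subseteq> zeros_in m s"
  by (auto simp: zeros_in_def)

lemma num_zeros_nonneg: "0 \<le> num_zeros m r"
  unfolding num_zeros_def by (intro sum_nonneg) auto

lemma num_zeros_mono:
  assumes "no_finite_limit_points m" "r \<le> s"
  shows "num_zeros m r \<le> num_zeros m s"
  unfolding num_zeros_def by (rule sum_mono2) (use assms zeros_in_mono in auto)

lemma log_zeros_term_nonneg: "a \<in> zeros_in m r \<Longrightarrow> 0 \<le> real (m a) * ln (r / norm a)"
  by (auto simp: zeros_in_def intro!: mult_nonneg_nonneg ln_ge_zero)

lemma log_zeros_nonneg: "0 \<le> log_zeros m r"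
  unfolding log_zeros_def by (intro sum_nonneg log_zeros_term_nonneg)

text \<open>\<open>log_zeros m r\<close> is the integral of \<open>num_zeros m t / t\<close> over
  \<open>0 < t < r\<close>. This lemma and \<open>log_zeros_diff_le\<close> bound its increments by
  the values of the increasing function \<open>num_zeros\<close> at the endpoints, but termwise,
  without integration.\<close>

lemma log_zeros_diff_ge:
  assumes m: "no_finite_limit_points m" and rs: "0 < r" "r \<le> s"
  shows "num_zeros m r * ln (s / r) \<le> log_zeros m s - log_zeros m r"
proof -
  have "num_zeros m r * ln (s / r) + log_zeros m r = (\<Sum>a\<in>zeros_in m r. real (m a) * ln (s / norm a))"
    unfolding num_zeros_def log_zeros_def sum_distrib_right sum.distrib[symmetric]
    using rs by (intro sum.cong refl) (auto simp: zeros_in_def ln_div algebra_simps)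
  also have "\<dots> \<le> log_zeros m s" unfolding log_zeros_def
    using zeros_in_mono[OF rs(2)] log_zeros_term_nonneg
    by (intro sum_mono2) (use m in auto)
  finally show ?thesis by simp
qed

lemma log_zeros_mono:
  assumes "no_finite_limit_points m" "0 < r" "r \<le> s"
  shows "log_zeros m r \<le> log_zeros m s"
proof -
  have "0 \<le> num_zeros m r * ln (s / r)" using assms num_zeros_nonneg by simp
  then show ?thesis using log_zeros_diff_ge[OF assms] by simp
qed

lemma log_zeros_diff_le:
  assumes m: "no_finite_limit_points m" and rs: "0 < r" "r \<le> s"
  shows "log_zeros m s - log_zeros m r \<le> num_zeros m s * ln (s / r)"
proof -
  have sub: "zeros_in m r \<subseteq> zeros_in m s" by (rule zeros_in_mono[OF rs(2)])
  have "log_zeros m s = (\<Sum>a\<in>zeros_in m s - zeros_in m r. real (m a) * ln (s / norm a))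
      + (\<Sum>a\<in>zeros_in m r. real (m a) * ln (s / norm a))"
    unfolding log_zeros_def by (rule sum.subset_diff[OF sub]) (use m in simp)
  also have "(\<Sum>a\<in>zeros_in m r. real (m a) * ln (s / norm a)) = log_zeros m r + (\<Sum>a\<in>zeros_in m r. real (m a)) * ln (s / r)"
    unfolding log_zeros_def sum_distrib_right sum.distrib[symmetric]
    using rs by (intro sum.cong refl) (auto simp: zeros_in_def ln_div algebra_simps)
  also have "(\<Sum>a\<in>zeros_in m s - zeros_in m r. real (m a) * ln (s / norm a))
     \<le> (\<Sum>a\<in>zeros_in m s - zeros_in m r. real (m a) * ln (s / r))"
    using rs by (intro sum_mono mult_left_mono) (auto simp: zeros_in_def not_less intro!: divide_left_mono)
  also have "\<dots> = (\<Sum>a\<in>zeros_in m s - zeros_in m r. real (m a)) * ln (s / r)"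
    by (simp add: sum_distrib_right)
  finally have "log_zeros m s - log_zeros m r \<le> ((\<Sum>a\<in>zeros_in m s - zeros_in m r. real (m a))
      + (\<Sum>a\<in>zeros_in m r. real (m a))) * ln (s / r)" by (simp add: algebra_simps)
  also have "(\<Sum>a\<in>zeros_in m s - zeros_in m r. real (m a)) + (\<Sum>a\<in>zeros_in m r. real (m a)) = num_zeros m s"
    unfolding num_zeros_def by (rule sum.subset_diff[OF sub, symmetric]) (use m in simp)
  finally show ?thesis .
qed

lemma zeros_in_empty:
  assumes "no_finite_limit_points m"
  obtains r0 where "0 < r0" "\<And>r. r \<le> r0 \<Longrightarrow> zeros_in m r = {}"
proof -
  obtain e where e: "0 < e" "\<And>a. a \<in> {a. 0 < m a \<and> a \<in> ball 0 1} \<Longrightarrow> a \<noteq> 0 \<Longrightarrow> e \<le> dist 0 a"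
    using finite_set_avoid[OF finite_zeros_ball[OF assms], of 0] by blast
  have "zeros_in m r = {}" if "r \<le> min e 1" for r
    using e(2) that by (force simp: zeros_in_def)
  then show thesis using e(1) by (intro that[of "min e 1"]) auto
qed

definition zero_product :: "(complex \<Rightarrow> nat) \<Rightarrow> real \<Rightarrow> complex \<Rightarrow> complex" where
  "zero_product m R z = z ^ m 0 * (\<Prod>a\<in>zeros_in m R. (1 - z / a) ^ m a)"

definition inverse_sum :: "(complex \<Rightarrow> nat) \<Rightarrow> real \<Rightarrow> complex" where
  "inverse_sum m R = (\<Sum>a\<in>zeros_in m R. of_nat (m a) / a)"

text \<open>The Poisson-Jensen formula in the form used here; at the centre of the disc it becomes
  Jensen's formula.\<close>

lemma ln_norm_Blaschke:
  assumes fin: "finite A" and r: "0 < \<rho>" and fz: "f z \<noteq> 0" and z: "z \<in> ball c \<rho>" and A: "A \<subseteq> ball c \<rho>"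
    and eq: "f z * (\<Prod>a\<in>A. ((of_real (\<rho>\<^sup>2) - cnj (a - c) * (z - c)) / of_real \<rho>) ^ m a) =
       exp (w :: complex) * (\<Prod>a\<in>A. (z - a) ^ m a)"
  shows "ln (norm (f z)) + (\<Sum>a\<in>A. real (m a) * ln (norm (of_real (\<rho>\<^sup>2) - cnj (a - c) * (z - c)) / (\<rho> * norm (z - a)))) = Re w"
proof -
  have N0: "of_real (\<rho>\<^sup>2) - cnj (a - c) * (z - c) \<noteq> 0" if a: "a \<in> A" for a
  proof
    assume "of_real (\<rho>\<^sup>2) - cnj (a - c) * (z - c) = 0"
    then have "norm (complex_of_real (\<rho>\<^sup>2)) = norm (cnj (a - c) * (z - c))" by simp
    then have "\<rho> * \<rho> = norm (a - c) * norm (z - c)"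
      unfolding norm_mult complex_mod_cnj norm_of_real by (simp add: power2_eq_square)
    moreover have "norm (a - c) * norm (z - c) < \<rho> * \<rho>"
      using a z A by (intro mult_strict_mono') (auto simp: dist_norm norm_minus_commute)
    ultimately show False by simp
  qed
  have "f z * (\<Prod>a\<in>A. ((of_real (\<rho>\<^sup>2) - cnj (a - c) * (z - c)) / of_real \<rho>) ^ m a) \<noteq> 0"
    using fz fin N0 r by auto
  then have P: "(\<Prod>a\<in>A. (z - a) ^ m a) \<noteq> 0" unfolding eq by auto
  then have za: "z - a \<noteq> 0 \<or> m a = 0" if "a \<in> A" for a using that fin by auto
  have "ln (norm (f z)) + (\<Sum>a\<in>A. real (m a) * ln (norm (of_real (\<rho>\<^sup>2) - cnj (a - c) * (z - c)) / \<rho>))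
      = ln (norm (f z * (\<Prod>a\<in>A. ((of_real (\<rho>\<^sup>2) - cnj (a - c) * (z - c)) / of_real \<rho>) ^ m a)))"
    using fz N0 r fin by (simp add: norm_mult ln_mult_pos prod_pos prod_norm[symmetric] norm_power norm_divide ln_prod ln_realpow)
  also have "\<dots> = Re w + (\<Sum>a\<in>A. ln (norm ((z - a) ^ m a)))"
  proof -
    have pos: "0 < norm ((z - a) ^ m a)" if "a \<in> A" for a using za[OF that] by auto
    have "norm (exp w * (\<Prod>a\<in>A. (z - a) ^ m a)) = exp (Re w) * (\<Prod>a\<in>A. norm ((z - a) ^ m a))"
      by (simp add: norm_mult prod_norm)
    moreover have "0 < (\<Prod>a\<in>A. norm ((z - a) ^ m a))" using pos by (intro prod_pos) auto
    moreover have "ln (\<Prod>a\<in>A. norm ((z - a) ^ m a)) = (\<Sum>a\<in>A. ln (norm ((z - a) ^ m a)))"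
      using fin pos by (intro ln_prod) auto
    ultimately show ?thesis unfolding eq by (simp only: ln_mult_pos exp_gt_zero ln_exp)
  qed
  also have "(\<Sum>a\<in>A. ln (norm ((z - a) ^ m a))) = (\<Sum>a\<in>A. real (m a) * ln (norm (z - a)))"
    using za by (intro sum.cong refl) (auto simp: norm_power ln_realpow)
  finally have "ln (norm (f z)) + ((\<Sum>a\<in>A. real (m a) * ln (norm (of_real (\<rho>\<^sup>2) - cnj (a - c) * (z - c)) / \<rho>))
      - (\<Sum>a\<in>A. real (m a) * ln (norm (z - a)))) = Re w" by simp
  also have "(\<Sum>a\<in>A. real (m a) * ln (norm (of_real (\<rho>\<^sup>2) - cnj (a - c) * (z - c)) / \<rho>))
      - (\<Sum>a\<in>A. real (m a) * ln (norm (z - a))) =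
      (\<Sum>a\<in>A. real (m a) * ln (norm (of_real (\<rho>\<^sup>2) - cnj (a - c) * (z - c)) / (\<rho> * norm (z - a))))"
    unfolding sum_subtractf[symmetric]
  proof (rule sum.cong[OF refl])
    fix a assume a: "a \<in> A"
    show "real (m a) * ln (norm (of_real (\<rho>\<^sup>2) - cnj (a - c) * (z - c)) / \<rho>) - real (m a) * ln (norm (z - a))
      = real (m a) * ln (norm (of_real (\<rho>\<^sup>2) - cnj (a - c) * (z - c)) / (\<rho> * norm (z - a)))"
    proof (cases "m a = 0")
      case False
      then show ?thesis using za[OF a] N0[OF a] r
        by (simp add: ln_div ln_mult_pos right_diff_distrib[symmetric] del: of_real_power)
    qed simp
  qed
  finally show ?thesis .
qed

lemma Blaschke_norm_identity:
  fixes u v :: complex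
  shows "(norm (of_real (\<rho>\<^sup>2) - cnj v * u))\<^sup>2 - \<rho>\<^sup>2 * (norm (u - v))\<^sup>2 = (\<rho>\<^sup>2 - (norm u)\<^sup>2) * (\<rho>\<^sup>2 - (norm v)\<^sup>2)"
  unfolding cmod_power2 by (simp add: power2_eq_square algebra_simps)

text \<open>The disc is tangent to the real axis at 0, so \<open>exp (\<sigma> Im z)\<close> is a majorant on it; Harnack's
  inequality between \<open>z0\<close> and the centre loses only a factor proportional to \<open>y\<close>.\<close>
lemma half_plane_disc_estimate:
  assumes f: "f holomorphic_on UNIV" and m: "is_zero_set m f" "no_finite_limit_points m"
    and bound: "\<And>z. 0 \<le> Im z \<Longrightarrow> norm (f z) \<le> exp (\<sigma> * Im z)"
    and e: "0 < \<epsilon>" and z0: "0 < Im z0" "exp ((\<sigma> - \<epsilon>) * Im z0) < norm (f z0)"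
    and y: "(norm z0)\<^sup>2 / Im z0 \<le> y"
  defines "A \<equiv> {a. 0 < m a \<and> a \<in> ball (\<i> * of_real y) y}"
  shows "f (\<i> * of_real y) \<noteq> 0 \<Longrightarrow>
      (\<sigma> - 4 * \<epsilon>) * y \<le> ln (norm (f (\<i> * of_real y))) + (\<Sum>a\<in>A. real (m a) * ln (y / norm (a - \<i> * of_real y)))"
    and "(\<Sum>a\<in>A. real (m a) * (2 * y * Im a - (norm a)\<^sup>2)) \<le> 8 * \<epsilon> * y ^ 3"
proof -
  define c where "c = \<i> * complex_of_real y"
  define y0 where "y0 = Im z0"
  have y0: "0 < y0" using z0 by (simp add: y0_def)
  have sq: "(norm (u - c))\<^sup>2 = y\<^sup>2 - (2 * y * Im u - (norm u)\<^sup>2)" for u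
    unfolding cmod_power2 c_def by (simp add: power2_eq_square algebra_simps)
  have z0n: "(norm z0)\<^sup>2 \<le> y * y0" using y y0 by (simp add: y0_def field_simps)
  have "0 < (norm z0)\<^sup>2" using z0(1) by auto
  then have "0 < y * y0" using z0n by linarith
  then have yp: "0 < y" using y0 by (simp add: zero_less_mult_iff)
  define s where "s = norm (z0 - c)"
  \<comment> \<open>Of the term \<open>2 * y * y0\<close> the assumption on \<open>y\<close> lets
    \<open>(norm z0)^2\<close> consume at most half. So \<open>z0\<close> lies in the disc, at
    distance at least \<open>y0 / 2\<close> from its boundary.\<close>
  have s2: "y * y0 \<le> y\<^sup>2 - s\<^sup>2" using sq[of z0] z0n by (simp add: s_def y0_def)
  then have "s\<^sup>2 < y\<^sup>2" using \<open>0 < y * y0\<close> by linarith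
  then have sy: "s < y" using yp by (simp add: power2_less_imp_less)
  have s0: "0 \<le> s" by (simp add: s_def)
  have z0b: "z0 \<in> ball c y" using sy by (simp add: s_def dist_norm norm_minus_commute)
  have Ac: "A = {a. 0 < m a \<and> a \<in> ball c y}" by (simp add: A_def c_def)
  have fin: "finite A" unfolding Ac by (rule finite_zeros_ball[OF m(2)])
  have Im_pos: "0 < 2 * y * Im u - (norm u)\<^sup>2" if "u \<in> ball c y" for u
  proof -
    have "norm (u - c) < y" using that by (simp add: dist_norm norm_minus_commute)
    then have "(norm (u - c))\<^sup>2 < y\<^sup>2" using yp by (simp add: power_strict_mono)
    then show ?thesis using sq[of u] by simp
  qed
  have "\<exists>W. W holomorphic_on ball c y \<and> (\<forall>z\<in>ball c y. 0 \<le> Re (W z)) \<and>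
    (\<forall>z\<in>ball c y. f z * (\<Prod>a\<in>A. ((of_real (y\<^sup>2) - cnj (a - c) * (z - c)) / of_real y) ^ m a) =
       exp (- \<i> * of_real \<sigma> * z - W z) * (\<Prod>a\<in>A. (z - a) ^ m a))"
  proof -
    have le: "norm (f z) \<le> exp (Re (- \<i> * of_real \<sigma> * z))" if "norm (z - c) = y" for z
    proof -
      \<comment> \<open>This is the equation of the circle tangent to the real axis at 0; it forces
        the circle into the closed upper half-plane.\<close>
      have "2 * y * Im z = (norm z)\<^sup>2" using sq[of z] that by simp
      moreover have "0 \<le> (norm z)\<^sup>2" by simp
      ultimately have "0 \<le> Im z" using yp by (metis zero_le_mult_iff mult_pos_pos not_less zero_less_numeral)
      then show ?thesis using bound[of z] by simp
    qed
    have q: "(\<lambda>z. - \<i> * of_real \<sigma> * z) holomorphic_on ball c y"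
        "continuous_on (cball c y) (\<lambda>z. - \<i> * of_real \<sigma> * z)"
      by (intro holomorphic_intros continuous_intros)+
    show ?thesis unfolding Ac
    proof (rule disc_Blaschke_factorization[OF f m(1) yp finite_zeros_ball[OF m(2)] q le], goal_cases)
      case (2 W)
      then show ?case by (intro exI[of _ W]) auto
    qed
  qed
  then obtain W where W: "W holomorphic_on ball c y" "\<And>z. z \<in> ball c y \<Longrightarrow> 0 \<le> Re (W z)"
    and eq: "\<And>z. z \<in> ball c y \<Longrightarrow> f z * (\<Prod>a\<in>A. ((of_real (y\<^sup>2) - cnj (a - c) * (z - c)) / of_real y) ^ m a) =
       exp (- \<i> * of_real \<sigma> * z - W z) * (\<Prod>a\<in>A. (z - a) ^ m a)" by blast
  have sub: "A \<subseteq> ball c y" by (auto simp: Ac)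
  have log: "ln (norm (f z)) + (\<Sum>a\<in>A. real (m a) * ln (norm (of_real (y\<^sup>2) - cnj (a - c) * (z - c)) / (y * norm (z - a)))) = \<sigma> * Im z - Re (W z)"
    if "f z \<noteq> 0" "z \<in> ball c y" for z
    using ln_norm_Blaschke[where f = f and m = m, OF fin yp that sub eq[OF that(2)]] by simp
  define L where "L a = ln (norm (of_real (y\<^sup>2) - cnj (a - c) * (z0 - c)) / (y * norm (z0 - a)))" for a
  have fz0: "f z0 \<noteq> 0" using z0(2) by (auto simp: not_less[symmetric])
  \<comment> \<open>From \<open>ln x \<le> x - 1\<close> with \<open>x = (D / N)^2\<close>: the
    quotient \<open>(N^2 - D^2) / N^2\<close> is bounded below through
    \<open>Blaschke_norm_identity\<close> and \<open>N \<le> 2 * y^2\<close>.\<close>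
  have Lge: "y0 * (2 * y * Im a - (norm a)\<^sup>2) / (8 * y ^ 3) \<le> L a" if a: "a \<in> A" for a
  proof -
    define N where "N = norm (of_real (y\<^sup>2) - cnj (a - c) * (z0 - c))"
    define D where "D = y * norm (z0 - a)"
    define t where "t = 2 * y * Im a - (norm a)\<^sup>2"
    have ab: "a \<in> ball c y" "0 < m a" using a by (auto simp: Ac)
    have t: "0 < t" unfolding t_def by (rule Im_pos[OF ab(1)])
    have "z0 \<noteq> a" using fz0 is_zero_set_zero_iff[OF m(1)] ab by auto
    then have D: "0 < D" using yp by (simp add: D_def)
    have "N\<^sup>2 - D\<^sup>2 = (y\<^sup>2 - s\<^sup>2) * (y\<^sup>2 - (norm (a - c))\<^sup>2)"
      using Blaschke_norm_identity[of y "a - c" "z0 - c"] by (simp add: N_def D_def s_def power_mult_distrib)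
    also have "y\<^sup>2 - (norm (a - c))\<^sup>2 = t" using sq[of a] by (simp add: t_def)
    finally have ND: "N\<^sup>2 - D\<^sup>2 = (y\<^sup>2 - s\<^sup>2) * t" .
    have ge: "(y * y0) * t \<le> N\<^sup>2 - D\<^sup>2" unfolding ND using s2 t by (intro mult_right_mono) auto
    have "N \<le> norm (complex_of_real (y\<^sup>2)) + norm (cnj (a - c) * (z0 - c))" unfolding N_def by (rule norm_triangle_ineq4)
    also have "norm (cnj (a - c) * (z0 - c)) \<le> y * y" unfolding norm_mult complex_mod_cnj
      using ab(1) sy s0 yp by (intro mult_mono) (auto simp: s_def dist_norm norm_minus_commute)
    finally have N2: "N \<le> 2 * y\<^sup>2" unfolding norm_of_real by (simp add: power2_eq_square)
    have "0 \<le> (y * y0) * t" using yp y0 t by simp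
    then have DN: "D\<^sup>2 \<le> N\<^sup>2" using ge by linarith
    then have Np: "0 < N" using D by (smt (verit) N_def norm_ge_zero power2_le_imp_le)
    have "ln ((D / N)\<^sup>2) \<le> (D / N)\<^sup>2 - 1" using D Np by (intro ln_le_minus_one) auto
    moreover have "L a = ln (N / D)" by (simp only: L_def N_def D_def)
    then have "ln ((D / N)\<^sup>2) = - 2 * L a" using D Np by (simp add: ln_realpow ln_div)
    ultimately have "(N\<^sup>2 - D\<^sup>2) / N\<^sup>2 \<le> 2 * L a" using Np by (simp add: diff_divide_distrib power_divide)
    moreover have "(y * y0) * t / (2 * y\<^sup>2)\<^sup>2 \<le> (N\<^sup>2 - D\<^sup>2) / N\<^sup>2"
      using ge N2 Np y0 yp t DN by (intro frac_le power_mono) auto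
    moreover have "(y * y0) * t / (2 * y\<^sup>2)\<^sup>2 = 2 * (y0 * t / (8 * y ^ 3))"
      using yp by (simp add: field_simps power2_eq_square power3_eq_cube)
    ultimately show ?thesis by (simp add: t_def)
  qed
  have Lpos: "0 \<le> L a" if "a \<in> A" for a
  proof -
    have "0 \<le> y0 * (2 * y * Im a - (norm a)\<^sup>2) / (8 * y ^ 3)"
      using Im_pos[of a] that y0 yp by (simp add: Ac)
    then show ?thesis using Lge[OF that] by linarith
  qed
  have "ln (exp ((\<sigma> - \<epsilon>) * y0)) < ln (norm (f z0))"
    using z0(2) fz0 by (subst ln_less_cancel_iff) (auto simp: y0_def)
  then have "(\<sigma> - \<epsilon>) * y0 < ln (norm (f z0))" by simp
  \<comment> \<open>Sharpness at \<open>z0\<close> leaves only \<open>\<epsilon> * y0\<close> for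
    the sum of two nonnegative quantities. Hence it bounds each of them: the first yields the growth
    estimate at the centre, the second the estimate for the zeros.\<close>
  then have small: "Re (W z0) + (\<Sum>a\<in>A. real (m a) * L a) \<le> \<epsilon> * y0"
    using log[OF fz0 z0b] by (simp add: L_def y0_def algebra_simps)
  have sumL: "0 \<le> (\<Sum>a\<in>A. real (m a) * L a)" using Lpos by (intro sum_nonneg mult_nonneg_nonneg) auto
  have W0: "Re (W z0) \<le> \<epsilon> * y0" using small sumL by linarith
  \<comment> \<open>Harnack costs a factor at most \<open>2 * y / (y - s)\<close>, which is at most
    \<open>4 * y / y0\<close>; so \<open>y0\<close> cancels and the bound
    \<open>4 * \<epsilon> * y\<close> does not depend on the point \<open>z0\<close>.\<close>
  have "Re (W c) * (y - s) \<le> (y + s) * Re (W z0)"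
    using Harnack_centre_le[OF W z0b] by (simp add: s_def)
  also have "\<dots> \<le> (y + y) * (\<epsilon> * y0)" using W0 W(2)[OF z0b] sy s0 yp by (intro mult_mono) auto
  finally have H: "Re (W c) * (y - s) \<le> 2 * y * (\<epsilon> * y0)" by simp
  have "y * y0 \<le> (y - s) * (2 * y)"
  proof -
    have "y\<^sup>2 - s\<^sup>2 = (y - s) * (y + s)" by (simp add: power2_eq_square algebra_simps)
    also have "\<dots> \<le> (y - s) * (2 * y)" using sy by (intro mult_left_mono) auto
    finally show ?thesis using s2 by linarith
  qed
  then have "y * y0 \<le> y * (2 * (y - s))" by (simp add: algebra_simps)
  then have ys: "y0 / 2 \<le> y - s" using yp by simp
  have "Re (W c) * (y0 / 2) \<le> Re (W c) * (y - s)" using ys W(2)[of c] yp by (intro mult_left_mono) auto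
  from this H have "Re (W c) * (y0 / 2) \<le> 2 * y * (\<epsilon> * y0)" by (rule order_trans)
  then have "Re (W c) * y0 \<le> (4 * \<epsilon> * y) * y0" by (simp add: mult_ac)
  then have Wc: "Re (W c) \<le> 4 * \<epsilon> * y" using y0 by simp
  show "(\<sigma> - 4 * \<epsilon>) * y \<le> ln (norm (f (\<i> * of_real y))) + (\<Sum>a\<in>A. real (m a) * ln (y / norm (a - \<i> * of_real y)))"
    if "f (\<i> * of_real y) \<noteq> 0"
  proof -
    have fc: "f c \<noteq> 0" and cb: "c \<in> ball c y" using that yp by (auto simp: c_def)
    have eq: "ln (y\<^sup>2 / (y * norm (c - a))) = ln (y / norm (a - c))" for a
      using yp by (simp add: power2_eq_square norm_minus_commute)
    have "ln (norm (f c)) + (\<Sum>a\<in>A. real (m a) * ln (y\<^sup>2 / (y * norm (c - a)))) = \<sigma> * y - Re (W c)"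
      using log[OF fc cb] by (simp add: norm_power) (simp add: c_def)
    then show ?thesis using Wc unfolding eq by (simp add: c_def algebra_simps)
  qed
  have "(\<Sum>a\<in>A. real (m a) * (2 * y * Im a - (norm a)\<^sup>2)) * (y0 / (8 * y ^ 3)) =
      (\<Sum>a\<in>A. real (m a) * (y0 * (2 * y * Im a - (norm a)\<^sup>2) / (8 * y ^ 3)))"
    unfolding sum_distrib_right by (intro sum.cong refl) simp
  also have "\<dots> \<le> (\<Sum>a\<in>A. real (m a) * L a)" by (intro sum_mono mult_left_mono Lge) auto
  also have "\<dots> \<le> \<epsilon> * y0" using small W(2)[OF z0b] by linarith
  finally show "(\<Sum>a\<in>A. real (m a) * (2 * y * Im a - (norm a)\<^sup>2)) \<le> 8 * \<epsilon> * y ^ 3"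
    using y0 yp by (simp add: field_simps)
qed

section \<open>The logarithmic kernel\<close>

text \<open>Chosen so that \<open>log (1 + y\<^sup>2 / t\<^sup>2)\<close> is the integral of \<open>log\<^sup>+ (s / t)\<close> against it.\<close>
definition log_kernel :: "real \<Rightarrow> real \<Rightarrow> real" where
  "log_kernel y s = 4 * y\<^sup>2 * s / (s\<^sup>2 + y\<^sup>2)\<^sup>2"

lemma log_kernel_nonneg: "0 \<le> s \<Longrightarrow> 0 \<le> log_kernel y s"
  by (simp add: log_kernel_def)

lemma measurable_log_kernel [measurable]: "log_kernel y \<in> borel_measurable borel"
  unfolding log_kernel_def[abs_def] by measurable

lemma nn_integral_log_kernel:
  assumes y: "0 < y" and t: "0 < t"
  shows "(\<integral>\<^sup>+s. ennreal (ln (s / t) * log_kernel y s) * indicator {t..} s \<partial>lborel) = ennreal (ln (1 + y\<^sup>2 / t\<^sup>2))"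
proof -
  \<comment> \<open>Integration by parts: the kernel is the derivative of
    \<open>- 2 * y^2 / (s^2 + y^2)\<close>, and what remains,
    \<open>2 * y^2 / (s * (s^2 + y^2))\<close>, splits into
    \<open>2 / s - 2 * s / (s^2 + y^2)\<close>.\<close>
  define F where "F s = - (2 * y\<^sup>2) * ((ln s - ln t) / (s\<^sup>2 + y\<^sup>2)) + 2 * ln s - ln (s\<^sup>2 + y\<^sup>2)" for s
  have q: "0 < s\<^sup>2 + y\<^sup>2" for s using y by (simp add: add_nonneg_pos)
  have der: "DERIV F s :> ln (s / t) * log_kernel y s" if s: "t \<le> s" for s
  proof -
    have s0: "0 < s" using s t by simp
    define Q where "Q = s\<^sup>2 + y\<^sup>2"
    have Q: "0 < Q" "s\<^sup>2 + y\<^sup>2 = Q" using q by (auto simp: Q_def)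
    have a: "DERIV (\<lambda>s. ln s - ln t) s :> 1 / s" and b: "DERIV (\<lambda>s. s\<^sup>2 + y\<^sup>2) s :> 2 * s"
      and l: "DERIV ln s :> 1 / s"
      using s0 by (auto intro!: derivative_eq_intros)
    have c: "DERIV (\<lambda>s. ln (s\<^sup>2 + y\<^sup>2)) s :> 1 / (s\<^sup>2 + y\<^sup>2) * (2 * s)"
      by (rule DERIV_chain2[OF DERIV_ln_divide b]) (rule q)
    have "DERIV F s :> - (2 * y\<^sup>2) * ((1 / s * (s\<^sup>2 + y\<^sup>2) - (ln s - ln t) * (2 * s)) / ((s\<^sup>2 + y\<^sup>2) * (s\<^sup>2 + y\<^sup>2)))
        + 2 * (1 / s) - 1 / (s\<^sup>2 + y\<^sup>2) * (2 * s)"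
      unfolding F_def by (rule DERIV_diff[OF DERIV_add[OF DERIV_cmult[OF DERIV_divide[OF a b]] DERIV_cmult[OF l]] c])
        (metis q less_irrefl)
    then have "DERIV F s :> - (2 * y\<^sup>2) * ((1 / s * Q - (ln s - ln t) * (2 * s)) / (Q * Q)) + 2 * (1 / s) - 2 * s / Q"
      unfolding Q(2) by simp
    moreover have "- (2 * y\<^sup>2) * ((1 / s * Q - (ln s - ln t) * (2 * s)) / (Q * Q)) + 2 * (1 / s) - 2 * s / Q
        = (ln s - ln t) * (4 * y\<^sup>2 * s / Q\<^sup>2)"
    proof -
      have "2 * (1 / s) - 2 * s / Q = 2 * y\<^sup>2 / (s * Q)"
        using s0 Q by (simp add: field_simps Q(2)[symmetric] power2_eq_square)
      moreover have "- (2 * y\<^sup>2) * ((1 / s * Q - (ln s - ln t) * (2 * s)) / (Q * Q)) =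
          (ln s - ln t) * (4 * y\<^sup>2 * s / Q\<^sup>2) - 2 * y\<^sup>2 / (s * Q)"
        using s0 Q(1) by (simp add: field_simps power2_eq_square)
      ultimately show ?thesis by linarith
    qed
    ultimately show ?thesis using s0 t by (simp add: log_kernel_def Q(2) ln_div)
  qed
  have lim: "(F \<longlongrightarrow> 0) at_top"
  proof -
    have "((\<lambda>s. - (2 * y\<^sup>2) * ((ln s - ln t) / (s\<^sup>2 + y\<^sup>2)) + (2 * ln s - ln (s\<^sup>2 + y\<^sup>2))) \<longlongrightarrow> - (2 * y\<^sup>2) * 0 + 0) at_top"
      by (intro tendsto_add tendsto_mult tendsto_const) real_asymp+
    then show ?thesis unfolding F_def by (simp only: add_diff_eq mult_zero_right add_0)
  qed
  have "(\<integral>\<^sup>+s. ennreal (ln (s / t) * log_kernel y s) * indicator {t..} s \<partial>lborel) = ennreal (0 - F t)"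
    by (rule nn_integral_FTC_atLeast[OF _ der _ lim])
      (use t in \<open>auto intro!: mult_nonneg_nonneg log_kernel_nonneg\<close>)
  also have "0 - F t = ln (1 + y\<^sup>2 / t\<^sup>2)"
  proof -
    have "1 + y\<^sup>2 / t\<^sup>2 = (t\<^sup>2 + y\<^sup>2) / t\<^sup>2" using t by (simp add: field_simps)
    moreover have "ln ((t\<^sup>2 + y\<^sup>2) / t\<^sup>2) = ln (t\<^sup>2 + y\<^sup>2) - 2 * ln t"
      using t q[of t] by (simp add: ln_div ln_realpow)
    ultimately show ?thesis by (simp add: F_def)
  qed
  finally show ?thesis .
qed

text \<open>The kernel has mass 2 and first moment \<open>\<pi> * y\<close>. For
  \<open>\<beta> = 2 * \<sigma> / \<pi>\<close> the main term becomes
  \<open>2 * \<sigma> * y\<close>, the one that sharpness gives as a lower bound.\<close>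

lemma nn_integral_linear_log_kernel:
  assumes y: "0 < y" and b: "0 \<le> \<beta>" "0 \<le> C"
  shows "(\<integral>\<^sup>+s. ennreal ((\<beta> * s + C) * log_kernel y s) * indicator {0..} s \<partial>lborel) = ennreal (pi * \<beta> * y + 2 * C)"
proof -
  define F where "F s = \<beta> * (2 * y * arctan (s / y) - 2 * y\<^sup>2 * s / (s\<^sup>2 + y\<^sup>2)) - 2 * C * y\<^sup>2 / (s\<^sup>2 + y\<^sup>2)" for s
  have q: "0 < s\<^sup>2 + y\<^sup>2" for s using y by (simp add: add_nonneg_pos)
  have der: "DERIV F s :> (\<beta> * s + C) * log_kernel y s" for s
  proof -
    define Q where "Q = s\<^sup>2 + y\<^sup>2"
    have Q: "0 < Q" "s\<^sup>2 + y\<^sup>2 = Q" using q by (auto simp: Q_def)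
    have at: "DERIV (\<lambda>s. arctan (s / y)) s :> y / Q"
    proof -
      have "DERIV (\<lambda>s. arctan (s / y)) s :> inverse (1 + (s / y)\<^sup>2) * (1 / y)"
        using y by (auto intro!: derivative_eq_intros simp: field_simps)
      moreover have "inverse (1 + (s / y)\<^sup>2) * (1 / y) = y / Q"
        using y Q by (simp add: Q_def field_simps power2_eq_square)
      ultimately show ?thesis by simp
    qed
    have qd: "DERIV (\<lambda>s. s\<^sup>2 + y\<^sup>2) s :> 2 * s" by (auto intro!: derivative_eq_intros)
    have ld: "DERIV (\<lambda>s. 2 * y\<^sup>2 * s) s :> 2 * y\<^sup>2" by (auto intro!: derivative_eq_intros)
    have Q0: "s\<^sup>2 + y\<^sup>2 \<noteq> 0" by (metis q less_irrefl)
    have "DERIV F s :> \<beta> * (2 * y * (y / Q) - (2 * y\<^sup>2 * (s\<^sup>2 + y\<^sup>2) - 2 * y\<^sup>2 * s * (2 * s)) / ((s\<^sup>2 + y\<^sup>2) * (s\<^sup>2 + y\<^sup>2)))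
        - (0 * (s\<^sup>2 + y\<^sup>2) - 2 * C * y\<^sup>2 * (2 * s)) / ((s\<^sup>2 + y\<^sup>2) * (s\<^sup>2 + y\<^sup>2))"
      unfolding F_def
      by (rule DERIV_diff[OF DERIV_cmult[OF DERIV_diff[OF DERIV_cmult[OF at] DERIV_divide[OF ld qd Q0]]] DERIV_divide[OF DERIV_const qd Q0]])
    then have "DERIV F s :> \<beta> * (2 * y * (y / Q) - (2 * y\<^sup>2 * Q - 2 * y\<^sup>2 * s * (2 * s)) / (Q * Q)) - (0 * Q - 2 * C * y\<^sup>2 * (2 * s)) / (Q * Q)"
      unfolding Q(2) .
    moreover have "\<beta> * (2 * y * (y / Q) - (2 * y\<^sup>2 * Q - 2 * y\<^sup>2 * s * (2 * s)) / (Q * Q)) - (0 * Q - 2 * C * y\<^sup>2 * (2 * s)) / (Q * Q)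
        = (\<beta> * s + C) * (4 * y\<^sup>2 * s / Q\<^sup>2)"
    proof -
      have "2 * y * (y / Q) = 2 * y\<^sup>2 * (s\<^sup>2 + y\<^sup>2) / (Q * Q)"
        using Q(1) unfolding Q(2) by (simp add: power2_eq_square)
      then have "2 * y * (y / Q) - (2 * y\<^sup>2 * Q - 2 * y\<^sup>2 * s * (2 * s)) / (Q * Q) = 4 * y\<^sup>2 * s\<^sup>2 / (Q * Q)"
        unfolding Q(2)[symmetric] by (simp add: diff_divide_distrib[symmetric] power2_eq_square algebra_simps)
      then show ?thesis by (simp add: power2_eq_square algebra_simps add_divide_distrib)
    qed
    ultimately show ?thesis by (simp add: log_kernel_def Q(2))
  qed
  have lim: "(F \<longlongrightarrow> \<beta> * (2 * y * (pi / 2) - 0) - 0) at_top"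
    unfolding F_def
  proof (intro tendsto_diff tendsto_mult tendsto_const)
    have "filterlim (\<lambda>s. s / y) at_top at_top" using y by real_asymp
    then show "((\<lambda>s. arctan (s / y)) \<longlongrightarrow> pi / 2) at_top"
      by (rule filterlim_compose[OF tendsto_arctan_at_top])
    show "((\<lambda>s. 2 * y\<^sup>2 * s / (s\<^sup>2 + y\<^sup>2)) \<longlongrightarrow> 0) at_top" using y by real_asymp
    show "((\<lambda>s. 2 * C * y\<^sup>2 / (s\<^sup>2 + y\<^sup>2)) \<longlongrightarrow> 0) at_top" by real_asymp
  qed
  have "(\<integral>\<^sup>+s. ennreal ((\<beta> * s + C) * log_kernel y s) * indicator {0..} s \<partial>lborel) = ennreal ((\<beta> * (2 * y * (pi / 2) - 0) - 0) - F 0)"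
    by (rule nn_integral_FTC_atLeast[OF _ der _ lim])
      (use b in \<open>auto intro!: mult_nonneg_nonneg log_kernel_nonneg add_nonneg_nonneg\<close>)
  also have "(\<beta> * (2 * y * (pi / 2) - 0) - 0) - F 0 = pi * \<beta> * y + 2 * C"
    using y by (simp add: F_def)
  finally show ?thesis .
qed

text \<open>An upper bound for the counting average, integrated against the kernel. The term
  \<open>d\<close> records a gap in this bound on the interval from \<open>l\<close> to
  \<open>u\<close>; the conclusion shows how much the gap costs. Nonnegative integrals spare all
  integrability questions.\<close>

lemma sum_ln_one_plus_le:
  fixes w t :: "'a \<Rightarrow> real"
  assumes fin: "finite I" and w: "\<And>i. i \<in> I \<Longrightarrow> 0 \<le> w i" and t: "\<And>i. i \<in> I \<Longrightarrow> 0 < t i"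
    and y: "0 < y" and b: "0 \<le> \<beta>" "0 \<le> C" and d: "0 \<le> d" "0 \<le> \<kappa>" and lu: "0 < l" "l \<le> u"
    and kernel: "\<And>s. l \<le> s \<Longrightarrow> s \<le> u \<Longrightarrow> \<kappa> \<le> log_kernel y s"
    and le: "\<And>s. 0 < s \<Longrightarrow> (\<Sum>i | i \<in> I \<and> t i \<le> s. w i * ln (s / t i)) + (if l \<le> s \<and> s \<le> u then d else 0) \<le> \<beta> * s + C"
  shows "(\<Sum>i\<in>I. w i * ln (1 + y\<^sup>2 / (t i)\<^sup>2)) + d * \<kappa> * (u - l) \<le> pi * \<beta> * y + 2 * C"
proof -
  define h where "h i s = ennreal (w i) * (ennreal (ln (s / t i) * log_kernel y s) * indicator {t i..} s)" for i s
  have h: "(\<integral>\<^sup>+s. h i s \<partial>lborel) = ennreal (w i * ln (1 + y\<^sup>2 / (t i)\<^sup>2))" if "i \<in> I" for i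
    unfolding h_def using nn_integral_log_kernel[OF y t[OF that]] w[OF that]
    by (subst nn_integral_cmult) (auto simp: ennreal_mult')
  have lnpos: "0 \<le> w i * ln (1 + y\<^sup>2 / (t i)\<^sup>2)" if "i \<in> I" for i
    using w[OF that] by (intro mult_nonneg_nonneg ln_ge_zero) auto
  have "ennreal ((\<Sum>i\<in>I. w i * ln (1 + y\<^sup>2 / (t i)\<^sup>2)) + d * \<kappa> * (u - l)) =
      (\<Sum>i\<in>I. ennreal (w i * ln (1 + y\<^sup>2 / (t i)\<^sup>2))) + ennreal (d * \<kappa>) * ennreal (u - l)"
    using lnpos d lu by (simp add: ennreal_plus sum_nonneg sum_ennreal ennreal_mult[symmetric])
  also have "\<dots> = (\<Sum>i\<in>I. \<integral>\<^sup>+s. h i s \<partial>lborel) + (\<integral>\<^sup>+s. ennreal (d * \<kappa>) * indicator {l..u} s \<partial>lborel)"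
    using h lu by (simp add: nn_integral_cmult_indicator)
  also have "\<dots> = (\<integral>\<^sup>+s. (\<Sum>i\<in>I. h i s) + ennreal (d * \<kappa>) * indicator {l..u} s \<partial>lborel)"
    unfolding h_def by (subst nn_integral_add) (auto simp: nn_integral_sum)
  also have "\<dots> \<le> (\<integral>\<^sup>+s. ennreal ((\<beta> * s + C) * log_kernel y s) * indicator {0..} s \<partial>lborel)"
  proof (rule nn_integral_mono)
    fix s :: real
    show "(\<Sum>i\<in>I. h i s) + ennreal (d * \<kappa>) * indicator {l..u} s \<le> ennreal ((\<beta> * s + C) * log_kernel y s) * indicator {0..} s"
    proof (cases "0 < s")
      case False
      have "h i s = 0" if "i \<in> I" for i using t[OF that] False by (auto simp: h_def indicator_def)
      then show ?thesis using False lu by (auto simp: indicator_def)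
    next
      case True
      define k where "k = log_kernel y s"
      have k: "0 \<le> k" unfolding k_def using True by (intro log_kernel_nonneg) simp
      define J where "J = {i. i \<in> I \<and> t i \<le> s}"
      have hJ: "h i s = (if t i \<le> s then ennreal (w i * ln (s / t i) * k) else 0)" if "i \<in> I" for i
        using w[OF that] k t[OF that] by (auto simp: h_def k_def indicator_def ennreal_mult'[symmetric] mult.assoc)
      have nn: "0 \<le> w i * ln (s / t i) * k" if "i \<in> J" for i
        using that w[of i] t[of i] k by (intro mult_nonneg_nonneg ln_ge_zero) (auto simp: J_def)
      have "(\<Sum>i\<in>I. h i s) = (\<Sum>i\<in>I. if t i \<le> s then ennreal (w i * ln (s / t i) * k) else 0)"
        using hJ by (intro sum.cong) auto
      also have "\<dots> = (\<Sum>i\<in>J. ennreal (w i * ln (s / t i) * k))"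
        unfolding J_def by (rule sum.inter_filter[OF fin, symmetric])
      also have "\<dots> = ennreal (\<Sum>i\<in>J. w i * ln (s / t i) * k)"
        using nn by (intro sum_ennreal) auto
      finally have S: "(\<Sum>i\<in>I. h i s) = ennreal ((\<Sum>i\<in>J. w i * ln (s / t i)) * k)"
        by (simp add: sum_distrib_right)
      have D: "ennreal (d * \<kappa>) * indicator {l..u} s \<le> ennreal ((if l \<le> s \<and> s \<le> u then d else 0) * k)"
        using kernel[of s] d by (auto simp: indicator_def k_def intro!: ennreal_leI mult_left_mono)
      have "(\<Sum>i\<in>I. h i s) + ennreal (d * \<kappa>) * indicator {l..u} s \<le>
          ennreal ((\<Sum>i\<in>J. w i * ln (s / t i)) * k) + ennreal ((if l \<le> s \<and> s \<le> u then d else 0) * k)"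
        unfolding S by (intro add_left_mono D)
      also have "\<dots> = ennreal (((\<Sum>i\<in>J. w i * ln (s / t i)) + (if l \<le> s \<and> s \<le> u then d else 0)) * k)"
      proof -
        have "0 \<le> (\<Sum>i\<in>J. w i * ln (s / t i)) * k"
          unfolding sum_distrib_right using nn by (intro sum_nonneg) auto
        moreover have "0 \<le> (if l \<le> s \<and> s \<le> u then d else 0) * k" using k d by simp
        ultimately show ?thesis by (simp only: ennreal_plus distrib_right)
      qed
      also have "\<dots> \<le> ennreal ((\<beta> * s + C) * k)"
        using le[OF True] k by (intro ennreal_leI mult_right_mono) (auto simp: J_def)
      finally show ?thesis using True by (simp add: k_def)
    qed
  qed
  also have "\<dots> = ennreal (pi * \<beta> * y + 2 * C)" by (rule nn_integral_linear_log_kernel[OF y b])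
  finally have "ennreal ((\<Sum>i\<in>I. w i * ln (1 + y\<^sup>2 / (t i)\<^sup>2)) + d * \<kappa> * (u - l)) \<le> ennreal (pi * \<beta> * y + 2 * C)" .
  moreover have "0 \<le> pi * \<beta> * y + 2 * C" using b y by simp
  ultimately show ?thesis by (simp only: ennreal_le_iff)
qed

section \<open>Disc representations of a balanced function\<close>

text \<open>The type \<sigma> is the same in both half-planes and can be lowered in neither. The
  constant in front of the exponential is normalized to 1, so that one point with large modulus is a
  quantitative statement about \<sigma>.\<close>

locale balanced_function =
  fixes f :: "complex \<Rightarrow> complex" and m :: "complex \<Rightarrow> nat" and \<sigma> :: real
  assumes holo: "f holomorphic_on UNIV" and zeros: "is_zero_set m f" and discrete: "no_finite_limit_points m"
    and m0: "m 0 = 0"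
    and bound: "\<And>z. norm (f z) \<le> exp (\<sigma> * \<bar>Im z\<bar>)"
    and sharp_upper: "\<And>\<epsilon>. 0 < \<epsilon> \<Longrightarrow> \<exists>z. 0 < Im z \<and> exp ((\<sigma> - \<epsilon>) * Im z) < norm (f z)"
    and sharp_lower: "\<And>\<epsilon>. 0 < \<epsilon> \<Longrightarrow> \<exists>z. 0 < Im z \<and> exp ((\<sigma> - \<epsilon>) * Im z) < norm (f (- z))"
begin

text \<open>The slack in Jensen's formula on the circle of radius \<open>R\<close>, where
  \<open>\<sigma> * |Im z|\<close> has mean \<open>2 * \<sigma> * R / \<pi>\<close>.\<close>

definition defect :: "real \<Rightarrow> real" where
  "defect R = 2 * \<sigma> / pi * R - ln (norm (f 0)) - log_zeros m R"

lemma f0: "f 0 \<noteq> 0"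
  using is_zero_set_zero_iff[OF zeros, of 0] m0 by simp

lemma finite_zeros [simp]: "finite (zeros_in m r)"
  by (rule finite_zeros_in[OF discrete])

text \<open>The Blaschke factorization with outer exponent
  \<open>\<sigma> * R * abs_Im_ext (z / R)\<close>, divided by its value at 0. Only
  \<open>W z - W 0\<close> survives in the exponent, and this is what the estimates near the centre
  bound by \<open>Re (W 0)\<close>.\<close>

lemma disc_representation:
  assumes R: "0 < R"
  obtains W where "W holomorphic_on ball 0 R" "\<And>z. z \<in> ball 0 R \<Longrightarrow> 0 \<le> Re (W z)" "Re (W 0) = defect R"
    "\<And>z. z \<in> ball 0 R \<Longrightarrow> f z / f 0 * (\<Prod>a\<in>zeros_in m R. (1 - cnj a * z / of_real (R\<^sup>2)) ^ m a) =
       exp (of_real (\<sigma> * R) * (abs_Im_ext (z / of_real R) - 2 / pi) - (W z - W 0)) * (\<Prod>a\<in>zeros_in m R. (1 - z / a) ^ m a)"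
proof -
  define q where "q z = of_real (\<sigma> * R) * abs_Im_ext (z / of_real R)" for z
  have Z: "zeros_in m R = {a. 0 < m a \<and> a \<in> ball 0 R}" using m0 by (auto simp: zeros_in_def intro: ccontr)
  have inb: "z / of_real R \<in> ball 0 1" if "z \<in> ball 0 R" for z :: complex
    using that R by (simp add: norm_divide)
  have "(abs_Im_ext \<circ> (\<lambda>z. z / of_real R)) holomorphic_on ball 0 R"
    by (rule holomorphic_on_compose_gen[OF _ holomorphic_abs_Im_ext]) (use inb R in \<open>auto intro!: holomorphic_intros\<close>)
  then have q1: "q holomorphic_on ball 0 R" unfolding q_def o_def by (intro holomorphic_intros)
  have "continuous_on (cball 0 R) (abs_Im_ext \<circ> (\<lambda>z. z / of_real R))"
    by (intro continuous_on_compose continuous_on_subset[OF continuous_on_abs_Im_ext] continuous_intros)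
      (use R in \<open>auto simp: norm_divide\<close>)
  then have q2: "continuous_on (cball 0 R) q" unfolding q_def o_def by (intro continuous_intros)
  have le: "norm (f z) \<le> exp (Re (q z))" if "norm (z - 0) = R" for z
  proof -
    have "norm (z / of_real R) = 1" using that R by (simp add: norm_divide)
    from Re_abs_Im_ext[OF this] have "Re (q z) = \<sigma> * \<bar>Im z\<bar>"
      using R by (simp add: q_def abs_mult)
    then show ?thesis using bound[of z] by simp
  qed
  have "\<exists>W. W holomorphic_on ball 0 R \<and> (\<forall>z\<in>ball 0 R. 0 \<le> Re (W z)) \<and>
    (\<forall>z\<in>ball 0 R. f z * (\<Prod>a\<in>zeros_in m R. ((of_real (R\<^sup>2) - cnj (a - 0) * (z - 0)) / of_real R) ^ m a) =
       exp (q z - W z) * (\<Prod>a\<in>zeros_in m R. (z - a) ^ m a))"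
    unfolding Z
  proof (rule disc_Blaschke_factorization[OF holo zeros R finite_zeros_ball[OF discrete] q1 q2 le], goal_cases)
    case (2 W)
    then show ?case by (intro exI[of _ W]) auto
  qed auto
  then obtain W where W: "W holomorphic_on ball 0 R" "\<And>z. z \<in> ball 0 R \<Longrightarrow> 0 \<le> Re (W z)"
    and eq: "\<And>z. z \<in> ball 0 R \<Longrightarrow> f z * (\<Prod>a\<in>zeros_in m R. ((of_real (R\<^sup>2) - cnj (a - 0) * (z - 0)) / of_real R) ^ m a) =
       exp (q z - W z) * (\<Prod>a\<in>zeros_in m R. (z - a) ^ m a)" by blast
  have z0: "0 \<in> ball (0::complex) R" using R by simp
  have "ln (norm (f 0)) + (\<Sum>a\<in>zeros_in m R. real (m a) * ln (norm (of_real (R\<^sup>2) - cnj (a - 0) * (0 - 0)) / (R * norm (0 - a)))) = Re (q 0 - W 0)"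
    by (rule ln_norm_Blaschke[where f = f and m = m, OF finite_zeros R f0 z0 _ eq[OF z0]]) (auto simp: Z)
  moreover have "norm (of_real (R\<^sup>2) - cnj (a - 0) * (0 - 0)) / (R * norm (0 - a)) = R / norm a" for a :: complex
    using R by (simp add: norm_mult power2_eq_square)
  ultimately have Re_W0: "Re (W 0) = defect R"
    by (simp add: defect_def log_zeros_def q_def algebra_simps)
  \<comment> \<open>\<open>B\<close> and \<open>A\<close> are the values of the two products at 0;
    the identity at 0 removes them.\<close>
  define B where "B = (\<Prod>a\<in>zeros_in m R. complex_of_real R ^ m a)"
  define A where "A = (\<Prod>a\<in>zeros_in m R. (- a) ^ m a)"
  have B0: "B \<noteq> 0" unfolding B_def using R by simp
  have "A \<noteq> 0" unfolding A_def by (subst prod_zero_iff[OF finite_zeros]) (auto simp: zeros_in_def)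
  note BA = B0 this
  have prods: "(\<Prod>a\<in>zeros_in m R. ((of_real (R\<^sup>2) - cnj (a - 0) * (z - 0)) / of_real R) ^ m a) = B * (\<Prod>a\<in>zeros_in m R. (1 - cnj a * z / of_real (R\<^sup>2)) ^ m a)"
    "(\<Prod>a\<in>zeros_in m R. (z - a) ^ m a) = A * (\<Prod>a\<in>zeros_in m R. (1 - z / a) ^ m a)" for z
  proof -
    have "(of_real (R\<^sup>2) - cnj a * z) / of_real R = of_real R * (1 - cnj a * z / of_real (R\<^sup>2))" for a
      using R by (simp add: field_simps power2_eq_square)
    then show "(\<Prod>a\<in>zeros_in m R. ((of_real (R\<^sup>2) - cnj (a - 0) * (z - 0)) / of_real R) ^ m a) = B * (\<Prod>a\<in>zeros_in m R. (1 - cnj a * z / of_real (R\<^sup>2)) ^ m a)"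
      unfolding B_def prod.distrib[symmetric] by (intro prod.cong refl) (simp only: power_mult_distrib[symmetric] diff_zero)
    show "(\<Prod>a\<in>zeros_in m R. (z - a) ^ m a) = A * (\<Prod>a\<in>zeros_in m R. (1 - z / a) ^ m a)"
      unfolding A_def prod.distrib[symmetric]
    proof (intro prod.cong refl)
      fix a assume "a \<in> zeros_in m R"
      then have "z - a = - a * (1 - z / a)" by (auto simp: zeros_in_def algebra_simps)
      then show "(z - a) ^ m a = (- a) ^ m a * (1 - z / a) ^ m a" by (metis power_mult_distrib)
    qed
  qed
  have at0: "f 0 * B = exp (q 0 - W 0) * A" using eq[OF z0] unfolding prods by simp
  have main: "f z / f 0 * (\<Prod>a\<in>zeros_in m R. (1 - cnj a * z / of_real (R\<^sup>2)) ^ m a) =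
       exp (of_real (\<sigma> * R) * (abs_Im_ext (z / of_real R) - 2 / pi) - (W z - W 0)) * (\<Prod>a\<in>zeros_in m R. (1 - z / a) ^ m a)"
    if z: "z \<in> ball 0 R" for z
  proof -
    define P Q where "P = (\<Prod>a\<in>zeros_in m R. (1 - cnj a * z / of_real (R\<^sup>2)) ^ m a)"
      and "Q = (\<Prod>a\<in>zeros_in m R. (1 - z / a) ^ m a)"
    have "f z * (B * P) = exp (q z - W z) * (A * Q)" using eq[OF z] unfolding prods P_def Q_def .
    then have "(f z * (B * P)) * exp (q 0 - W 0) = exp (q z - W z) * Q * (exp (q 0 - W 0) * A)" by (simp add: mult_ac)
    also have "\<dots> = exp (q z - W z) * Q * (f 0 * B)" unfolding at0 ..
    finally have "f z * P * exp (q 0 - W 0) = exp (q z - W z) * Q * f 0" using BA by (simp add: mult_ac)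
    then have "f z / f 0 * P = exp (q z - W z) / exp (q 0 - W 0) * Q" using f0 by (simp add: field_simps)
    also have "exp (q z - W z) / exp (q 0 - W 0) = exp (of_real (\<sigma> * R) * (abs_Im_ext (z / of_real R) - 2 / pi) - (W z - W 0))"
      by (simp add: exp_diff[symmetric] q_def algebra_simps)
    finally show ?thesis unfolding P_def Q_def .
  qed
  show thesis using W Re_W0 main by (intro that[of W]) auto
qed

lemma defect_nonneg: "0 < R \<Longrightarrow> 0 \<le> defect R"
  using disc_representation[of R] by (metis centre_in_ball)

lemma defect_le: "0 < R \<Longrightarrow> defect R \<le> 2 * \<sigma> / pi * R + \<bar>ln (norm (f 0))\<bar>"
  using log_zeros_nonneg[of m R] by (simp add: defect_def)

lemma log_zeros_le: "0 < R \<Longrightarrow> log_zeros m R \<le> 2 * \<sigma> / pi * R + \<bar>ln (norm (f 0))\<bar>"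
  using defect_nonneg[of R] by (simp add: defect_def)

text \<open>For negative \<sigma> the upper bound for the nonnegative \<open>log_zeros\<close> would
  be negative at large radii; \<open>R\<close> is chosen to make it exactly -1.\<close>

lemma sigma_nonneg: "0 \<le> \<sigma>"
proof (rule ccontr)
  assume "\<not> 0 \<le> \<sigma>"
  define k where "k = - (2 * \<sigma> / pi)"
  have k: "0 < k" using \<open>\<not> 0 \<le> \<sigma>\<close> by (simp add: k_def divide_neg_pos)
  define R where "R = (\<bar>ln (norm (f 0))\<bar> + 1) / k"
  have R: "0 < R" unfolding R_def using k by (intro divide_pos_pos) auto
  have "k * R = \<bar>ln (norm (f 0))\<bar> + 1" unfolding R_def using k by simp
  then have "2 * \<sigma> / pi * R + \<bar>ln (norm (f 0))\<bar> = -1" unfolding k_def by linarith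
  then show False using log_zeros_le[OF R] log_zeros_nonneg[of m R] by simp
qed

text \<open>Since \<open>ln (exp 1) = 1\<close>, \<open>num_zeros m r\<close> is at most
  \<open>log_zeros m (exp 1 * r)\<close>. The additive constant in the bound for the latter is
  absorbed because there are no zeros to count up to \<open>r0\<close>.\<close>

lemma num_zeros_le_linear: "\<exists>K>0. \<forall>r>0. num_zeros m r \<le> K * r"
proof -
  define C where "C = \<bar>ln (norm (f 0))\<bar>"
  obtain r0 where r0: "0 < r0" "\<And>r. r \<le> r0 \<Longrightarrow> zeros_in m r = {}"
    using zeros_in_empty[OF discrete] by blast
  define K where "K = 2 * \<sigma> / pi * exp 1 + C / r0 + 1"
  have s0: "0 \<le> 2 * \<sigma> / pi * exp 1" using sigma_nonneg by simp
  have C0: "0 \<le> C" by (simp add: C_def)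
  have "0 < K" unfolding K_def using s0 C0 r0(1) by (intro add_nonneg_pos) auto
  moreover have "num_zeros m r \<le> K * r" if r: "0 < r" for r
  proof (cases "r \<le> r0")
    case True then show ?thesis using r0 \<open>0 < K\<close> r by (simp add: num_zeros_def)
  next
    case False
    have "num_zeros m r * ln (exp 1 * r / r) \<le> log_zeros m (exp 1 * r) - log_zeros m r"
      by (rule log_zeros_diff_ge[OF discrete r]) (use r in \<open>auto simp: one_le_exp_iff\<close>)
    then have "num_zeros m r \<le> log_zeros m (exp 1 * r)" using r log_zeros_nonneg[of m r] by simp
    also have "\<dots> \<le> 2 * \<sigma> / pi * (exp 1 * r) + C" unfolding C_def by (rule log_zeros_le) (use r in simp)
    also have "C \<le> C / r0 * r" using False C0 r0 r by (simp add: field_simps mult_left_mono)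
    also have "2 * \<sigma> / pi * (exp 1 * r) + C / r0 * r \<le> K * r" using r by (simp add: K_def algebra_simps)
    finally show ?thesis by simp
  qed
  ultimately show ?thesis by blast
qed

end

section \<open>From discs to the imaginary axis\<close>

text \<open>The weight \<open>2 * y * Im a - (norm a)^2\<close> of the disc estimate degenerates at
  the circle. For zeros in the disc of radius \<open>y\<close> the weight belonging to radius
  \<open>2 * y\<close> is at least \<open>2 * y * Im a\<close>, and
  \<open>8 * \<epsilon> * (2 * y)^3\<close> divided by \<open>2 * y\<close> gives
  \<open>32 * \<epsilon> * y^2\<close>.\<close>

lemma half_plane_estimates:
  assumes f: "f holomorphic_on UNIV" and m: "is_zero_set m f" "no_finite_limit_points m"
    and bound: "\<And>z. 0 \<le> Im z \<Longrightarrow> norm (f z) \<le> exp (\<sigma> * Im z)"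
    and e: "0 < \<epsilon>" and sharp: "\<exists>z. 0 < Im z \<and> exp ((\<sigma> - \<epsilon>) * Im z) < norm (f z)"
  defines "A \<equiv> \<lambda>y. {a. 0 < m a \<and> a \<in> ball (\<i> * complex_of_real y) y}"
  shows "\<exists>Y>0. \<forall>y\<ge>Y. (\<Sum>a\<in>A y. real (m a) * Im a) \<le> 32 * \<epsilon> * y\<^sup>2 \<and>
    (f (\<i> * of_real y) \<noteq> 0 \<longrightarrow>
      (\<sigma> - 4 * \<epsilon>) * y \<le> ln (norm (f (\<i> * of_real y))) + (\<Sum>a\<in>A y. real (m a) * ln (y / norm (a - \<i> * of_real y))))"
proof -
  obtain z0 where z0: "0 < Im z0" "exp ((\<sigma> - \<epsilon>) * Im z0) < norm (f z0)" using sharp by blast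
  define Y where "Y = (norm z0)\<^sup>2 / Im z0"
  have "z0 \<noteq> 0" using z0(1) by auto
  then have Y: "0 < Y" using z0(1) by (simp add: Y_def)
  note est = half_plane_disc_estimate[OF f m bound e z0]
  have sq: "(norm (a - \<i> * of_real s))\<^sup>2 = s\<^sup>2 - (2 * s * Im a - (norm a)\<^sup>2)" for a s
    unfolding cmod_power2 by (simp add: power2_eq_square algebra_simps)
  have in_A: "(norm a)\<^sup>2 < 2 * y * Im a" if "a \<in> A y" "0 < y" for a y
  proof -
    have "norm (a - \<i> * of_real y) < y" using that by (simp add: A_def dist_norm norm_minus_commute)
    then have "(norm (a - \<i> * of_real y))\<^sup>2 < y\<^sup>2" using that(2) by (simp add: power_strict_mono)
    then show ?thesis unfolding sq by simp
  qed
  have "(\<Sum>a\<in>A y. real (m a) * Im a) \<le> 32 * \<epsilon> * y\<^sup>2" if y: "Y \<le> y" for y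
  proof -
    have y0: "0 < y" using y Y by simp
    have sub: "A y \<subseteq> A (2 * y)"
    proof
      fix a assume a: "a \<in> A y"
      have "(norm a)\<^sup>2 < 2 * y * Im a" by (rule in_A[OF a y0])
      moreover have "0 \<le> (norm a)\<^sup>2" by simp
      ultimately have "0 < 2 * y * Im a" by linarith
      then have "0 < Im a" using y0 by (simp add: zero_less_mult_iff)
      then have "(norm a)\<^sup>2 < 2 * (2 * y) * Im a" 
        using \<open>(norm a)\<^sup>2 < 2 * y * Im a\<close> \<open>0 < 2 * y * Im a\<close> by linarith
      then have "(norm (a - \<i> * of_real (2 * y)))\<^sup>2 < (2 * y)\<^sup>2"
        unfolding sq by simp
      then have "norm (a - \<i> * of_real (2 * y)) < 2 * y"
        by (rule power2_less_imp_less) (use y0 in simp)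
      then show "a \<in> A (2 * y)" using a unfolding A_def mem_ball dist_norm
        by (subst norm_minus_commute) blast
    qed
    have "2 * y * (\<Sum>a\<in>A y. real (m a) * Im a) = (\<Sum>a\<in>A y. real (m a) * (2 * y * Im a))"
      by (simp add: sum_distrib_left mult_ac)
    also have "\<dots> \<le> (\<Sum>a\<in>A y. real (m a) * (2 * (2 * y) * Im a - (norm a)\<^sup>2))"
    proof (intro sum_mono mult_left_mono)
      fix a assume "a \<in> A y"
      from in_A[OF this y0] show "2 * y * Im a \<le> 2 * (2 * y) * Im a - (norm a)\<^sup>2" by simp
    qed simp
    also have "\<dots> \<le> (\<Sum>a\<in>A (2 * y). real (m a) * (2 * (2 * y) * Im a - (norm a)\<^sup>2))"
    proof (rule sum_mono2[OF _ sub])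
      show "finite (A (2 * y))" unfolding A_def by (rule finite_zeros_ball[OF m(2)])
      fix a assume "a \<in> A (2 * y) - A y"
      then show "0 \<le> real (m a) * (2 * (2 * y) * Im a - (norm a)\<^sup>2)"
        using in_A[of a "2 * y"] y0 by (intro mult_nonneg_nonneg) auto
    qed
    also have "\<dots> \<le> 8 * \<epsilon> * (2 * y) ^ 3"
      unfolding A_def by (rule est(2)) (use y y0 in \<open>auto simp: Y_def\<close>)
    finally have "(2 * y) * (\<Sum>a\<in>A y. real (m a) * Im a) \<le> (2 * y) * (32 * \<epsilon> * y\<^sup>2)"
      by (simp add: power2_eq_square power3_eq_cube)
    then show ?thesis using y0 by simp
  qed
  moreover have "(\<sigma> - 4 * \<epsilon>) * y \<le> ln (norm (f (\<i> * of_real y))) + (\<Sum>a\<in>A y. real (m a) * ln (y / norm (a - \<i> * of_real y)))"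
    if "Y \<le> y" "f (\<i> * of_real y) \<noteq> 0" for y
    using est(1)[of y] that unfolding A_def Y_def by blast
  ultimately show ?thesis using Y by blast
qed

lemma ln_norm_prod_power:
  fixes g :: "'a \<Rightarrow> complex"
  assumes "finite A" "\<And>a. a \<in> A \<Longrightarrow> g a \<noteq> 0"
  shows "ln (norm (\<Prod>a\<in>A. g a ^ k a)) = (\<Sum>a\<in>A. real (k a) * ln (norm (g a)))"
proof -
  have "ln (norm (\<Prod>a\<in>A. g a ^ k a)) = ln (\<Prod>a\<in>A. norm (g a) ^ k a)"
    by (simp add: prod_norm[symmetric] norm_power)
  also have "\<dots> = (\<Sum>a\<in>A. ln (norm (g a) ^ k a))" using assms by (intro ln_prod) auto
  also have "\<dots> = (\<Sum>a\<in>A. real (k a) * ln (norm (g a)))" using assms by (intro sum.cong refl) (simp add: ln_realpow)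
  finally show ?thesis .
qed

text \<open>Up to the factor \<open>\<sigma> * z\<close> this is a difference quotient of
  \<open>abs_Im_ext\<close> at 0, where the derivative vanishes. Hence the outer factor disappears
  as \<open>R\<close> grows.\<close>

lemma tendsto_abs_Im_ext_scaled:
  "((\<lambda>R. of_real (\<sigma> * R) * (abs_Im_ext (z / of_real R) - 2 / pi)) \<longlongrightarrow> 0) at_top"
proof (cases "z = 0")
  case False
  have "((\<lambda>R. inverse (of_real R) :: complex) \<longlongrightarrow> 0) at_top"
    by (rule tendsto_inverse_0_at_top[THEN tendsto_of_real[where 'a = complex], simplified]) (rule filterlim_ident)
  then have "((\<lambda>R. z * inverse (of_real R)) \<longlongrightarrow> z * 0) at_top" by (intro tendsto_mult tendsto_const)
  then have "((\<lambda>R. z / of_real R) \<longlongrightarrow> 0) at_top" by (simp add: divide_inverse)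
  moreover have "eventually (\<lambda>R. z / of_real R \<noteq> 0) at_top"
    using eventually_gt_at_top[of 0] by eventually_elim (use False in auto)
  ultimately have h: "filterlim (\<lambda>R. z / of_real R) (at 0) at_top" by (simp add: filterlim_at)
  have "((\<lambda>h. (abs_Im_ext (0 + h) - abs_Im_ext 0) / h) \<longlongrightarrow> 0) (at 0)"
    using DERIV_abs_Im_ext_0 by (simp add: DERIV_def)
  from filterlim_compose[OF this h]
  have "((\<lambda>R. (of_real \<sigma> * z) * ((abs_Im_ext (0 + z / of_real R) - abs_Im_ext 0) / (z / of_real R))) \<longlongrightarrow> (of_real \<sigma> * z) * 0) at_top"
    by (intro tendsto_mult tendsto_const)
  moreover have "eventually (\<lambda>R. (of_real \<sigma> * z) * ((abs_Im_ext (0 + z / of_real R) - abs_Im_ext 0) / (z / of_real R)) =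
     of_real (\<sigma> * R) * (abs_Im_ext (z / of_real R) - 2 / pi)) at_top"
    using eventually_gt_at_top[of 0] by eventually_elim (use False in auto)
  ultimately show ?thesis by (simp add: tendsto_cong)
qed simp

text \<open>The square of \<open>norm (a + \<i> * y)\<close> exceeds \<open>(norm a)^2 + y^2\<close>
  by \<open>2 * y * Im a\<close>, and \<open>1 + x \<le> exp x\<close> moves this excess into the
  exponential.\<close>

lemma mult_norm_add_le_exp:
  assumes y: "0 < y" and a: "0 \<le> Im a"
  shows "y * norm (a + \<i> * of_real y) \<le> ((norm a)\<^sup>2 + y\<^sup>2) * exp (Im a / y)"
proof -
  define q where "q = (norm a)\<^sup>2 + y\<^sup>2"
  have q: "y\<^sup>2 \<le> q" "0 < q" using y by (auto simp: q_def add_nonneg_pos)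
  have n: "(norm (a + \<i> * of_real y))\<^sup>2 = q + 2 * y * Im a"
    unfolding q_def cmod_power2 by (simp add: power2_eq_square algebra_simps)
  have "(y * norm (a + \<i> * of_real y))\<^sup>2 = y\<^sup>2 * (q + 2 * y * Im a)" by (simp add: power_mult_distrib n)
  also have "\<dots> = y\<^sup>2 * q + y\<^sup>2 * y\<^sup>2 * (2 * Im a / y)" using y by (simp add: field_simps power2_eq_square)
  also have "\<dots> \<le> q * q + q * q * (2 * Im a / y)"
    using q y a by (intro add_mono mult_mono mult_right_mono) auto
  also have "\<dots> = q\<^sup>2 * (1 + 2 * (Im a / y))" by (simp add: power2_eq_square algebra_simps)
  also have "\<dots> \<le> q\<^sup>2 * exp (2 * (Im a / y))" by (intro mult_left_mono exp_ge_add_one_self) auto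
  also have "\<dots> = (q * exp (Im a / y))\<^sup>2" by (simp only: power_mult_distrib exp_double)
  finally have "(y * norm (a + \<i> * of_real y))\<^sup>2 \<le> (q * exp (Im a / y))\<^sup>2" .
  then have "y * norm (a + \<i> * of_real y) \<le> q * exp (Im a / y)"
    by (rule power2_le_imp_le) (use q in simp)
  then show ?thesis by (simp add: q_def)
qed

text \<open>Adding \<open>ln (y / |a - iy|)\<close> sweeps a zero \<open>a\<close> near \<open>iy\<close> to the boundary of the tangent disc;
  this costs little compared with putting the zero at distance \<open>|a|\<close> on the real axis.\<close>
lemma ln_norm_swept_le:
  assumes y: "0 < y" and a: "0 \<le> Im a" "a \<noteq> 0" "a \<noteq> \<i> * of_real y"
  shows "ln (norm (1 + of_real (y\<^sup>2) / a\<^sup>2)) + ln (y / norm (a - \<i> * of_real y)) \<le> ln (1 + y\<^sup>2 / (norm a)\<^sup>2) + Im a / y"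
proof -
  define u v where "u = norm (a - \<i> * of_real y)" and "v = norm (a + \<i> * of_real y)"
  have u: "0 < u" using a by (simp add: u_def)
  have "a + \<i> * of_real y \<noteq> 0" using y a by (auto simp: complex_eq_iff)
  then have v: "0 < v" by (simp add: v_def)
  have n: "0 < norm a" using a by simp
  have "1 + of_real (y\<^sup>2) / a\<^sup>2 = (a - \<i> * of_real y) * (a + \<i> * of_real y) / a\<^sup>2"
    using a by (simp add: field_simps power2_eq_square)
  then have "norm (1 + of_real (y\<^sup>2) / a\<^sup>2) = u * v / (norm a)\<^sup>2"
    by (simp only: norm_mult norm_divide norm_power u_def v_def)
  then have "ln (norm (1 + of_real (y\<^sup>2) / a\<^sup>2)) + ln (y / u) = ln (u * v / (norm a)\<^sup>2 * (y / u))"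
  proof -
    have "0 < u * v / (norm a)\<^sup>2" "0 < y / u" using u v n y by auto
    then show ?thesis using \<open>norm (1 + of_real (y\<^sup>2) / a\<^sup>2) = u * v / (norm a)\<^sup>2\<close> by (simp only: ln_mult_pos)
  qed
  \<comment> \<open>The sweeping term cancels \<open>norm (a - \<i> * y)\<close>, the factor that is
    small when \<open>a\<close> is near \<open>\<i> * y\<close>.\<close>
  also have "u * v / (norm a)\<^sup>2 * (y / u) = y * v / (norm a)\<^sup>2" using u by simp
  also have "ln (y * v / (norm a)\<^sup>2) \<le> ln (((norm a)\<^sup>2 + y\<^sup>2) * exp (Im a / y) / (norm a)\<^sup>2)"
    using mult_norm_add_le_exp[OF y a(1)] y v n
    by (subst ln_le_cancel_iff) (auto simp: v_def intro!: divide_right_mono divide_pos_pos mult_pos_pos add_pos_pos)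
  also have "((norm a)\<^sup>2 + y\<^sup>2) * exp (Im a / y) / (norm a)\<^sup>2 = (1 + y\<^sup>2 / (norm a)\<^sup>2) * exp (Im a / y)"
    using n by (simp add: field_simps)
  also have "ln \<dots> = ln (1 + y\<^sup>2 / (norm a)\<^sup>2) + Im a / y"
    by (subst ln_mult_pos) (auto simp: add_pos_nonneg)
  finally show ?thesis by (simp add: u_def)
qed

lemma ln_norm_one_plus_le:
  fixes a :: complex
  assumes "a \<noteq> 0"
  shows "ln (norm (1 + of_real (y\<^sup>2) / a\<^sup>2)) \<le> ln (1 + y\<^sup>2 / (norm a)\<^sup>2)"
proof (cases "1 + of_real (y\<^sup>2) / a\<^sup>2 = 0")
  case False
  have "norm (1 + of_real (y\<^sup>2) / a\<^sup>2) \<le> norm (1::complex) + norm (complex_of_real (y\<^sup>2) / a\<^sup>2)" by (rule norm_triangle_ineq)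
  also have "norm (complex_of_real (y\<^sup>2) / a\<^sup>2) = y\<^sup>2 / (norm a)\<^sup>2"
    unfolding norm_divide norm_power norm_of_real by simp
  finally show ?thesis using False by (subst ln_le_cancel_iff) (auto simp: add_pos_nonneg)
qed simp

context balanced_function
begin

lemma ln_representation:
  assumes R: "0 < R" and z: "z \<in> ball 0 R" "f z \<noteq> 0"
    and eq: "f z / f 0 * (\<Prod>a\<in>zeros_in m R. (1 - cnj a * z / of_real (R\<^sup>2)) ^ m a) =
       exp E * (\<Prod>a\<in>zeros_in m R. (1 - z / a) ^ m a)"
  shows "ln (norm (f z)) - ln (norm (f 0)) + (\<Sum>a\<in>zeros_in m R. real (m a) * ln (norm (1 - cnj a * z / of_real (R\<^sup>2))))
    = Re E + (\<Sum>a\<in>zeros_in m R. real (m a) * ln (norm (1 - z / a)))"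
proof -
  have 1: "1 - cnj a * z / of_real (R\<^sup>2) \<noteq> 0" if "a \<in> zeros_in m R" for a
  proof
    assume "1 - cnj a * z / of_real (R\<^sup>2) = 0"
    then have "norm (cnj a * z / of_real (R\<^sup>2)) = 1" by simp
    then have "norm a * norm z = R\<^sup>2" using R unfolding norm_divide norm_mult norm_of_real by simp
    moreover have "norm a * norm z < R * R"
      using that z by (intro mult_strict_mono') (auto simp: zeros_in_def)
    ultimately show False by (simp add: power2_eq_square)
  qed
  have 2: "1 - z / a \<noteq> 0" if "a \<in> zeros_in m R" for a
  proof -
    have "z \<noteq> a" using is_zero_set_zero_iff[OF zeros, of a] that z(2) by (auto simp: zeros_in_def)
    then show ?thesis using that by (auto simp: zeros_in_def)
  qed
  have n1: "0 < norm (\<Prod>a\<in>zeros_in m R. (1 - cnj a * z / of_real (R\<^sup>2)) ^ m a)"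
    and n2: "0 < norm (\<Prod>a\<in>zeros_in m R. (1 - z / a) ^ m a)"
    using 1 2 by auto
  have "ln (norm (f z)) - ln (norm (f 0)) + ln (norm (\<Prod>a\<in>zeros_in m R. (1 - cnj a * z / of_real (R\<^sup>2)) ^ m a))
     = ln (norm (f z / f 0 * (\<Prod>a\<in>zeros_in m R. (1 - cnj a * z / of_real (R\<^sup>2)) ^ m a)))"
    unfolding norm_mult norm_divide using n1 z f0 by (simp add: ln_mult_pos ln_div)
  also have "\<dots> = Re E + ln (norm (\<Prod>a\<in>zeros_in m R. (1 - z / a) ^ m a))"
    unfolding eq norm_mult using n2 by (simp add: ln_mult_pos)
  also have "ln (norm (\<Prod>a\<in>zeros_in m R. (1 - z / a) ^ m a)) = (\<Sum>a\<in>zeros_in m R. real (m a) * ln (norm (1 - z / a)))"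
    by (rule ln_norm_prod_power[OF finite_zeros]) (rule 2)
  also have "ln (norm (\<Prod>a\<in>zeros_in m R. (1 - cnj a * z / of_real (R\<^sup>2)) ^ m a)) =
      (\<Sum>a\<in>zeros_in m R. real (m a) * ln (norm (1 - cnj a * z / of_real (R\<^sup>2))))"
    by (rule ln_norm_prod_power[OF finite_zeros]) (rule 1)
  finally show ?thesis .
qed

text \<open>The representations at \<open>\<i> * y\<close> and \<open>- \<i> * y\<close> are added.
  The derivative of \<open>W\<close> at 0 drops out and the remainder is of size
  \<open>defect R / R^2\<close>, which tends to 0 although only \<open>defect R = O(R)\<close> is
  known so far. The paired factors \<open>1 + y^2 / a^2\<close> also make the sum insensitive to the
  still unknown convergence of the sum of \<open>1 / a\<close>.\<close>

lemma log_product_at_imaginary: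
  assumes y: "0 < y" and fy: "f (\<i> * of_real y) \<noteq> 0" "f (- (\<i> * of_real y)) \<noteq> 0" and \<delta>: "0 < \<delta>"
  shows "eventually (\<lambda>R. ln (norm (f (\<i> * of_real y))) + ln (norm (f (- (\<i> * of_real y)))) - 2 * ln (norm (f 0)) - \<delta>
    \<le> (\<Sum>a\<in>zeros_in m R. real (m a) * ln (norm (1 + of_real (y\<^sup>2) / a\<^sup>2)))) at_top"
proof -
  define z where "z = \<i> * complex_of_real y"
  have z2: "z * z = - of_real (y\<^sup>2)" by (simp add: z_def complex_eq_iff power2_eq_square)
  have nz: "norm z = y" using y by (simp add: z_def norm_mult)
  obtain K where K: "0 < K" "\<And>r. 0 < r \<Longrightarrow> num_zeros m r \<le> K * r" using num_zeros_le_linear by blast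
  define e1 where "e1 R w = of_real (\<sigma> * R) * (abs_Im_ext (w / of_real R) - 2 / pi)" for R w
  define err where "err R = 2 * y\<^sup>2 * (K / R) + norm (e1 R z) + norm (e1 R (- z)) +
    128 * y\<^sup>2 * ((2 * \<sigma> / pi * R + \<bar>ln (norm (f 0))\<bar>) / R\<^sup>2)" for R
  have "(err \<longlongrightarrow> 2 * y\<^sup>2 * 0 + 0 + 0 + 128 * y\<^sup>2 * 0) at_top" unfolding err_def
  proof (intro tendsto_add tendsto_mult tendsto_const)
    show "((\<lambda>R. K / R) \<longlongrightarrow> 0) at_top" by real_asymp
    show "((\<lambda>R. (2 * \<sigma> / pi * R + \<bar>ln (norm (f 0))\<bar>) / R\<^sup>2) \<longlongrightarrow> 0) at_top" by real_asymp
    show "((\<lambda>R. norm (e1 R z)) \<longlongrightarrow> 0) at_top" "((\<lambda>R. norm (e1 R (- z))) \<longlongrightarrow> 0) at_top"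
      unfolding e1_def by (intro tendsto_norm_zero tendsto_abs_Im_ext_scaled)+
  qed
  then have "eventually (\<lambda>R. err R < \<delta>) at_top" using \<delta> by (intro order_tendstoD) auto
  then show ?thesis using eventually_gt_at_top[of "4 * y"]
  proof eventually_elim
    case (elim R)
    have R: "0 < R" "4 * y < R" using elim y by auto
    obtain W where W: "W holomorphic_on ball 0 R" "\<And>z. z \<in> ball 0 R \<Longrightarrow> 0 \<le> Re (W z)" "Re (W 0) = defect R"
      and eq: "\<And>z. z \<in> ball 0 R \<Longrightarrow> f z / f 0 * (\<Prod>a\<in>zeros_in m R. (1 - cnj a * z / of_real (R\<^sup>2)) ^ m a) =
       exp (of_real (\<sigma> * R) * (abs_Im_ext (z / of_real R) - 2 / pi) - (W z - W 0)) * (\<Prod>a\<in>zeros_in m R. (1 - z / a) ^ m a)"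
      using disc_representation[OF R(1)] by blast
    have zb: "z \<in> ball 0 R" "- z \<in> ball 0 R" using R nz y by auto
    have fz: "f z \<noteq> 0" "f (- z) \<noteq> 0" using fy by (simp_all add: z_def)
    let ?S = "\<lambda>g. \<Sum>a\<in>zeros_in m R. real (m a) * ln (norm (g a :: complex))"
    have r1: "ln (norm (f z)) - ln (norm (f 0)) + ?S (\<lambda>a. 1 - cnj a * z / of_real (R\<^sup>2))
        = Re (e1 R z - (W z - W 0)) + ?S (\<lambda>a. 1 - z / a)"
      unfolding e1_def by (rule ln_representation[OF R(1) zb(1) fz(1) eq[OF zb(1)]])
    have r2: "ln (norm (f (- z))) - ln (norm (f 0)) + ?S (\<lambda>a. 1 - cnj a * (- z) / of_real (R\<^sup>2))
        = Re (e1 R (- z) - (W (- z) - W 0)) + ?S (\<lambda>a. 1 - (- z) / a)"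
      unfolding e1_def by (rule ln_representation[OF R(1) zb(2) fz(2) eq[OF zb(2)]])
    have nonzero: "1 - z / a \<noteq> 0" "1 - (- z) / a \<noteq> 0" "norm a < R" "a \<noteq> 0" if "a \<in> zeros_in m R" for a
    proof -
      have "a \<noteq> z" "a \<noteq> - z" using is_zero_set_zero_iff[OF zeros, of a] that fz by (auto simp: zeros_in_def)
      then show "1 - z / a \<noteq> 0" "1 - (- z) / a \<noteq> 0" "norm a < R" "a \<noteq> 0"
        using that by (auto simp: zeros_in_def field_simps add_eq_0_iff)
    qed
    have Q: "?S (\<lambda>a. 1 - z / a) + ?S (\<lambda>a. 1 - (- z) / a) = ?S (\<lambda>a. 1 + of_real (y\<^sup>2) / a\<^sup>2)"
      unfolding sum.distrib[symmetric]
    proof (rule sum.cong[OF refl])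
      fix a assume a: "a \<in> zeros_in m R"
      have "(1 - z / a) * (1 - (- z) / a) = 1 - z * z / a\<^sup>2"
        using nonzero(4)[OF a] by (simp add: field_simps power2_eq_square)
      then have "1 + of_real (y\<^sup>2) / a\<^sup>2 = (1 - z / a) * (1 - (- z) / a)" unfolding z2 by simp
      then show "real (m a) * ln (norm (1 - z / a)) + real (m a) * ln (norm (1 - (- z) / a)) = real (m a) * ln (norm (1 + of_real (y\<^sup>2) / a\<^sup>2))"
      proof -
        have "0 < norm (1 - z / a)" "0 < norm (1 - (- z) / a)" using nonzero(1,2)[OF a] by auto
        from ln_mult_pos[OF this] show ?thesis
          unfolding \<open>1 + of_real (y\<^sup>2) / a\<^sup>2 = (1 - z / a) * (1 - (- z) / a)\<close> norm_mult by (simp only: distrib_left)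
      qed
    qed
    \<comment> \<open>Pairing leaves \<open>ln (norm (1 - u^2))\<close> with
      \<open>norm u \<le> y / R\<close>. With at most \<open>K * R\<close> zeros the total error is
      \<open>O(1 / R)\<close>.\<close>
    have half: "- 2 * (y\<^sup>2 / R\<^sup>2) \<le> ln (norm (1 - cnj a * z / of_real (R\<^sup>2))) + ln (norm (1 - cnj a * (- z) / of_real (R\<^sup>2)))"
      if a: "a \<in> zeros_in m R" for a
    proof -
      define u where "u = cnj a * z / of_real (R\<^sup>2)"
      have "norm u = norm a * y / R\<^sup>2" unfolding u_def norm_divide norm_mult norm_of_real by (simp add: nz)
      also have "\<dots> \<le> R * y / R\<^sup>2" using nonzero(3)[OF a] y by (intro divide_right_mono mult_right_mono) auto
      finally have nu: "norm u \<le> y / R" using R by (simp add: power2_eq_square)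
      have yR: "y / R \<le> 1 / 4" using R by simp
      define q where "q = y\<^sup>2 / R\<^sup>2"
      have q: "(y / R) * (y / R) = q" "0 \<le> q" by (simp_all add: q_def power2_eq_square)
      have "norm (u * u) \<le> (y / R) * (y / R)" unfolding norm_mult using nu y R by (intro mult_mono) auto
      then have uu: "norm (u * u) \<le> q" unfolding q .
      have "(y / R) * (y / R) \<le> (1 / 4) * (1 / 4)" using yR y R by (intro mult_mono) auto
      then have small: "q \<le> 1 / 2" unfolding q by simp
      have "1 - q \<le> norm (1 - u * u)" using norm_triangle_ineq2[of 1 "u * u"] uu by simp
      then have "ln (1 - q) \<le> ln (norm (1 - u * u))" using small by (subst ln_le_cancel_iff) auto
      moreover have "- q - 2 * q\<^sup>2 \<le> ln (1 - q)"
        using small q by (intro ln_one_minus_pos_lower_bound) auto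
      moreover have "2 * q\<^sup>2 \<le> q"
        using mult_right_mono[OF small q(2)] by (simp add: power2_eq_square)
      ultimately have ge: "- 2 * q \<le> ln (norm (1 - u * u))" by linarith
      have "1 - u * u = (1 - u) * (1 - (- u))" by (simp add: algebra_simps)
      moreover have "norm u < 1" using nu yR by linarith
      then have "1 - u \<noteq> 0" "1 - (- u) \<noteq> 0" by (auto simp: add_eq_0_iff)
      then have "0 < norm (1 - u)" "0 < norm (1 - (- u))" by auto
      ultimately have "ln (norm (1 - u * u)) = ln (norm (1 - u)) + ln (norm (1 - (- u)))"
        by (simp only: norm_mult ln_mult_pos)
      moreover have "- u = cnj a * (- z) / of_real (R\<^sup>2)" by (simp add: u_def)
      ultimately show ?thesis using ge by (simp only: u_def q_def)
    qed
    have P: "- (2 * y\<^sup>2 * (K / R)) \<le> ?S (\<lambda>a. 1 - cnj a * z / of_real (R\<^sup>2)) + ?S (\<lambda>a. 1 - cnj a * (- z) / of_real (R\<^sup>2))"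
    proof -
      have "num_zeros m R * (2 * (y\<^sup>2 / R\<^sup>2)) \<le> K * R * (2 * (y\<^sup>2 / R\<^sup>2))"
        using K(2)[OF R(1)] by (intro mult_right_mono) auto
      also have "\<dots> = 2 * y\<^sup>2 * (K / R)" using R by (simp add: power2_eq_square)
      finally have "- (2 * y\<^sup>2 * (K / R)) \<le> num_zeros m R * (- 2 * (y\<^sup>2 / R\<^sup>2))" by simp
      also have "\<dots> = (\<Sum>a\<in>zeros_in m R. real (m a) * (- 2 * (y\<^sup>2 / R\<^sup>2)))"
        by (simp only: num_zeros_def sum_distrib_right)
      also have "\<dots> \<le> (\<Sum>a\<in>zeros_in m R. real (m a) * (ln (norm (1 - cnj a * z / of_real (R\<^sup>2))) + ln (norm (1 - cnj a * (- z) / of_real (R\<^sup>2)))))"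
        by (intro sum_mono mult_left_mono half) auto
      finally show ?thesis by (simp only: distrib_left sum.distrib)
    qed
    have T: "norm (W v - W 0 - deriv W 0 * v) \<le> 64 * defect R / R\<^sup>2 * y\<^sup>2" if "norm v = y" for v
      using Taylor1_centre_le[OF W(1,2) R(1), of v] that R W(3) by simp
    have "- Re ((W z - W 0) + (W (- z) - W 0)) \<le> norm ((W z - W 0 - deriv W 0 * z) + (W (- z) - W 0 - deriv W 0 * (- z)))"
      using abs_Re_le_cmod[of "(W z - W 0) + (W (- z) - W 0)"] by (simp add: algebra_simps)
    also have "\<dots> \<le> 64 * defect R / R\<^sup>2 * y\<^sup>2 + 64 * defect R / R\<^sup>2 * y\<^sup>2"
      by (rule norm_triangle_mono[OF T T]) (simp_all add: nz)
    also have "\<dots> = 128 * y\<^sup>2 * (defect R / R\<^sup>2)" by simp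
    also have "\<dots> \<le> 128 * y\<^sup>2 * ((2 * \<sigma> / pi * R + \<bar>ln (norm (f 0))\<bar>) / R\<^sup>2)"
      by (intro mult_left_mono divide_right_mono defect_le R) auto
    finally have W2: "- (Re (W z - W 0) + Re (W (- z) - W 0)) \<le> 128 * y\<^sup>2 * ((2 * \<sigma> / pi * R + \<bar>ln (norm (f 0))\<bar>) / R\<^sup>2)"
      by simp
    have arith: "A + B - 2 * C - d \<le> Q"
      if "A - C + P1 = (E1 - W1) + Q1" "B - C + P2 = (E2 - W2) + Q2" "Q1 + Q2 = Q" "- p \<le> P1 + P2"
        "- (W1 + W2) \<le> w" "E1 \<le> n1" "E2 \<le> n2" "p + n1 + n2 + w < d"
      for A B C P1 P2 Q1 Q2 Q E1 E2 W1 W2 p w n1 n2 d :: real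
      using that by linarith
    show ?case unfolding z_def[symmetric]
      by (rule arith[OF r1[unfolded minus_complex.sel] r2[unfolded minus_complex.sel] Q P W2[unfolded minus_complex.sel]
            complex_Re_le_cmod complex_Re_le_cmod elim(1)[unfolded err_def]])
  qed
qed

end

section \<open>The defect is small\<close>

context balanced_function
begin

text \<open>Each half-plane loses \<open>4 * \<epsilon> * y\<close> through Harnack and
  \<open>32 * \<epsilon> * y\<close> through sweeping the zeros, in all
  \<open>72 * \<epsilon> * y\<close>. The lower half-plane is treated by applying the upper
  estimates to \<open>f (- z)\<close>.\<close>

lemma log_sum_lower_bound:
  assumes e: "0 < \<epsilon>"
  shows "\<exists>Y>0. \<forall>y\<ge>Y. f (\<i> * of_real y) \<noteq> 0 \<longrightarrow> f (- (\<i> * of_real y)) \<noteq> 0 \<longrightarrow>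
    eventually (\<lambda>R. (2 * \<sigma> - 72 * \<epsilon>) * y - 2 * ln (norm (f 0)) - 1 \<le> (\<Sum>a\<in>zeros_in m R. real (m a) * ln (1 + y\<^sup>2 / (norm a)\<^sup>2))) at_top"
proof -
  define g where "g z = f (- z)" for z
  define k where "k z = m (- z)" for z
  have "(f \<circ> uminus) holomorphic_on UNIV"
    by (rule holomorphic_on_compose_gen[OF _ holo]) (auto intro!: holomorphic_intros)
  then have g: "g holomorphic_on UNIV" by (simp add: g_def[abs_def] o_def)
  have kz: "is_zero_set k g" unfolding k_def[abs_def] g_def[abs_def] by (rule is_zero_set_reflect[OF holo zeros])
  have kd: "no_finite_limit_points k"
    unfolding no_finite_limit_points_def
  proof
    fix r :: real
    have "{z. 0 < k z \<and> norm z \<le> r} = uminus ` {z. 0 < m z \<and> norm z \<le> r}"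
      by (force simp: k_def image_iff)
    then show "finite {z. 0 < k z \<and> norm z \<le> r}"
      using discrete by (simp add: no_finite_limit_points_def)
  qed
  have bf: "norm (f z) \<le> exp (\<sigma> * Im z)" and bg: "norm (g z) \<le> exp (\<sigma> * Im z)" if "0 \<le> Im z" for z
    using bound[of z] bound[of "- z"] that by (auto simp: g_def)
  define A where "A y = {a. 0 < m a \<and> a \<in> ball (\<i> * complex_of_real y) y}" for y
  define B where "B y = {a. 0 < m a \<and> - a \<in> ball (\<i> * complex_of_real y) y}" for y
  define c where "c a y = ln (y / norm (a - \<i> * complex_of_real y))" for a y
  obtain Y1 where Y1: "0 < Y1" "\<And>y. Y1 \<le> y \<Longrightarrow> (\<Sum>a\<in>A y. real (m a) * Im a) \<le> 32 * \<epsilon> * y\<^sup>2"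
    "\<And>y. Y1 \<le> y \<Longrightarrow> f (\<i> * of_real y) \<noteq> 0 \<Longrightarrow> (\<sigma> - 4 * \<epsilon>) * y \<le> ln (norm (f (\<i> * of_real y))) + (\<Sum>a\<in>A y. real (m a) * c a y)"
    using half_plane_estimates[OF holo zeros discrete bf e sharp_upper[OF e]] unfolding A_def c_def by blast
  obtain Y2 where Y2: "0 < Y2" "\<And>y. Y2 \<le> y \<Longrightarrow> (\<Sum>a | 0 < k a \<and> a \<in> ball (\<i> * of_real y) y. real (k a) * Im a) \<le> 32 * \<epsilon> * y\<^sup>2"
    "\<And>y. Y2 \<le> y \<Longrightarrow> g (\<i> * of_real y) \<noteq> 0 \<Longrightarrow> (\<sigma> - 4 * \<epsilon>) * y \<le> ln (norm (g (\<i> * of_real y))) +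
        (\<Sum>a | 0 < k a \<and> a \<in> ball (\<i> * of_real y) y. real (k a) * c a y)"
    using half_plane_estimates[OF g kz kd bg e] sharp_lower[OF e] unfolding c_def g_def by blast
  have reflect: "(\<Sum>a | 0 < k a \<and> a \<in> ball (\<i> * of_real y) y. real (k a) * \<phi> a) = (\<Sum>a\<in>B y. real (m a) * \<phi> (- a))" for y \<phi>
    unfolding B_def k_def by (rule sum.reindex_bij_witness[of _ uminus uminus]) auto
  have Im_pos: "0 < Im a" if "a \<in> ball (\<i> * of_real y) y" "0 < y" for a y
  proof -
    have "norm (a - \<i> * of_real y) < y" using that by (simp add: dist_norm norm_minus_commute)
    then have "\<bar>Im (a - \<i> * of_real y)\<bar> < y" using abs_Im_le_cmod order_le_less_trans by blast
    then show ?thesis by simp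
  qed
  show ?thesis
  proof (intro exI[of _ "max Y1 Y2"] conjI allI impI)
    show "0 < max Y1 Y2" using Y1 by simp
    fix y assume y: "max Y1 Y2 \<le> y" and fy: "f (\<i> * of_real y) \<noteq> 0" "f (- (\<i> * of_real y)) \<noteq> 0"
    have y0: "0 < y" using y Y1 by simp
    have gy: "g (\<i> * of_real y) \<noteq> 0" using fy by (simp add: g_def)
    show "eventually (\<lambda>R. (2 * \<sigma> - 72 * \<epsilon>) * y - 2 * ln (norm (f 0)) - 1 \<le> (\<Sum>a\<in>zeros_in m R. real (m a) * ln (1 + y\<^sup>2 / (norm a)\<^sup>2))) at_top"
      using log_product_at_imaginary[OF y0 fy zero_less_one] eventually_gt_at_top[of "2 * y"]
    proof eventually_elim
      case (elim R)
      define Z where "Z = zeros_in m R"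
      have Zin: "a \<in> Z" if "0 < m a" "norm (a - \<i> * of_real y) < y \<or> norm (- a - \<i> * of_real y) < y" for a
      proof -
        have "norm a < 2 * y"
          using that(2) norm_triangle_sub[of a "\<i> * of_real y"] norm_triangle_sub[of "- a" "\<i> * of_real y"] y0
          by (auto simp: norm_mult)
        moreover have "a \<noteq> 0" using that m0 by auto
        ultimately show ?thesis using that elim by (simp add: Z_def zeros_in_def)
      qed
      have AZ: "Z \<inter> A y = A y" "Z \<inter> B y = B y"
      proof -
        have "a \<in> Z" if "a \<in> A y" for a
          using that Zin[of a] norm_minus_commute[of a] unfolding A_def mem_ball dist_norm by simp
        then show "Z \<inter> A y = A y" by blast
        have "a \<in> Z" if "a \<in> B y" for a
          using that Zin[of a] unfolding B_def mem_ball dist_norm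
          by (simp add: norm_minus_commute[of "- a"])
        then show "Z \<inter> B y = B y" by blast
      qed
      have fin: "finite Z" by (simp add: Z_def)
      have restrict: "(\<Sum>a\<in>A y. \<phi> a) = (\<Sum>a\<in>Z. if a \<in> A y then \<phi> a else 0)"
        "(\<Sum>a\<in>B y. \<phi> a) = (\<Sum>a\<in>Z. if a \<in> B y then \<phi> a else 0)" for \<phi> :: "complex \<Rightarrow> real"
        using sum.inter_restrict[OF fin, of \<phi> "A y"] sum.inter_restrict[OF fin, of \<phi> "B y"] unfolding AZ by auto
      define L where "L a = ln (1 + y\<^sup>2 / (norm a)\<^sup>2)" for a :: complex
      define T where "T a = ln (norm (1 + of_real (y\<^sup>2) / a\<^sup>2))" for a :: complex
      have le: "real (m a) * T a + (if a \<in> A y then real (m a) * c a y else 0) + (if a \<in> B y then real (m a) * c (- a) y else 0)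
        \<le> real (m a) * L a + (if a \<in> A y then real (m a) * Im a / y else 0) + (if a \<in> B y then real (m a) * Im (- a) / y else 0)"
        if a: "a \<in> Z" for a
      proof -
        have a0: "a \<noteq> 0" "0 < m a" using a by (auto simp: Z_def zeros_in_def)
        have fa: "f a = 0" using is_zero_set_zero_iff[OF zeros, of a] a0 by simp
        then have ne: "a \<noteq> \<i> * of_real y" "- a \<noteq> \<i> * of_real y"
          using fy by (auto simp: minus_equation_iff[of a])
        \<comment> \<open>The two discs lie in opposite open half-planes, so no zero is swept twice;
          the others need only the triangle inequality.\<close>
        consider "a \<in> A y" "a \<notin> B y" | "a \<notin> A y" "a \<in> B y" | "a \<notin> A y" "a \<notin> B y"
          using Im_pos[of a y] Im_pos[of "- a" y] y0 by (force simp: A_def B_def)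
        then show ?thesis
        proof cases
          case 1
          have "0 \<le> Im a" using 1 Im_pos[of a y] y0 by (simp add: A_def)
          then have "T a + c a y \<le> L a + Im a / y"
            unfolding T_def c_def L_def by (rule ln_norm_swept_le[OF y0 _ a0(1) ne(1)])
          then have "real (m a) * (T a + c a y) \<le> real (m a) * (L a + Im a / y)" by (intro mult_left_mono) auto
          then show ?thesis using 1 by (simp add: distrib_left)
        next
          case 2
          have "0 \<le> Im (- a)" using 2 Im_pos[of "- a" y] y0 by (simp add: B_def)
          then have "ln (norm (1 + of_real (y\<^sup>2) / (- a)\<^sup>2)) + ln (y / norm (- a - \<i> * of_real y)) \<le> ln (1 + y\<^sup>2 / (norm (- a))\<^sup>2) + Im (- a) / y"
            by (rule ln_norm_swept_le[OF y0 _ _ ne(2)]) (use a0 in simp)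
          then have "T a + c (- a) y \<le> L a + Im (- a) / y" unfolding T_def c_def L_def by simp
          then have "real (m a) * (T a + c (- a) y) \<le> real (m a) * (L a + Im (- a) / y)" by (intro mult_left_mono) auto
          then show ?thesis using 2 by (simp add: distrib_left right_diff_distrib)
        next
          case 3
          have "T a \<le> L a" unfolding T_def L_def by (rule ln_norm_one_plus_le[OF a0(1)])
          then have "real (m a) * T a \<le> real (m a) * L a" by (intro mult_left_mono) auto
          then show ?thesis using 3 by simp
        qed
      qed
      have main: "(\<Sum>a\<in>Z. real (m a) * T a) + (\<Sum>a\<in>A y. real (m a) * c a y) + (\<Sum>a\<in>B y. real (m a) * c (- a) y) \<le>
          (\<Sum>a\<in>Z. real (m a) * L a) + (\<Sum>a\<in>A y. real (m a) * Im a / y) + (\<Sum>a\<in>B y. real (m a) * Im (- a) / y)"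
        unfolding restrict sum.distrib[symmetric] by (intro sum_mono le)
      have SA: "(\<Sum>a\<in>A y. real (m a) * Im a / y) \<le> 32 * \<epsilon> * y"
        using Y1(2)[of y] y y0 by (simp add: sum_divide_distrib[symmetric] divide_le_eq power2_eq_square mult_ac)
      have SB: "(\<Sum>a\<in>B y. real (m a) * Im (- a) / y) \<le> 32 * \<epsilon> * y"
      proof -
        have "(\<Sum>a\<in>B y. real (m a) * Im (- a)) \<le> 32 * \<epsilon> * y\<^sup>2"
          using Y2(2)[of y] y unfolding reflect by simp
        then have "(\<Sum>a\<in>B y. real (m a) * Im (- a)) / y \<le> 32 * \<epsilon> * y"
          using y0 by (simp add: divide_le_eq power2_eq_square mult_ac)
        then show ?thesis by (simp only: sum_divide_distrib)
      qed
      have U: "(\<sigma> - 4 * \<epsilon>) * y \<le> ln (norm (f (\<i> * of_real y))) + (\<Sum>a\<in>A y. real (m a) * c a y)"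
        by (rule Y1(3)) (use y fy in auto)
      have V: "(\<sigma> - 4 * \<epsilon>) * y \<le> ln (norm (f (- (\<i> * of_real y)))) + (\<Sum>a\<in>B y. real (m a) * c (- a) y)"
        using Y2(3)[of y] y gy unfolding reflect by (simp add: g_def)
      have "ln (norm (f (\<i> * of_real y))) + ln (norm (f (- (\<i> * of_real y)))) - 2 * ln (norm (f 0)) - 1 \<le> (\<Sum>a\<in>Z. real (m a) * T a)"
        using elim(1) unfolding Z_def T_def .
      with main SA SB U V have "2 * ((\<sigma> - 4 * \<epsilon>) * y) - 64 * (\<epsilon> * y) - 2 * ln (norm (f 0)) - 1 \<le> (\<Sum>a\<in>Z. real (m a) * L a)"
        by linarith
      then show ?case unfolding Z_def L_def by (simp add: algebra_simps)
    qed
  qed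
qed

text \<open>The lower bound needs \<open>f\<close> nonzero at both points of the imaginary axis;
  only finitely many heights in the interval violate this.\<close>

lemma exists_height_avoiding_zeros:
  assumes t: "0 < t"
  obtains y where "t \<le> y" "y \<le> 2 * t" "f (\<i> * of_real y) \<noteq> 0" "f (- (\<i> * of_real y)) \<noteq> 0"
proof -
  define S where "S = {z. 0 < m z \<and> norm z \<le> 2 * t}"
  have "finite S" using discrete by (simp add: S_def no_finite_limit_points_def)
  then have "finite (Im ` S \<union> (\<lambda>z. - Im z) ` S)" by simp
  moreover have "infinite {t..2 * t}" using t by (intro infinite_Icc) simp
  ultimately obtain y where y: "y \<in> {t..2 * t}" "y \<notin> Im ` S \<union> (\<lambda>z. - Im z) ` S"
    by (meson finite_subset subsetI)
  have n: "norm (\<i> * complex_of_real y) \<le> 2 * t" using y t by (simp add: norm_mult)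
  show thesis
  proof (rule that)
    show "t \<le> y" "y \<le> 2 * t" using y by auto
    show "f (\<i> * of_real y) \<noteq> 0"
    proof
      assume "f (\<i> * of_real y) = 0"
      then have "\<i> * of_real y \<in> S" using is_zero_set_zero_iff[OF zeros] n by (simp add: S_def)
      then have "Im (\<i> * of_real y) \<in> Im ` S" by (rule imageI)
      then show False using y by simp
    qed
    show "f (- (\<i> * of_real y)) \<noteq> 0"
    proof
      assume "f (- (\<i> * of_real y)) = 0"
      then have "- (\<i> * of_real y) \<in> S" using is_zero_set_zero_iff[OF zeros] n by (simp add: S_def)
      then have "- Im (- (\<i> * of_real y)) \<in> (\<lambda>z. - Im z) ` S" by (rule imageI)
      then show False using y by simp
    qed
  qed
qed

text \<open>The numerator is smallest at \<open>y = t\<close>, \<open>s = t / 2\<close>, the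
  denominator largest at \<open>y = 2 * t\<close>, \<open>s = t\<close>.\<close>

lemma log_kernel_ge:
  assumes t: "0 < t" and y: "t \<le> y" "y \<le> 2 * t" and s: "t / 2 \<le> s" "s \<le> t"
  shows "2 / (25 * t) \<le> log_kernel y s"
proof -
  have "2 / (25 * t) = 4 * t\<^sup>2 * (t / 2) / (t\<^sup>2 + (2 * t)\<^sup>2)\<^sup>2"
    using t by (simp add: field_simps power2_eq_square)
  also have "\<dots> \<le> 4 * y\<^sup>2 * s / (s\<^sup>2 + y\<^sup>2)\<^sup>2"
    using t y s by (intro frac_le mult_mono power_mono add_mono) (auto intro!: zero_less_power add_pos_pos)
  finally show ?thesis by (simp add: log_kernel_def)
qed

text \<open>A defect above \<open>\<delta> * t\<close> would leave a gap of at least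
  \<open>\<delta> * t / 2\<close> for \<open>(1 - \<mu>) * t \<le> s \<le> t\<close>. Against the
  kernel this gap costs \<open>\<delta> * \<mu> * t / 25\<close>, more than the difference between
  the upper and the lower bound for the sum of logarithms permits when \<open>t\<close> is
  large.\<close>

lemma defect_eventually_le:
  assumes \<delta>: "0 < \<delta>"
  shows "eventually (\<lambda>t. defect t \<le> \<delta> * t) at_top"
proof -
  define \<beta> where "\<beta> = 2 * \<sigma> / pi"
  have b: "0 \<le> \<beta>" using sigma_nonneg by (simp add: \<beta>_def)
  have pb: "pi * \<beta> = 2 * \<sigma>" by (simp add: \<beta>_def)
  \<comment> \<open>Chosen so that the linear bound \<open>\<beta> * s\<close> falls by at most
    \<open>\<delta> * t / 2\<close> over the interval, half of the assumed shortfall.\<close>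
  define \<mu> where "\<mu> = min (1 / 2) (\<delta> / (2 * (\<beta> + 1)))"
  have "0 < \<mu>" using \<delta> b by (auto simp: \<mu>_def)
  moreover have "\<mu> \<le> 1 / 2" unfolding \<mu>_def by (rule min.cobounded1)
  ultimately have mu: "0 < \<mu>" "\<mu> \<le> 1 / 2" by auto
  have "\<mu> * (\<beta> + 1) \<le> \<delta> / (2 * (\<beta> + 1)) * (\<beta> + 1)" using b by (intro mult_right_mono) (auto simp: \<mu>_def)
  also have "\<dots> = \<delta> / 2" using b by (simp add: field_simps)
  finally have bmu: "\<beta> * \<mu> \<le> \<delta> / 2" using mu by (simp add: algebra_simps)
  define C where "C = \<bar>ln (norm (f 0))\<bar>"
  have C0: "0 \<le> C" by (simp add: C_def)
  \<comment> \<open>Then \<open>72 * \<epsilon> * (2 * t) = \<delta> * \<mu> * t / 50\<close>, half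
    of the cost of the gap.\<close>
  define \<epsilon> where "\<epsilon> = \<delta> * \<mu> / 7200"
  have e: "0 < \<epsilon>" using \<delta> mu by (simp add: \<epsilon>_def)
  obtain Y where Y: "0 < Y" "\<And>y. Y \<le> y \<Longrightarrow> f (\<i> * of_real y) \<noteq> 0 \<Longrightarrow> f (- (\<i> * of_real y)) \<noteq> 0 \<Longrightarrow>
    eventually (\<lambda>R. (2 * \<sigma> - 72 * \<epsilon>) * y - 2 * ln (norm (f 0)) - 1 \<le> (\<Sum>a\<in>zeros_in m R. real (m a) * ln (1 + y\<^sup>2 / (norm a)\<^sup>2))) at_top"
    using log_sum_lower_bound[OF e] by blast
  show ?thesis
    using eventually_gt_at_top[of Y] eventually_gt_at_top[of "50 * (4 * C + 1) / (\<delta> * \<mu>)"]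
  proof eventually_elim
    case (elim t)
    have t: "0 < t" using elim Y by simp
    show ?case
    proof (rule ccontr)
      assume "\<not> defect t \<le> \<delta> * t"
      then have big: "\<delta> * t < defect t" by simp
      obtain y where y: "t \<le> y" "y \<le> 2 * t" "f (\<i> * of_real y) \<noteq> 0" "f (- (\<i> * of_real y)) \<noteq> 0"
        by (rule exists_height_avoiding_zeros[OF t])
      have y0: "0 < y" using y t by simp
      obtain R where R: "(2 * \<sigma> - 72 * \<epsilon>) * y - 2 * ln (norm (f 0)) - 1 \<le> (\<Sum>a\<in>zeros_in m R. real (m a) * ln (1 + y\<^sup>2 / (norm a)\<^sup>2))"
        using eventually_happens'[OF trivial_limit_at_top_linorder Y(2)[of y]] y elim by auto
      define l where "l = (1 - \<mu>) * t"
      have "1 / 2 * t \<le> (1 - \<mu>) * t" "(1 - \<mu>) * t \<le> 1 * t" using mu t by (intro mult_right_mono; simp)+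
      then have l: "t / 2 \<le> l" "l \<le> t" "0 < l" using t by (auto simp: l_def)
      have count: "(\<Sum>a | a \<in> zeros_in m R \<and> norm a \<le> s. real (m a) * ln (s / norm a)) \<le> log_zeros m s" if s: "0 < s" for s
      proof -
        have sub: "{a. a \<in> zeros_in m R \<and> norm a < s} \<subseteq> {a. a \<in> zeros_in m R \<and> norm a \<le> s}" by auto
        have zero: "real (m a) * ln (s / norm a) = 0"
          if "a \<in> {a. a \<in> zeros_in m R \<and> norm a \<le> s} - {a. a \<in> zeros_in m R \<and> norm a < s}" for a
        proof -
          have "norm a = s" using that by auto
          then show ?thesis using s by simp
        qed
        have "(\<Sum>a | a \<in> zeros_in m R \<and> norm a \<le> s. real (m a) * ln (s / norm a)) =
            (\<Sum>a | a \<in> zeros_in m R \<and> norm a < s. real (m a) * ln (s / norm a))"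
          by (rule sum.mono_neutral_right[OF _ sub]) (use zero in auto)
        also have "\<dots> \<le> log_zeros m s" unfolding log_zeros_def
        proof (rule sum_mono2)
          show "{a. a \<in> zeros_in m R \<and> norm a < s} \<subseteq> zeros_in m s" by (auto simp: zeros_in_def)
        qed (use log_zeros_term_nonneg in auto)
        finally show ?thesis .
      qed
      have "(\<Sum>a\<in>zeros_in m R. real (m a) * ln (1 + y\<^sup>2 / (norm a)\<^sup>2)) + (\<delta> * t / 2) * (2 / (25 * t)) * (t - l) \<le> pi * \<beta> * y + 2 * C"
      proof (rule sum_ln_one_plus_le[OF finite_zeros _ _ y0 b C0 _ _ l(3,2)])
        show "0 \<le> \<delta> * t / 2" "0 \<le> 2 / (25 * t)" using \<delta> t by auto
        show "0 < norm a" if "a \<in> zeros_in m R" for a using that by (simp add: zeros_in_def)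
        show "2 / (25 * t) \<le> log_kernel y s" if "l \<le> s" "s \<le> t" for s
          using log_kernel_ge[OF t y(1,2), of s] that l by simp
        fix s :: real assume s: "0 < s"
        show "(\<Sum>a | a \<in> zeros_in m R \<and> norm a \<le> s. real (m a) * ln (s / norm a)) + (if l \<le> s \<and> s \<le> t then \<delta> * t / 2 else 0) \<le> \<beta> * s + C"
        proof (cases "l \<le> s \<and> s \<le> t")
          case False
          then show ?thesis using count[OF s] log_zeros_le[OF s] by (auto simp: \<beta>_def C_def)
        next
          case True
          have "log_zeros m s \<le> log_zeros m t" by (rule log_zeros_mono[OF discrete s]) (use True in simp)
          also have "\<dots> \<le> \<beta> * t + C - \<delta> * t" using big by (simp add: defect_def \<beta>_def C_def)
          finally have "log_zeros m s \<le> \<beta> * t + C - \<delta> * t" .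
          moreover have "\<beta> * l \<le> \<beta> * s" using True b by (intro mult_left_mono) auto
          moreover have "\<beta> * l = \<beta> * t - (\<beta> * \<mu>) * t" by (simp add: l_def algebra_simps)
          moreover have "(\<beta> * \<mu>) * t \<le> \<delta> / 2 * t" using bmu t by (intro mult_right_mono) auto
          ultimately have "log_zeros m s + \<delta> * t / 2 \<le> \<beta> * s + C" by (simp add: algebra_simps)
          then show ?thesis using count[OF s] True by auto
        qed
      qed auto
      also have "(\<delta> * t / 2) * (2 / (25 * t)) * (t - l) = \<delta> * \<mu> * t / 25"
        using t by (simp add: l_def field_simps)
      finally have "(2 * \<sigma> - 72 * \<epsilon>) * y - 2 * ln (norm (f 0)) - 1 + \<delta> * \<mu> * t / 25 \<le> 2 * \<sigma> * y + 2 * C"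
        using R unfolding pb by linarith
      moreover have "ln (norm (f 0)) \<le> C" by (simp add: C_def)
      ultimately have "\<delta> * \<mu> * t / 25 \<le> 72 * \<epsilon> * y + 4 * C + 1" by (simp add: algebra_simps)
      moreover have "72 * \<epsilon> * y \<le> 72 * \<epsilon> * (2 * t)" using y e by (intro mult_left_mono) auto
      moreover have "72 * \<epsilon> * (2 * t) = \<delta> * \<mu> * t / 50" by (simp add: \<epsilon>_def)
      ultimately have "\<delta> * \<mu> * t / 50 \<le> 4 * C + 1" by linarith
      then have upper: "t * (\<delta> * \<mu>) \<le> 50 * (4 * C + 1)" by (simp add: mult_ac)
      have "50 * (4 * C + 1) < t * (\<delta> * \<mu>)" using elim(2) \<delta> mu by (simp add: divide_less_eq)
      with upper show False by (meson not_le)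
    qed
  qed
qed

lemma defect_over_tendsto_0: "((\<lambda>R. defect R / R) \<longlongrightarrow> 0) at_top"
proof (rule tendstoI)
  fix e :: real assume e: "0 < e"
  have "eventually (\<lambda>t. defect t \<le> e / 2 * t) at_top" by (rule defect_eventually_le) (use e in simp)
  then show "eventually (\<lambda>R. dist (defect R / R) 0 < e) at_top" using eventually_gt_at_top[of 0]
  proof eventually_elim
    case (elim R)
    have "\<bar>defect R / R\<bar> = defect R / R" using defect_nonneg[of R] elim by simp
    also have "\<dots> \<le> e / 2" using elim by (simp add: divide_le_eq)
    also have "\<dots> < e" using e by simp
    finally show ?case by (simp only: dist_real_def diff_zero)
  qed
qed

end

section \<open>Consequences of a small defect\<close>

lemma DERIV_prod_one_minus_at_0:
  fixes c :: "'a \<Rightarrow> complex"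
  assumes "finite A"
  shows "((\<lambda>z. \<Prod>a\<in>A. (1 - c a * z) ^ k a) has_field_derivative - (\<Sum>a\<in>A. of_nat (k a) * c a)) (at 0)"
  using assms
proof (induction A)
  case (insert b A)
  have "((\<lambda>z. (1 - c b * z) ^ k b) has_field_derivative - (of_nat (k b) * c b)) (at 0)"
    by (auto intro!: derivative_eq_intros)
  from DERIV_mult[OF this insert.IH] show ?case using insert.hyps by (simp add: algebra_simps)
qed simp

context balanced_function
begin

text \<open>\<open>log_zeros\<close> is linear up to the defect, so its increments over the ratio
  \<open>1 + \<eta>\<close>, taken above and below \<open>R\<close>, determine
  \<open>num_zeros m R\<close> approximately. At the other endpoint only the sign of the defect
  enters, so smallness is needed at \<open>R\<close> alone.\<close>

lemma num_zeros_eventually_near: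
  assumes e: "0 < e"
  shows "eventually (\<lambda>R. \<bar>num_zeros m R - 2 * \<sigma> / pi * R\<bar> \<le> e * R) at_top"
proof -
  define \<beta> where "\<beta> = 2 * \<sigma> / pi"
  have b: "0 \<le> \<beta>" using sigma_nonneg by (simp add: \<beta>_def)
  define \<eta> where "\<eta> = min 1 (e / (2 * (\<beta> + 1)))"
  have eta: "0 < \<eta>" using e b by (auto simp: \<eta>_def)
  have eta1: "\<eta> \<le> 1" unfolding \<eta>_def by (rule min.cobounded1)
  have "\<eta> * (\<beta> + 1) \<le> e / (2 * (\<beta> + 1)) * (\<beta> + 1)" using b by (intro mult_right_mono) (auto simp: \<eta>_def)
  also have "\<dots> = e / 2" using b by (simp add: field_simps)
  finally have eb: "\<eta> * \<beta> \<le> e / 2" using eta by (simp add: algebra_simps)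
  \<comment> \<open>The defect gets divided by \<eta> below; this choice leaves
    \<open>e / 2 * R\<close> for it, and the other half of \<open>e\<close> pays for
    \<open>\<eta> * \<beta>\<close>.\<close>
  have "0 < e * \<eta> / 4" using e eta by simp
  from defect_eventually_le[OF this] show ?thesis using eventually_gt_at_top[of 0]
  proof eventually_elim
    case (elim R)
    then have R: "0 < R" and d: "defect R \<le> e * \<eta> / 4 * R" by auto
    have ln_up: "ln (1 + \<eta>) \<le> \<eta>" using ln_add_one_self_le_self[of \<eta>] eta by simp
    have ln_lo: "\<eta> / (1 + \<eta>) \<le> ln (1 + \<eta>)"
    proof -
      have "ln (1 / (1 + \<eta>)) \<le> 1 / (1 + \<eta>) - 1" using eta by (intro ln_le_minus_one) auto
      moreover have "1 / (1 + \<eta>) - 1 = - (\<eta> / (1 + \<eta>))" using eta by (simp add: field_simps)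
      moreover have "ln (1 / (1 + \<eta>)) = - ln (1 + \<eta>)" using eta by (simp add: ln_div)
      ultimately show ?thesis by linarith
    qed
    have N: "log_zeros m r = \<beta> * r - ln (norm (f 0)) - defect r" for r by (simp add: defect_def \<beta>_def)
    have dR: "(1 + \<eta>) / \<eta> * defect R \<le> e / 2 * R"
    proof -
      have "(1 + \<eta>) / \<eta> * defect R \<le> 2 / \<eta> * (e * \<eta> / 4 * R)"
        using eta eta1 d defect_nonneg[OF R] by (intro mult_mono divide_right_mono) auto
      also have "2 / \<eta> * (e * \<eta> / 4 * R) = e / 2 * R" using eta by (simp add: field_simps)
      finally show ?thesis .
    qed
    have upper: "num_zeros m R \<le> \<beta> * R + e * R"
    proof -
      have "num_zeros m R * ln ((1 + \<eta>) * R / R) \<le> log_zeros m ((1 + \<eta>) * R) - log_zeros m R"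
        by (rule log_zeros_diff_ge[OF discrete R]) (use eta R in simp)
      also have "\<dots> \<le> \<beta> * \<eta> * R + defect R"
      proof -
        have "0 \<le> defect ((1 + \<eta>) * R)" by (rule defect_nonneg) (use eta R in simp)
        then show ?thesis unfolding N by (simp add: algebra_simps)
      qed
      finally have "num_zeros m R * ln (1 + \<eta>) \<le> \<beta> * \<eta> * R + defect R" using R by simp
      moreover have "num_zeros m R * (\<eta> / (1 + \<eta>)) \<le> num_zeros m R * ln (1 + \<eta>)"
        by (intro mult_left_mono ln_lo num_zeros_nonneg)
      ultimately have "num_zeros m R * (\<eta> / (1 + \<eta>)) \<le> \<beta> * \<eta> * R + defect R" by linarith
      then have "num_zeros m R * (\<eta> / (1 + \<eta>)) * ((1 + \<eta>) / \<eta>) \<le> (\<beta> * \<eta> * R + defect R) * ((1 + \<eta>) / \<eta>)"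
        using eta by (intro mult_right_mono) auto
      moreover have "num_zeros m R * (\<eta> / (1 + \<eta>)) * ((1 + \<eta>) / \<eta>) = num_zeros m R"
      proof -
        have "1 + \<eta> \<noteq> 0" "\<eta> \<noteq> 0" using eta by auto
        then show ?thesis by simp
      qed
      moreover have "(\<beta> * \<eta> * R + defect R) * ((1 + \<eta>) / \<eta>) = \<beta> * (1 + \<eta>) * R + (1 + \<eta>) / \<eta> * defect R"
        using eta by (simp add: field_simps)
      ultimately have "num_zeros m R \<le> \<beta> * (1 + \<eta>) * R + (1 + \<eta>) / \<eta> * defect R" by simp
      also have "\<beta> * (1 + \<eta>) * R = \<beta> * R + (\<eta> * \<beta>) * R" by (simp add: algebra_simps)
      also have "(\<eta> * \<beta>) * R \<le> e / 2 * R" using eb R by (intro mult_right_mono) auto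
      finally show ?thesis using dR by linarith
    qed
    have lower: "\<beta> * R - e * R \<le> num_zeros m R"
    proof -
      define r where "r = R / (1 + \<eta>)"
      have r: "0 < r" "r \<le> R" "R / r = 1 + \<eta>" using R eta by (auto simp: r_def field_simps)
      have "\<beta> * (R - r) - defect R \<le> log_zeros m R - log_zeros m r"
        using defect_nonneg[OF r(1)] unfolding N by (simp add: algebra_simps)
      also have "\<dots> \<le> num_zeros m R * ln (R / r)" by (rule log_zeros_diff_le[OF discrete r(1,2)])
      also have "\<dots> \<le> num_zeros m R * \<eta>" unfolding r(3) by (intro mult_left_mono ln_up num_zeros_nonneg)
      finally have "(\<beta> * (R - r) - defect R) / \<eta> \<le> num_zeros m R" using eta by (simp add: divide_le_eq)
      moreover have "(\<beta> * (R - r) - defect R) / \<eta> = \<beta> * r - defect R / \<eta>"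
      proof -
        have "1 + \<eta> \<noteq> 0" using eta by simp
        then have "R = r * (1 + \<eta>)" by (simp add: r_def)
        then have eq: "\<beta> * (R - r) = \<beta> * r * \<eta>" by (simp add: algebra_simps)
        show ?thesis unfolding diff_divide_distrib eq using eta by simp
      qed
      moreover have "R - r \<le> \<eta> * R" using R eta by (simp add: r_def field_simps)
      then have "\<beta> * (R - r) \<le> \<beta> * (\<eta> * R)" using b by (intro mult_left_mono)
      moreover have "\<beta> * (\<eta> * R) \<le> e / 2 * R" using mult_right_mono[OF eb, of R] R by (simp add: mult_ac)
      moreover have "defect R / \<eta> \<le> (1 + \<eta>) / \<eta> * defect R"
        using eta defect_nonneg[OF R] by (simp add: field_simps)
      ultimately show ?thesis using dR unfolding right_diff_distrib by linarith
    qed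
    show ?case using upper lower by (simp add: \<beta>_def abs_le_iff)
  qed
qed

lemma num_zeros_annulus_eventually_le:
  assumes l: "1 \<le> \<theta>" and e: "0 < e"
  shows "eventually (\<lambda>R. num_zeros m (\<theta> * R) - num_zeros m R \<le> (2 * \<sigma> / pi * (\<theta> - 1) + e) * R) at_top"
proof -
  define \<beta> where "\<beta> = 2 * \<sigma> / pi"
  define e' where "e' = e / (1 + \<theta>)"
  have e': "0 < e'" using e l by (simp add: e'_def)
  have near: "eventually (\<lambda>R. \<bar>num_zeros m R - \<beta> * R\<bar> \<le> e' * R) at_top"
    unfolding \<beta>_def by (rule num_zeros_eventually_near[OF e'])
  have "filterlim (\<lambda>R. \<theta> * R) at_top at_top"
    by (rule filterlim_tendsto_pos_mult_at_top[OF tendsto_const _ filterlim_ident]) (use l in simp)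
  then have "eventually (\<lambda>R. \<bar>num_zeros m (\<theta> * R) - \<beta> * (\<theta> * R)\<bar> \<le> e' * (\<theta> * R)) at_top"
    using near unfolding filterlim_iff by blast
  with near show ?thesis
    unfolding \<beta>_def[symmetric]
  proof eventually_elim
    case (elim R)
    then have "num_zeros m (\<theta> * R) - num_zeros m R \<le> \<beta> * (\<theta> * R) - \<beta> * R + (e' * (\<theta> * R) + e' * R)"
      unfolding abs_le_iff by linarith
    also have "e' * (\<theta> * R) + e' * R = (e' * (1 + \<theta>)) * R" by (simp add: algebra_simps)
    also have "e' * (1 + \<theta>) = e" using l by (simp add: e'_def)
    finally show ?case by (simp add: algebra_simps)
  qed
qed

section \<open>Convergence of the sum of reciprocals and of the product\<close>

text \<open>\<open>- cnj_sum R / R^2\<close> is the derivative at 0 of the product of the Blaschke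
  denominators in the disc representation.\<close>

definition cnj_sum :: "real \<Rightarrow> complex" where
  "cnj_sum R = (\<Sum>a\<in>zeros_in m R. of_nat (m a) * cnj a)"

text \<open>Compares derivatives at 0 in the disc representation. The outer factor contributes
  nothing, and the derivative of \<open>W\<close> is at most
  \<open>4 * defect R / R\<close>.\<close>

lemma inverse_sum_minus_cnj_sum_tendsto:
  "((\<lambda>R. inverse_sum m R - cnj_sum R / of_real (R\<^sup>2)) \<longlongrightarrow> - (deriv f 0 / f 0)) at_top"
proof -
  have "norm ((inverse_sum m R - cnj_sum R / of_real (R\<^sup>2)) - - (deriv f 0 / f 0)) \<le> 4 * (defect R / R)" if R: "0 < R" for R
  proof -
    obtain W where W: "W holomorphic_on ball 0 R" "\<And>z. z \<in> ball 0 R \<Longrightarrow> 0 \<le> Re (W z)" "Re (W 0) = defect R"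
      and eq: "\<And>z. z \<in> ball 0 R \<Longrightarrow> f z / f 0 * (\<Prod>a\<in>zeros_in m R. (1 - cnj a * z / of_real (R\<^sup>2)) ^ m a) =
       exp (of_real (\<sigma> * R) * (abs_Im_ext (z / of_real R) - 2 / pi) - (W z - W 0)) * (\<Prod>a\<in>zeros_in m R. (1 - z / a) ^ m a)"
      using disc_representation[OF R] by blast
    have dW: "(W has_field_derivative deriv W 0) (at 0)" using holomorphic_derivI[OF W(1)] R by auto
    have df: "(f has_field_derivative deriv f 0) (at 0)" using holomorphic_derivI[OF holo] by auto
    have "((\<lambda>z. abs_Im_ext (z / of_real R)) has_field_derivative 0 * (1 / of_real R)) (at 0)"
      by (rule DERIV_chain2[of abs_Im_ext 0]) (use DERIV_abs_Im_ext_0 R in \<open>auto intro!: derivative_eq_intros\<close>)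
    then have dE: "((\<lambda>z. of_real (\<sigma> * R) * (abs_Im_ext (z / of_real R) - 2 / pi) - (W z - W 0)) has_field_derivative - deriv W 0) (at 0)"
      using dW by (auto intro!: derivative_eq_intros)
    have p1: "((\<lambda>z. \<Prod>a\<in>zeros_in m R. (1 - cnj a * z / of_real (R\<^sup>2)) ^ m a) has_field_derivative - (cnj_sum R / of_real (R\<^sup>2))) (at 0)"
      using DERIV_prod_one_minus_at_0[where c = "\<lambda>a. cnj a / of_real (R\<^sup>2)" and k = m, OF finite_zeros[of R]]
      by (simp add: cnj_sum_def sum_divide_distrib)
    have p2: "((\<lambda>z. \<Prod>a\<in>zeros_in m R. (1 - z / a) ^ m a) has_field_derivative - inverse_sum m R) (at 0)"
      using DERIV_prod_one_minus_at_0[where c = "\<lambda>a. 1 / a" and k = m, OF finite_zeros[of R]]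
      by (simp add: inverse_sum_def)
    have L: "((\<lambda>z. f z / f 0 * (\<Prod>a\<in>zeros_in m R. (1 - cnj a * z / of_real (R\<^sup>2)) ^ m a)) has_field_derivative
        deriv f 0 / f 0 - cnj_sum R / of_real (R\<^sup>2)) (at 0)"
      using DERIV_mult[OF DERIV_cdivide[OF df, of "f 0"] p1] f0 by simp
    have "((\<lambda>z. exp (of_real (\<sigma> * R) * (abs_Im_ext (z / of_real R) - 2 / pi) - (W z - W 0))) has_field_derivative - deriv W 0) (at 0)"
      using DERIV_chain2[OF DERIV_exp dE] by simp
    from DERIV_mult[OF this p2]
    have Rt: "((\<lambda>z. exp (of_real (\<sigma> * R) * (abs_Im_ext (z / of_real R) - 2 / pi) - (W z - W 0)) * (\<Prod>a\<in>zeros_in m R. (1 - z / a) ^ m a))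
        has_field_derivative - deriv W 0 - inverse_sum m R) (at 0)" by simp
    have "((\<lambda>z. f z / f 0 * (\<Prod>a\<in>zeros_in m R. (1 - cnj a * z / of_real (R\<^sup>2)) ^ m a)) has_field_derivative - deriv W 0 - inverse_sum m R) (at 0)"
      by (rule has_field_derivative_transform_within_open[OF Rt, of "ball 0 R"]) (use eq R in auto)
    with L have "deriv f 0 / f 0 - cnj_sum R / of_real (R\<^sup>2) = - deriv W 0 - inverse_sum m R" by (rule DERIV_unique)
    then have "(inverse_sum m R - cnj_sum R / of_real (R\<^sup>2)) - - (deriv f 0 / f 0) = - deriv W 0" by (simp add: algebra_simps)
    then show ?thesis using deriv_centre_le[OF W(1,2) R] W(3) by simp
  qed
  then have "eventually (\<lambda>R. norm ((inverse_sum m R - cnj_sum R / of_real (R\<^sup>2)) - - (deriv f 0 / f 0)) \<le> 4 * (defect R / R)) at_top"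
    using eventually_gt_at_top[of 0] by (rule eventually_mono[rotated])
  moreover have "((\<lambda>R. 4 * (defect R / R)) \<longlongrightarrow> 0) at_top"
    using tendsto_mult[OF tendsto_const defect_over_tendsto_0, of 4] by simp
  ultimately have "((\<lambda>R. (inverse_sum m R - cnj_sum R / of_real (R\<^sup>2)) - - (deriv f 0 / f 0)) \<longlongrightarrow> 0) at_top"
    by (rule Lim_null_comparison)
  then show ?thesis by (rule LIM_zero_cancel)
qed

text \<open>A Tauberian argument: \<open>S - T / R\<^sup>2\<close> converges, where \<open>S = \<Sum> 1 / a\<close> and
  \<open>T = \<Sum> cnj a\<close>. Comparing \<open>R\<close> with \<open>\<theta> R\<close>, the zeros in between change both terms little,
  while \<open>T / R\<^sup>2\<close> itself is scaled by \<open>1 / \<theta>\<^sup>2\<close>.\<close>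
lemma cnj_sum_over_square_tendsto_0: "((\<lambda>R. cnj_sum R / of_real (R\<^sup>2)) \<longlongrightarrow> 0) at_top"
proof (rule tendstoI)
  fix e :: real assume e: "0 < e"
  define \<beta> where "\<beta> = 2 * \<sigma> / pi"
  have b: "0 \<le> \<beta>" using sigma_nonneg by (simp add: \<beta>_def)
  define V where "V R = inverse_sum m R - cnj_sum R / of_real (R\<^sup>2)" for R
  \<comment> \<open>Chosen so that the expected number of zeros in the annulus,
    \<open>\<beta> * (\<theta> - 1) * R\<close>, is at most \<open>e / 4 * R\<close>; the
    \<open>+ 1\<close> covers \<open>\<beta> = 0\<close>.\<close>
  define \<theta> where "\<theta> = 1 + e / (4 * (\<beta> + 1))"
  have l: "1 < \<theta>" using e b by (simp add: \<theta>_def)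
  have "\<beta> * (\<theta> - 1) \<le> (\<beta> + 1) * (e / (4 * (\<beta> + 1)))"
    unfolding \<theta>_def add_diff_cancel_left' using b e by (intro mult_right_mono) auto
  also have "\<dots> = e / 4" using b by (simp add: field_simps)
  finally have bl: "\<beta> * (\<theta> - 1) \<le> e / 4" .
  \<comment> \<open>The same \<kappa> measures the scaling of the conjugate sum and the size of a
    single term of the annulus (\<open>annulus_term\<close>), so it cancels at the end.\<close>
  define \<kappa> where "\<kappa> = 1 - 1 / \<theta>\<^sup>2"
  have k: "0 < \<kappa>" using l by (simp add: \<kappa>_def power_less_one_iff one_less_power)
  have Vlim: "(V \<longlongrightarrow> - (deriv f 0 / f 0)) at_top" unfolding V_def by (rule inverse_sum_minus_cnj_sum_tendsto)
  have "filterlim (\<lambda>R. \<theta> * R) at_top at_top"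
    by (rule filterlim_tendsto_pos_mult_at_top[OF tendsto_const _ filterlim_ident]) (use l in simp)
  from filterlim_compose[OF Vlim this] have "((\<lambda>R. V (\<theta> * R) - V R) \<longlongrightarrow> - (deriv f 0 / f 0) - - (deriv f 0 / f 0)) at_top"
    by (intro tendsto_diff Vlim)
  then have "((\<lambda>R. V (\<theta> * R) - V R) \<longlongrightarrow> 0) at_top" by simp
  moreover have "0 < \<kappa> * (e / 4)" using k e by simp
  ultimately have ev1: "eventually (\<lambda>R. dist (V (\<theta> * R) - V R) 0 < \<kappa> * (e / 4)) at_top" by (rule tendstoD)
  have ev2: "eventually (\<lambda>R. num_zeros m (\<theta> * R) - num_zeros m R \<le> (\<beta> * (\<theta> - 1) + e / 4) * R) at_top"
    unfolding \<beta>_def by (rule num_zeros_annulus_eventually_le) (use l e in auto)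
  show "eventually (\<lambda>R. dist (cnj_sum R / of_real (R\<^sup>2)) 0 < e) at_top"
    using ev1 ev2 eventually_gt_at_top[of 0]
  proof eventually_elim
    case (elim R)
    then have R: "0 < R" by simp
    define D where "D = zeros_in m (\<theta> * R) - zeros_in m R"
    have "R \<le> \<theta> * R" using l R by simp
    then have sub: "zeros_in m R \<subseteq> zeros_in m (\<theta> * R)" by (rule zeros_in_mono)
    have split: "sum \<phi> (zeros_in m (\<theta> * R)) = sum \<phi> D + sum \<phi> (zeros_in m R)" for \<phi> :: "complex \<Rightarrow> complex"
      unfolding D_def by (rule sum.subset_diff[OF sub finite_zeros])
    have splitr: "num_zeros m (\<theta> * R) - num_zeros m R = (\<Sum>a\<in>D. real (m a))"
      unfolding num_zeros_def D_def using sum.subset_diff[OF sub finite_zeros, of "\<lambda>a. real (m a)"] by simp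
    define L where "L = complex_of_real ((\<theta> * R)\<^sup>2)"
    have "V (\<theta> * R) - V R = (\<Sum>a\<in>D. of_nat (m a) / a) - (\<Sum>a\<in>D. of_nat (m a) * cnj a) / L + (cnj_sum R / of_real (R\<^sup>2) - cnj_sum R / L)"
      unfolding V_def inverse_sum_def cnj_sum_def split L_def[symmetric] by (simp add: add_divide_distrib)
    also have "cnj_sum R / of_real (R\<^sup>2) - cnj_sum R / L = of_real \<kappa> * (cnj_sum R / of_real (R\<^sup>2))"
      using R l by (simp add: \<kappa>_def L_def power_mult_distrib field_simps)
    also have "(\<Sum>a\<in>D. of_nat (m a) / a) - (\<Sum>a\<in>D. of_nat (m a) * cnj a) / L = (\<Sum>a\<in>D. of_nat (m a) * (1 / a - cnj a / L))"
      by (simp add: sum_divide_distrib sum_subtractf[symmetric] algebra_simps)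
    finally have eq: "of_real \<kappa> * (cnj_sum R / of_real (R\<^sup>2)) = (V (\<theta> * R) - V R) - (\<Sum>a\<in>D. of_nat (m a) * (1 / a - cnj a / L))"
      by (simp add: algebra_simps)
    have annulus_term: "norm (1 / a - cnj a / L) \<le> \<kappa> / R" if a: "a \<in> D" for a
    proof -
      have a1: "R \<le> norm a" "norm a \<le> \<theta> * R" "a \<noteq> 0" using a R by (auto simp: D_def zeros_in_def)
      have "1 / a = cnj a / of_real ((norm a)\<^sup>2)"
        using a1(3) by (simp add: complex_norm_square field_simps del: of_real_power)
      then have "1 / a - cnj a / L = cnj a * of_real (1 / (norm a)\<^sup>2 - 1 / (\<theta> * R)\<^sup>2)"
        by (simp add: L_def algebra_simps)
      then have "norm (1 / a - cnj a / L) = norm a * \<bar>1 / (norm a)\<^sup>2 - 1 / (\<theta> * R)\<^sup>2\<bar>"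
        by (simp only: norm_mult norm_of_real complex_mod_cnj)
      also have "\<bar>1 / (norm a)\<^sup>2 - 1 / (\<theta> * R)\<^sup>2\<bar> = 1 / (norm a)\<^sup>2 - 1 / (\<theta> * R)\<^sup>2"
        using a1 R by (intro abs_of_nonneg) (auto intro!: divide_left_mono power_mono mult_pos_pos)
      also have "norm a * (1 / (norm a)\<^sup>2 - 1 / (\<theta> * R)\<^sup>2) = 1 / norm a - norm a / (\<theta> * R)\<^sup>2"
        using a1 by (simp add: power2_eq_square right_diff_distrib)
      also have "\<dots> \<le> 1 / R - R / (\<theta> * R)\<^sup>2"
        using a1 R l by (intro diff_mono divide_left_mono divide_right_mono) auto
      also have "\<dots> = \<kappa> / R" using R l by (simp add: \<kappa>_def power2_eq_square field_simps)
      finally show ?thesis .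
    qed
    have "norm (\<Sum>a\<in>D. of_nat (m a) * (1 / a - cnj a / L)) \<le> (\<Sum>a\<in>D. real (m a) * (\<kappa> / R))"
    proof (rule sum_norm_le)
      fix a assume "a \<in> D"
      then show "norm (of_nat (m a) * (1 / a - cnj a / L)) \<le> real (m a) * (\<kappa> / R)"
        unfolding norm_mult norm_of_nat by (intro mult_left_mono annulus_term) auto
    qed
    also have "\<dots> = (num_zeros m (\<theta> * R) - num_zeros m R) * (\<kappa> / R)" by (simp only: splitr sum_distrib_right)
    also have "\<dots> \<le> (\<beta> * (\<theta> - 1) + e / 4) * R * (\<kappa> / R)" using elim(2) k R by (intro mult_right_mono) auto
    also have "\<dots> = \<kappa> * (\<beta> * (\<theta> - 1) + e / 4)" using R by simp
    also have "\<dots> \<le> \<kappa> * (e / 2)" using bl k by (intro mult_left_mono) auto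
    finally have s: "norm (\<Sum>a\<in>D. of_nat (m a) * (1 / a - cnj a / L)) \<le> \<kappa> * (e / 2)" .
    have "\<kappa> * norm (cnj_sum R / of_real (R\<^sup>2)) = norm (of_real \<kappa> * (cnj_sum R / of_real (R\<^sup>2)))"
      using k by (simp only: norm_mult norm_of_real abs_of_pos)
    also have "\<dots> \<le> norm (V (\<theta> * R) - V R) + norm (\<Sum>a\<in>D. of_nat (m a) * (1 / a - cnj a / L))"
      unfolding eq by (rule norm_triangle_ineq4)
    also have "\<dots> < \<kappa> * (e / 4) + \<kappa> * (e / 2)" using elim(1) s by simp
    also have "\<dots> < \<kappa> * e" using k e by (simp add: field_simps)
    finally show ?case using k by simp
  qed
qed

lemma inverse_sum_tendsto: "(inverse_sum m \<longlongrightarrow> - (deriv f 0 / f 0)) at_top"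
  using tendsto_add[OF inverse_sum_minus_cnj_sum_tendsto cnj_sum_over_square_tendsto_0] by simp

text \<open>All other factors of the disc representation tend to 1: the outer factor; the
  exponential of \<open>W z - W 0\<close>, by Borel-Caratheodory and the small defect; and the
  Blaschke denominators, whose logarithm is \<open>- z * cnj_sum R / R^2\<close> up to
  \<open>O(1 / R)\<close>.\<close>

lemma zero_product_tendsto:
  "((\<lambda>R. \<Prod>a\<in>zeros_in m R. (1 - z / a) ^ m a) \<longlongrightarrow> f z / f 0) at_top"
proof -
  obtain K where K: "0 < K" "\<And>r. 0 < r \<Longrightarrow> num_zeros m r \<le> K * r" using num_zeros_le_linear by blast
  have "\<exists>W. \<forall>R>0. W R holomorphic_on ball 0 R \<and> (\<forall>z\<in>ball 0 R. 0 \<le> Re (W R z)) \<and> Re (W R 0) = defect R \<and>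
    (\<forall>z\<in>ball 0 R. f z / f 0 * (\<Prod>a\<in>zeros_in m R. (1 - cnj a * z / of_real (R\<^sup>2)) ^ m a) =
       exp (of_real (\<sigma> * R) * (abs_Im_ext (z / of_real R) - 2 / pi) - (W R z - W R 0)) * (\<Prod>a\<in>zeros_in m R. (1 - z / a) ^ m a))"
  proof (intro choice allI)
    fix R :: real
    show "\<exists>W. 0 < R \<longrightarrow> W holomorphic_on ball 0 R \<and> (\<forall>z\<in>ball 0 R. 0 \<le> Re (W z)) \<and> Re (W 0) = defect R \<and>
      (\<forall>z\<in>ball 0 R. f z / f 0 * (\<Prod>a\<in>zeros_in m R. (1 - cnj a * z / of_real (R\<^sup>2)) ^ m a) =
       exp (of_real (\<sigma> * R) * (abs_Im_ext (z / of_real R) - 2 / pi) - (W z - W 0)) * (\<Prod>a\<in>zeros_in m R. (1 - z / a) ^ m a))"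
    proof (cases "0 < R")
      case True
      then show ?thesis by (rule disc_representation) blast
    qed simp
  qed
  then obtain W where W: "\<And>R. 0 < R \<Longrightarrow> W R holomorphic_on ball 0 R" "\<And>R z. 0 < R \<Longrightarrow> z \<in> ball 0 R \<Longrightarrow> 0 \<le> Re (W R z)"
     "\<And>R. 0 < R \<Longrightarrow> Re (W R 0) = defect R"
    and eq: "\<And>R z. 0 < R \<Longrightarrow> z \<in> ball 0 R \<Longrightarrow> f z / f 0 * (\<Prod>a\<in>zeros_in m R. (1 - cnj a * z / of_real (R\<^sup>2)) ^ m a) =
       exp (of_real (\<sigma> * R) * (abs_Im_ext (z / of_real R) - 2 / pi) - (W R z - W R 0)) * (\<Prod>a\<in>zeros_in m R. (1 - z / a) ^ m a)"
    by blast
  define E where "E R = of_real (\<sigma> * R) * (abs_Im_ext (z / of_real R) - 2 / pi) - (W R z - W R 0)" for R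
  have W0: "((\<lambda>R. W R z - W R 0) \<longlongrightarrow> 0) at_top"
  proof (rule Lim_null_comparison)
    show "eventually (\<lambda>R. norm (W R z - W R 0) \<le> 4 * norm z * (defect R / R)) at_top"
      using eventually_gt_at_top[of "2 * norm z"]
    proof eventually_elim
      case (elim R)
      have R: "0 < R" using elim norm_ge_zero[of z] by linarith
      have z: "z \<in> ball 0 R" unfolding mem_ball_0 using elim norm_ge_zero[of z] by linarith
      have "norm (W R z - W R 0) \<le> 2 * Re (W R 0) * norm (z - 0) / (R - norm (z - 0))"
        by (rule Borel_Caratheodory_nonneg[OF W(1)[OF R] W(2)[OF R] z])
      also have "\<dots> = 2 * defect R * norm z / (R - norm z)" using W(3)[OF R] by simp
      also have "\<dots> \<le> 2 * defect R * norm z / (R / 2)"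
        using elim R defect_nonneg[OF R] by (intro divide_left_mono) auto
      finally show ?case by (simp add: mult_ac)
    qed
    have "((\<lambda>R. 4 * norm z * (defect R / R)) \<longlongrightarrow> 4 * norm z * 0) at_top" by (intro tendsto_mult tendsto_const defect_over_tendsto_0)
    then show "((\<lambda>R. 4 * norm z * (defect R / R)) \<longlongrightarrow> 0) at_top" by simp
  qed
  have E0: "(E \<longlongrightarrow> 0) at_top" unfolding E_def using tendsto_diff[OF tendsto_abs_Im_ext_scaled W0] by simp
  define B where "B R = (\<Prod>a\<in>zeros_in m R. (1 - cnj a * z / of_real (R\<^sup>2)) ^ m a)" for R
  define l where "l R = (\<Sum>a\<in>zeros_in m R. of_nat (m a) * Ln (1 - cnj a * z / of_real (R\<^sup>2)))" for R
  have small: "norm (cnj a * z / of_real (R\<^sup>2)) \<le> norm z / R" if "0 < R" "a \<in> zeros_in m R" for a R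
  proof -
    have "norm (cnj a * z / of_real (R\<^sup>2)) = norm a * norm z / R\<^sup>2"
      unfolding norm_divide norm_mult norm_of_real by simp
    also have "\<dots> \<le> R * norm z / R\<^sup>2" using that by (intro divide_right_mono mult_right_mono) (auto simp: zeros_in_def)
    also have "\<dots> = norm z / R" using that by (simp add: power2_eq_square)
    finally show ?thesis .
  qed
  have ev: "eventually (\<lambda>R. 0 < R \<and> norm z / R \<le> 1 / 2) at_top"
    using eventually_gt_at_top[of "2 * norm z"] eventually_gt_at_top[of 0]
    by eventually_elim (auto simp: divide_le_eq)
  have Bl: "eventually (\<lambda>R. B R = exp (l R)) at_top"
    using ev
  proof eventually_elim
    case (elim R)
    have "(1 - cnj a * z / of_real (R\<^sup>2)) ^ m a = exp (of_nat (m a) * Ln (1 - cnj a * z / of_real (R\<^sup>2)))" if a: "a \<in> zeros_in m R" for a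
    proof -
      have "norm (cnj a * z / of_real (R\<^sup>2)) < 1" using small[of R a] elim a by linarith
      then have "1 - cnj a * z / of_real (R\<^sup>2) \<noteq> 0" by (metis eq_iff_diff_eq_0 norm_one less_irrefl)
      from exp_Ln[OF this] show ?thesis by (simp only: exp_of_nat_mult)
    qed
    then show ?case unfolding B_def l_def by (simp add: exp_sum)
  qed
  have l0: "((\<lambda>R. l R - - (z * (cnj_sum R / of_real (R\<^sup>2)))) \<longlongrightarrow> 0) at_top"
  proof (rule Lim_null_comparison)
    show "eventually (\<lambda>R. norm (l R - - (z * (cnj_sum R / of_real (R\<^sup>2)))) \<le> 2 * K * (norm z)\<^sup>2 / R) at_top"
      using ev
    proof eventually_elim
      case (elim R)
      have eq: "l R - - (z * (cnj_sum R / of_real (R\<^sup>2))) =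
          (\<Sum>a\<in>zeros_in m R. of_nat (m a) * (Ln (1 + - (cnj a * z / of_real (R\<^sup>2))) - - (cnj a * z / of_real (R\<^sup>2))))"
        by (simp add: l_def cnj_sum_def sum_divide_distrib sum_distrib_left sum.distrib algebra_simps)
      have "norm (l R - - (z * (cnj_sum R / of_real (R\<^sup>2)))) \<le> (\<Sum>a\<in>zeros_in m R. real (m a) * (2 * (norm z / R)\<^sup>2))"
        unfolding eq
      proof (rule sum_norm_le)
        fix a assume a: "a \<in> zeros_in m R"
        define u where "u = - (cnj a * z / of_real (R\<^sup>2))"
        have u: "norm u \<le> norm z / R" using small[of R a] elim a unfolding u_def norm_minus_cancel by blast
        have u2: "norm u \<le> 1 / 2" using u elim by linarith
        have "norm (Ln (1 + u) - u) \<le> (norm u)\<^sup>2 / (1 - norm u)" by (rule Ln_approx_linear) (use u2 in linarith)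
        also have "\<dots> \<le> (norm z / R)\<^sup>2 / (1 / 2)" using u u2 by (intro frac_le power_mono) auto
        finally have "norm (Ln (1 + u) - u) \<le> 2 * (norm z / R)\<^sup>2" by simp
        then show "norm (of_nat (m a) * (Ln (1 + - (cnj a * z / of_real (R\<^sup>2))) - - (cnj a * z / of_real (R\<^sup>2)))) \<le> real (m a) * (2 * (norm z / R)\<^sup>2)"
          unfolding u_def[symmetric] norm_mult norm_of_nat by (intro mult_left_mono) auto
      qed
      also have "\<dots> = num_zeros m R * (2 * (norm z / R)\<^sup>2)" by (simp only: num_zeros_def sum_distrib_right)
      also have "\<dots> \<le> K * R * (2 * (norm z / R)\<^sup>2)" using K(2)[of R] elim by (intro mult_right_mono) auto
      also have "\<dots> = 2 * K * (norm z)\<^sup>2 / R" using elim by (simp add: power2_eq_square)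
      finally show ?case .
    qed
    show "((\<lambda>R. 2 * K * (norm z)\<^sup>2 / R) \<longlongrightarrow> 0) at_top" by real_asymp
  qed
  have "((\<lambda>R. (l R - - (z * (cnj_sum R / of_real (R\<^sup>2)))) + - (z * (cnj_sum R / of_real (R\<^sup>2)))) \<longlongrightarrow> 0 + - (z * 0)) at_top"
    by (intro tendsto_add l0 tendsto_minus tendsto_mult tendsto_const cnj_sum_over_square_tendsto_0)
  then have "(l \<longlongrightarrow> 0) at_top" by simp
  then have "((\<lambda>R. exp (l R)) \<longlongrightarrow> exp 0) at_top" by (rule tendsto_exp)
  then have B1: "(B \<longlongrightarrow> 1) at_top" using tendsto_cong[OF Bl] by simp
  have "((\<lambda>R. f z / f 0 * B R * exp (- E R)) \<longlongrightarrow> f z / f 0 * 1 * exp (- 0)) at_top"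
    by (intro tendsto_mult tendsto_const B1 tendsto_exp tendsto_minus E0)
  moreover have "eventually (\<lambda>R. f z / f 0 * B R * exp (- E R) = (\<Prod>a\<in>zeros_in m R. (1 - z / a) ^ m a)) at_top"
    using eventually_gt_at_top[of "norm z"] eventually_gt_at_top[of 0]
  proof eventually_elim
    case (elim R)
    have "f z / f 0 * B R = exp (E R) * (\<Prod>a\<in>zeros_in m R. (1 - z / a) ^ m a)"
      unfolding B_def E_def by (rule eq) (use elim in auto)
    then show ?case by (simp add: exp_minus)
  qed
  ultimately show ?thesis by (simp add: tendsto_cong)
qed

end

section \<open>Lindelof products\<close>

locale linear_zero_density =
  fixes m :: "complex \<Rightarrow> nat" and K :: real
  assumes discrete: "no_finite_limit_points m" and K0: "0 \<le> K"
    and density: "\<And>r. 0 < r \<Longrightarrow> num_zeros m r \<le> K * r"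
begin

lemma finite_zeros [simp]: "finite (zeros_in m r)"
  by (rule finite_zeros_in[OF discrete])

text \<open>Halving the radius costs at most \<open>K * R\<close>, and the resulting geometric
  series sums to \<open>2 * K * R\<close>. The recursion ends at \<open>r0\<close>, up to which
  there are no zeros.\<close>

lemma log_zeros_le_linear:
  assumes "0 < R"
  shows "log_zeros m R \<le> 2 * K * R"
proof -
  obtain r0 where r0: "0 < r0" "\<And>r. r \<le> r0 \<Longrightarrow> zeros_in m r = {}" using zeros_in_empty[OF discrete] by blast
  have "\<forall>R. 0 < R \<longrightarrow> R \<le> 2 ^ n * r0 \<longrightarrow> log_zeros m R \<le> 2 * K * R" for n
  proof (induction n)
    case 0
    then show ?case using r0 K0 by (auto simp: log_zeros_def)
  next
    case (Suc n)
    show ?case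
    proof (intro allI impI)
      fix R :: real assume R: "0 < R" "R \<le> 2 ^ Suc n * r0"
      have "log_zeros m R - log_zeros m (R / 2) \<le> num_zeros m R * ln (R / (R / 2))"
        by (rule log_zeros_diff_le[OF discrete]) (use R in auto)
      also have "\<dots> \<le> num_zeros m R * 1" using R ln_2_less_1 num_zeros_nonneg by (intro mult_left_mono) auto
      also have "\<dots> \<le> K * R" using density[OF R(1)] by simp
      finally have "log_zeros m R \<le> log_zeros m (R / 2) + K * R" by simp
      moreover have "0 < R / 2 \<and> R / 2 \<le> 2 ^ n * r0" using R by simp
      then have "log_zeros m (R / 2) \<le> 2 * K * (R / 2)" using Suc.IH by blast
      ultimately show "log_zeros m R \<le> 2 * K * R" by simp
    qed
  qed
  moreover obtain n where "R / r0 < 2 ^ n" using real_arch_pow[of 2 "R / r0"] by auto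
  then have "R \<le> 2 ^ n * r0" using r0 by (simp add: divide_less_eq)
  ultimately show ?thesis using assms by blast
qed

text \<open>Dyadic shells: the shell from \<open>s\<close> to \<open>2 * s\<close> contributes at
  most \<open>2 * K / s\<close>, and the rest is the same bound at \<open>2 * s\<close>.\<close>

lemma inverse_square_tail:
  assumes "0 < s"
  shows "(\<Sum>a\<in>zeros_in m R - zeros_in m s. real (m a) / (norm a)\<^sup>2) \<le> 4 * K / s"
proof -
  let ?T = "\<lambda>s. \<Sum>a\<in>zeros_in m R - zeros_in m s. real (m a) / (norm a)\<^sup>2"
  have "\<forall>s>0. R \<le> 2 ^ n * s \<longrightarrow> ?T s \<le> 4 * K / s" for n
  proof (induction n)
    case 0
    have "zeros_in m R - zeros_in m s = {}" if "R \<le> s" for s using zeros_in_mono[OF that] by auto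
    then have "?T s \<le> 4 * K / s" if "R \<le> s" "0 < s" for s
      using K0 that by (simp only: sum.empty) simp
    then show ?case by simp
  next
    case (Suc n)
    show ?case
    proof (intro allI impI)
      fix s :: real assume s: "0 < s" "R \<le> 2 ^ Suc n * s"
      have "?T s \<le> (\<Sum>a\<in>(zeros_in m (2 * s) - zeros_in m s) \<union> (zeros_in m R - zeros_in m (2 * s)). real (m a) / (norm a)\<^sup>2)"
        by (intro sum_mono2) auto
      also have "\<dots> \<le> (\<Sum>a\<in>zeros_in m (2 * s) - zeros_in m s. real (m a) / (norm a)\<^sup>2) + ?T (2 * s)"
        by (subst sum.union_disjoint) auto
      also have "?T (2 * s) \<le> 4 * K / (2 * s)"
      proof -
        have "0 < 2 * s \<and> R \<le> 2 ^ n * (2 * s)" using s by (simp add: mult_ac)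
        then show ?thesis using Suc.IH by blast
      qed
      also have "(\<Sum>a\<in>zeros_in m (2 * s) - zeros_in m s. real (m a) / (norm a)\<^sup>2) \<le> (\<Sum>a\<in>zeros_in m (2 * s) - zeros_in m s. real (m a) / s\<^sup>2)"
        using s by (intro sum_mono divide_left_mono power_mono mult_pos_pos) (auto simp: zeros_in_def)
      also have "\<dots> \<le> (\<Sum>a\<in>zeros_in m (2 * s). real (m a) / s\<^sup>2)" by (intro sum_mono2) auto
      also have "\<dots> = num_zeros m (2 * s) / s\<^sup>2" by (simp add: num_zeros_def sum_divide_distrib)
      also have "\<dots> \<le> K * (2 * s) / s\<^sup>2" using density[of "2 * s"] s by (intro divide_right_mono) auto
      also have "K * (2 * s) / s\<^sup>2 + 4 * K / (2 * s) = 4 * K / s" using s by (simp add: field_simps power2_eq_square)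
      finally show "?T s \<le> 4 * K / s" by simp
    qed
  qed
  moreover obtain n where "R / s < 2 ^ n" using real_arch_pow[of 2 "R / s"] by auto
  then have "R \<le> 2 ^ n * s" using assms by (simp add: divide_less_eq)
  ultimately show ?thesis using assms by blast
qed

section \<open>Tails with convergence factors\<close>

text \<open>The logarithm of the Weierstrass primary factor of genus one, counted with
  multiplicity.\<close>

definition log_factor :: "complex \<Rightarrow> complex \<Rightarrow> complex" where
  "log_factor a z = of_nat (m a) * (Ln (1 - z / a) + z / a)"

text \<open>The factor 2 keeps \<open>norm (z / a)\<close> below \<open>1 / 2\<close> for
  \<open>norm z \<le> r\<close>, away from the branch cut of \<open>Ln\<close>.\<close>

definition far_zeros :: "real \<Rightarrow> complex set" where
  "far_zeros r = {a. 0 < m a \<and> 2 * r \<le> norm a}"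

definition log_tail :: "real \<Rightarrow> complex \<Rightarrow> complex" where
  "log_tail r z = (\<Sum>\<^sub>\<infinity>a\<in>far_zeros r. log_factor a z)"

lemma norm_log_factor_le:
  assumes r: "0 < r" and a: "a \<in> far_zeros r" and z: "norm z \<le> r"
  shows "norm (log_factor a z) \<le> 2 * r\<^sup>2 * (real (m a) / (norm a)\<^sup>2)"
proof -
  have na: "0 < norm a" "2 * r \<le> norm a" using a r by (auto simp: far_zeros_def)
  define u where "u = - (z / a)"
  have "norm u = norm z / norm a" by (simp add: u_def norm_divide)
  also have "\<dots> \<le> r / norm a" using z na by (intro divide_right_mono) auto
  finally have u: "norm u \<le> r / norm a" .
  have "r / norm a \<le> 1 / 2" using na by (simp add: divide_le_eq)
  then have u2: "norm u \<le> 1 / 2" using u by linarith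
  have "norm (Ln (1 + u) - u) \<le> (norm u)\<^sup>2 / (1 - norm u)" by (rule Ln_approx_linear) (use u2 in linarith)
  also have "\<dots> \<le> (r / norm a)\<^sup>2 / (1 / 2)" using u u2 by (intro frac_le power_mono) auto
  finally have "norm (Ln (1 + u) - u) \<le> 2 * r\<^sup>2 / (norm a)\<^sup>2" by (simp add: power_divide mult.commute)
  then have "real (m a) * norm (Ln (1 + u) - u) \<le> real (m a) * (2 * r\<^sup>2 / (norm a)\<^sup>2)" by (intro mult_left_mono) auto
  then show ?thesis by (simp add: log_factor_def norm_mult u_def mult_ac)
qed

lemma sum_far_zeros_le:
  assumes r: "0 < r" and F: "finite F" "F \<subseteq> far_zeros r"
  shows "(\<Sum>a\<in>F. 2 * r\<^sup>2 * (real (m a) / (norm a)\<^sup>2)) \<le> 4 * K * r"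
proof -
  obtain R where R: "\<And>a. a \<in> F \<Longrightarrow> norm a < R"
    using finite_imp_bounded[OF F(1)] bounded_pos_less by (metis bounded_pos_less)
  have "F \<subseteq> zeros_in m R - zeros_in m (2 * r)" using F(2) R r by (force simp: far_zeros_def zeros_in_def)
  then have "(\<Sum>a\<in>F. real (m a) / (norm a)\<^sup>2) \<le> (\<Sum>a\<in>zeros_in m R - zeros_in m (2 * r). real (m a) / (norm a)\<^sup>2)"
    by (intro sum_mono2) auto
  also have "\<dots> \<le> 4 * K / (2 * r)" by (rule inverse_square_tail) (use r in simp)
  finally have "2 * r\<^sup>2 * (\<Sum>a\<in>F. real (m a) / (norm a)\<^sup>2) \<le> 2 * r\<^sup>2 * (4 * K / (2 * r))" by (intro mult_left_mono) auto
  also have "\<dots> = 4 * K * r" using r by (simp add: power2_eq_square)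
  finally show ?thesis by (simp add: sum_distrib_left)
qed

text \<open>The M-test gives convergence along all finite sets of far zeros; the sets of zeros with
  modulus below \<open>R\<close> are cofinal among them, so the limit can be taken along
  \<open>R\<close>.\<close>

lemma uniform_limit_log_tail:
  assumes r: "0 < r"
  shows "uniform_limit (cball 0 r) (\<lambda>R z. \<Sum>a\<in>zeros_in m R - zeros_in m (2 * r). log_factor a z) (log_tail r) at_top"
proof -
  have "(\<lambda>a. 2 * r\<^sup>2 * (real (m a) / (norm a)\<^sup>2)) summable_on far_zeros r"
    by (rule nonneg_bounded_partial_sums_imp_summable_on[where C = "4 * K * r"])
      (rule mult_nonneg_nonneg, simp, simp, rule eventually_finite_subsets_at_top_weakI, rule sum_far_zeros_le[OF r])
  then have "uniform_limit (cball 0 r) (\<lambda>F z. \<Sum>a\<in>F. log_factor a z) (\<lambda>z. \<Sum>\<^sub>\<infinity>a\<in>far_zeros r. log_factor a z) (finite_subsets_at_top (far_zeros r))"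
    by (rule Weierstrass_m_test_general[rotated]) (rule norm_log_factor_le[OF r], auto)
  moreover have "filterlim (\<lambda>R. zeros_in m R - zeros_in m (2 * r)) (finite_subsets_at_top (far_zeros r)) at_top"
    unfolding filterlim_finite_subsets_at_top
  proof (intro allI impI)
    fix F assume F: "finite F \<and> F \<subseteq> far_zeros r"
    obtain B where B: "\<And>a. a \<in> F \<Longrightarrow> norm a < B"
      using finite_imp_bounded[of F] F by (metis bounded_pos_less)
    show "eventually (\<lambda>R. finite (zeros_in m R - zeros_in m (2 * r)) \<and> F \<subseteq> zeros_in m R - zeros_in m (2 * r)
        \<and> zeros_in m R - zeros_in m (2 * r) \<subseteq> far_zeros r) at_top"
      using eventually_ge_at_top[of B]
    proof eventually_elim
      case (elim R)
      have "a \<in> zeros_in m R - zeros_in m (2 * r)" if "a \<in> F" for a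
      proof -
        have "a \<in> far_zeros r" using that F by blast
        then show ?thesis using B[OF that] elim r by (auto simp: far_zeros_def zeros_in_def)
      qed
      moreover have "zeros_in m R - zeros_in m (2 * r) \<subseteq> far_zeros r" by (auto simp: far_zeros_def zeros_in_def)
      ultimately show ?case by auto
    qed
  qed
  ultimately show ?thesis unfolding log_tail_def[abs_def] by (rule filterlim_compose)
qed

lemma holomorphic_log_tail:
  assumes r: "0 < r"
  shows "log_tail r holomorphic_on ball 0 r"
proof -
  have "continuous_on (cball 0 r) (log_tail r) \<and> log_tail r holomorphic_on ball 0 r"
  proof (rule holomorphic_uniform_limit[OF _ uniform_limit_log_tail[OF r]])
    have h: "(\<lambda>z. \<Sum>a\<in>zeros_in m R - zeros_in m (2 * r). log_factor a z) holomorphic_on ball 0 (2 * r)" for R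
      unfolding log_factor_def
    proof (intro holomorphic_intros)
      fix a z :: complex assume a: "a \<in> zeros_in m R - zeros_in m (2 * r)" and z: "z \<in> ball 0 (2 * r)"
      have na: "2 * r \<le> norm a" using a by (auto simp: zeros_in_def)
      then have "norm (z / a) < 1" using z r by (simp add: norm_divide divide_less_eq)
      then have "Re (z / a) < 1" using complex_Re_le_cmod[of "z / a"] by linarith
      then show "1 - z / a \<notin> \<real>\<^sub>\<le>\<^sub>0" by (auto simp: complex_nonpos_Reals_iff)
      show "a \<noteq> 0" using na r by auto
      show "a \<noteq> 0" using na r by auto
    qed
    have sub: "cball 0 r \<subseteq> ball (0::complex) (2 * r)" using r by auto
    show "eventually (\<lambda>R. continuous_on (cball 0 r) (\<lambda>z. \<Sum>a\<in>zeros_in m R - zeros_in m (2 * r). log_factor a z) \<and>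
        (\<lambda>z. \<Sum>a\<in>zeros_in m R - zeros_in m (2 * r). log_factor a z) holomorphic_on ball 0 r) at_top"
    proof (intro always_eventually allI conjI)
      fix R
      show "continuous_on (cball 0 r) (\<lambda>z. \<Sum>a\<in>zeros_in m R - zeros_in m (2 * r). log_factor a z)"
        by (rule holomorphic_on_imp_continuous_on[OF holomorphic_on_subset[OF h sub]])
      show "(\<lambda>z. \<Sum>a\<in>zeros_in m R - zeros_in m (2 * r). log_factor a z) holomorphic_on ball 0 r"
        by (rule holomorphic_on_subset[OF h]) (use r in auto)
    qed
  qed simp_all
  then show ?thesis by simp
qed

lemma norm_log_tail_le:
  assumes r: "0 < r" and z: "norm z \<le> r"
  shows "norm (log_tail r z) \<le> 4 * K * r"
proof -
  have "((\<lambda>R. \<Sum>a\<in>zeros_in m R - zeros_in m (2 * r). log_factor a z) \<longlongrightarrow> log_tail r z) at_top"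
    by (rule tendsto_uniform_limitI[OF uniform_limit_log_tail[OF r]]) (use z in simp)
  then have "((\<lambda>R. norm (\<Sum>a\<in>zeros_in m R - zeros_in m (2 * r). log_factor a z)) \<longlongrightarrow> norm (log_tail r z)) at_top"
    by (rule tendsto_norm)
  moreover have "norm (\<Sum>a\<in>zeros_in m R - zeros_in m (2 * r). log_factor a z) \<le> 4 * K * r" for R
  proof -
    have far: "zeros_in m R - zeros_in m (2 * r) \<subseteq> far_zeros r" by (auto simp: zeros_in_def far_zeros_def)
    have "norm (\<Sum>a\<in>zeros_in m R - zeros_in m (2 * r). log_factor a z) \<le> (\<Sum>a\<in>zeros_in m R - zeros_in m (2 * r). 2 * r\<^sup>2 * (real (m a) / (norm a)\<^sup>2))"
      by (rule sum_norm_le, rule norm_log_factor_le[OF r _ z]) (use far in auto)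
    also have "\<dots> \<le> 4 * K * r" by (rule sum_far_zeros_le[OF r _ far]) simp
    finally show ?thesis .
  qed
  ultimately show ?thesis by (intro tendsto_upperbound) auto
qed

text \<open>The convergence factors \<open>exp (z / a)\<close> are inserted and taken out again.
  What is taken out is an increment of \<open>inverse_sum\<close>, and this is where condition (i)
  replaces convergence factors.\<close>

lemma zero_product_split:
  assumes r: "0 < r" and z: "norm z \<le> r" and R: "2 * r \<le> R"
  shows "zero_product m R z = zero_product m (2 * r) z *
    exp ((\<Sum>a\<in>zeros_in m R - zeros_in m (2 * r). log_factor a z) - z * (inverse_sum m R - inverse_sum m (2 * r)))"
proof -
  let ?D = "zeros_in m R - zeros_in m (2 * r)"
  have sub: "zeros_in m (2 * r) \<subseteq> zeros_in m R" by (rule zeros_in_mono[OF R])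
  have "(1 - z / a) ^ m a = exp (of_nat (m a) * Ln (1 - z / a))" if a: "a \<in> ?D" for a
  proof -
    have "2 * r \<le> norm a" using a by (auto simp: zeros_in_def)
    then have "norm z < norm a" using z r by linarith
    then have "1 - z / a \<noteq> 0" by (auto simp: divide_eq_1_iff)
    from exp_Ln[OF this] show ?thesis by (simp only: exp_of_nat_mult)
  qed
  then have "(\<Prod>a\<in>?D. (1 - z / a) ^ m a) = exp (\<Sum>a\<in>?D. of_nat (m a) * Ln (1 - z / a))"
    by (simp add: exp_sum)
  also have "(\<Sum>a\<in>?D. of_nat (m a) * Ln (1 - z / a)) = (\<Sum>a\<in>?D. log_factor a z) - z * (\<Sum>a\<in>?D. of_nat (m a) / a)"
    by (simp add: log_factor_def sum_distrib_left sum_subtractf[symmetric] algebra_simps)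
  also have "(\<Sum>a\<in>?D. of_nat (m a) / a) = inverse_sum m R - inverse_sum m (2 * r)"
    unfolding inverse_sum_def using sum.subset_diff[OF sub finite_zeros, of "\<lambda>a. of_nat (m a) / a"] by simp
  finally show ?thesis
    unfolding zero_product_def prod.subset_diff[OF sub finite_zeros] by (simp add: mult_ac)
qed

lemma inverse_sum_bounded:
  assumes "(inverse_sum m \<longlongrightarrow> L) at_top"
  obtains M where "\<And>R. norm (inverse_sum m R) \<le> M"
proof -
  have "eventually (\<lambda>R. dist (inverse_sum m R) L < 1) at_top" using assms by (rule tendstoD) simp
  then obtain R0 where R0: "\<And>R. R0 \<le> R \<Longrightarrow> dist (inverse_sum m R) L < 1" by (auto simp: eventually_at_top_linorder)
  have "norm (inverse_sum m R) \<le> (norm L + 1) + (\<Sum>a\<in>zeros_in m R0. real (m a) / norm a)" for R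
  proof (cases "R0 \<le> R")
    case True
    have "norm (inverse_sum m R) \<le> norm L + 1"
      using R0[OF True] norm_triangle_sub[of "inverse_sum m R" L] by (simp add: dist_norm)
    moreover have "0 \<le> (\<Sum>a\<in>zeros_in m R0. real (m a) / norm a)" by (intro sum_nonneg) auto
    ultimately show ?thesis by simp
  next
    case False
    have "norm (inverse_sum m R) \<le> (\<Sum>a\<in>zeros_in m R. real (m a) / norm a)"
      unfolding inverse_sum_def by (rule sum_norm_le) (simp add: norm_divide)
    also have "\<dots> \<le> (\<Sum>a\<in>zeros_in m R0. real (m a) / norm a)"
      using zeros_in_mono[of R R0 m] False by (intro sum_mono2) auto
    finally show ?thesis using norm_ge_zero[of L] by linarith
  qed
  then show thesis by (rule that)
qed

lemma zero_product_local_factor: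
  assumes a: "norm a < R"
  obtains g where "g holomorphic_on UNIV" "g a \<noteq> 0" "\<And>z. zero_product m R z = (z - a) ^ m a * g z"
proof -
  define Q where "Q z = (\<Prod>b\<in>zeros_in m R - {a}. (1 - z / b) ^ m b)" for z
  have Q: "Q holomorphic_on UNIV" unfolding Q_def by (intro holomorphic_intros) (auto simp: zeros_in_def)
  have Qa: "Q a \<noteq> 0" unfolding Q_def
    by (subst prod_zero_iff) (auto simp: zeros_in_def[of m R] divide_eq_1_iff intro: finite_subset[OF _ finite_zeros[of R]])
  show thesis
  proof (cases "a = 0")
    case True
    have "zeros_in m R - {a} = zeros_in m R" using True by (auto simp: zeros_in_def)
    then show thesis using Q Qa True by (intro that[of Q]) (auto simp: zero_product_def Q_def)
  next
    case False
    have split: "(\<Prod>b\<in>zeros_in m R. (1 - z / b) ^ m b) = (1 - z / a) ^ m a * Q z" for z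
    proof (cases "0 < m a")
      case True
      then have "a \<in> zeros_in m R" using a False by (simp add: zeros_in_def)
      then show ?thesis unfolding Q_def by (rule prod.remove[OF finite_zeros])
    next
      case not: False
      then have "zeros_in m R - {a} = zeros_in m R" by (auto simp: zeros_in_def)
      then show ?thesis using not by (simp add: Q_def)
    qed
    have "(1 - z / a) ^ m a = (z - a) ^ m a * (- 1 / a) ^ m a" for z
    proof -
      have "1 - z / a = (z - a) * (- 1 / a)" using False by (simp add: field_simps)
      then show ?thesis by (simp only: power_mult_distrib)
    qed
    then have eq: "zero_product m R z = (z - a) ^ m a * ((- 1 / a) ^ m a * z ^ m 0 * Q z)" for z
      by (simp only: zero_product_def split mult_ac)
    show thesis
      by (rule that[of "\<lambda>z. (- 1 / a) ^ m a * z ^ m 0 * Q z", OF _ _ eq])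
        (use Q Qa False in \<open>auto intro!: holomorphic_intros\<close>)
  qed
qed

text \<open>\<open>norm (1 - z / a) \<le> 3 * r / norm a\<close> turns the logarithm of the product
  into a part of \<open>log_zeros m (3 * r)\<close>.\<close>

lemma norm_zero_product_le:
  assumes r: "0 < r" and z: "norm z \<le> r"
  shows "norm (zero_product m (2 * r) z) \<le> exp (real (m 0) * r + 6 * K * r)"
proof -
  have "norm z ^ m 0 \<le> exp r ^ m 0" 
  proof (rule power_mono)
    show "norm z \<le> exp r" using z exp_ge_add_one_self[of r] by linarith
  qed simp
  also have "\<dots> = exp (real (m 0) * r)" by (simp add: exp_of_nat_mult)
  finally have 1: "norm (z ^ m 0) \<le> exp (real (m 0) * r)" by (simp add: norm_power)
  have "norm (\<Prod>a\<in>zeros_in m (2 * r). (1 - z / a) ^ m a) \<le> (\<Prod>a\<in>zeros_in m (2 * r). exp (real (m a) * ln (3 * r / norm a)))"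
    unfolding prod_norm[symmetric]
  proof (rule prod_mono)
    fix a assume a: "a \<in> zeros_in m (2 * r)"
    then have na: "0 < norm a" "norm a < 2 * r" by (auto simp: zeros_in_def)
    have "norm (1 - z / a) \<le> 1 + norm z / norm a" using norm_triangle_ineq4[of 1 "z / a"] by (simp add: norm_divide)
    also have "\<dots> = (norm a + norm z) / norm a" using na by (simp add: field_simps)
    also have "\<dots> \<le> 3 * r / norm a" using na z by (intro divide_right_mono) auto
    finally have "norm (1 - z / a) ^ m a \<le> (3 * r / norm a) ^ m a" by (intro power_mono) auto
    also have "\<dots> = exp (real (m a) * ln (3 * r / norm a))" using na r by (simp add: exp_of_nat_mult)
    finally show "0 \<le> norm ((1 - z / a) ^ m a) \<and> norm ((1 - z / a) ^ m a) \<le> exp (real (m a) * ln (3 * r / norm a))"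
      by (simp add: norm_power)
  qed
  also have "\<dots> = exp (\<Sum>a\<in>zeros_in m (2 * r). real (m a) * ln (3 * r / norm a))" by (simp add: exp_sum)
  also have "\<dots> \<le> exp (6 * K * r)"
  proof -
    have "(\<Sum>a\<in>zeros_in m (2 * r). real (m a) * ln (3 * r / norm a)) \<le> log_zeros m (3 * r)"
      unfolding log_zeros_def using zeros_in_mono[of "2 * r" "3 * r" m] r log_zeros_term_nonneg by (intro sum_mono2) auto
    also have "\<dots> \<le> 2 * K * (3 * r)" by (rule log_zeros_le_linear) (use r in simp)
    finally show ?thesis by simp
  qed
  finally show ?thesis unfolding zero_product_def norm_mult exp_add using 1 by (intro mult_mono) auto
qed

text \<open>On the disc of radius \<open>r\<close> the limit is a finite product times an
  exponential without zeros. These local formulas agree, all being limits of the same products, so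
  \<open>F\<close> may pick a radius depending on \<open>z\<close>.\<close>

theorem Lindelof_product:
  assumes L: "(inverse_sum m \<longlongrightarrow> L) at_top"
  obtains F where "F holomorphic_on UNIV" "is_zero_set m F" "exponential_type F"
    "\<And>z. ((\<lambda>R. zero_product m R z) \<longlongrightarrow> F z) at_top"
proof -
  define G where "G r z = zero_product m (2 * r) z * exp (log_tail r z - z * (L - inverse_sum m (2 * r)))" for r z
  have lim: "((\<lambda>R. zero_product m R z) \<longlongrightarrow> G r z) at_top" if r: "0 < r" and z: "norm z \<le> r" for r z
  proof -
    have "((\<lambda>R. \<Sum>a\<in>zeros_in m R - zeros_in m (2 * r). log_factor a z) \<longlongrightarrow> log_tail r z) at_top"
      by (rule tendsto_uniform_limitI[OF uniform_limit_log_tail[OF r]]) (use z in simp)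
    then have "((\<lambda>R. zero_product m (2 * r) z *
       exp ((\<Sum>a\<in>zeros_in m R - zeros_in m (2 * r). log_factor a z) - z * (inverse_sum m R - inverse_sum m (2 * r)))) \<longlongrightarrow> G r z) at_top"
      unfolding G_def by (intro tendsto_intros L)
    moreover have "eventually (\<lambda>R. zero_product m (2 * r) z *
       exp ((\<Sum>a\<in>zeros_in m R - zeros_in m (2 * r). log_factor a z) - z * (inverse_sum m R - inverse_sum m (2 * r))) = zero_product m R z) at_top"
      using eventually_ge_at_top[of "2 * r"] by eventually_elim (rule zero_product_split[OF r z, symmetric])
    ultimately show ?thesis by (simp add: tendsto_cong)
  qed
  define F where "F z = G (norm z + 1) z" for z
  have limF: "((\<lambda>R. zero_product m R z) \<longlongrightarrow> F z) at_top" for z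
    unfolding F_def by (rule lim) (auto simp: add_nonneg_pos)
  have FG: "F z = G r z" if "0 < r" "norm z \<le> r" for r z
    by (rule tendsto_unique[OF _ limF lim[OF that]]) simp
  have zp: "zero_product m R holomorphic_on S" for R S
    unfolding zero_product_def[abs_def] by (intro holomorphic_intros) (auto simp: zeros_in_def)
  have Gh: "G r holomorphic_on ball 0 r" if "0 < r" for r
    unfolding G_def[abs_def] by (intro holomorphic_intros zp holomorphic_log_tail that)
  have Fr: "F holomorphic_on ball 0 r" if "0 < r" for r
    by (rule holomorphic_transform[OF Gh[OF that]]) (use FG[OF that] in auto)
  have F: "F holomorphic_on UNIV"
    unfolding holomorphic_on_def
  proof
    fix z :: complex
    have "z \<in> ball 0 (norm z + 1)" by simp
    moreover have "F holomorphic_on ball 0 (norm z + 1)" by (rule Fr) (simp add: add_nonneg_pos)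
    ultimately show "F field_differentiable (at z within UNIV)"
      using holomorphic_on_imp_differentiable_at by blast
  qed
  have "is_zero_set m F"
    unfolding is_zero_set_iff_local_factor[OF F]
  proof
    fix a :: complex
    define r where "r = norm a + 1"
    have r: "0 < r" "norm a < r" by (auto simp: r_def add_nonneg_pos)
    obtain g where g: "g holomorphic_on UNIV" "g a \<noteq> 0" "\<And>z. zero_product m (2 * r) z = (z - a) ^ m a * g z"
      by (rule zero_product_local_factor[of a "2 * r"]) (use r in auto)
    define h where "h z = g z * exp (log_tail r z - z * (L - inverse_sum m (2 * r)))" for z
    have "h holomorphic_on ball 0 r" unfolding h_def
      by (intro holomorphic_intros holomorphic_log_tail r holomorphic_on_subset[OF g(1)]) auto
    then have "h analytic_on {a}" using r by (intro holomorphic_on_imp_analytic_at[of _ "ball 0 r"]) auto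
    moreover have "h a \<noteq> 0" using g(2) by (simp add: h_def)
    moreover have "eventually (\<lambda>z. z \<in> ball 0 r) (nhds a)" using r by (intro eventually_nhds_in_open) auto
    then have "eventually (\<lambda>z. F z = (z - a) ^ m a * h z) (nhds a)"
      by eventually_elim (use FG[OF r(1)] in \<open>auto simp: G_def h_def g(3)\<close>)
    ultimately show "\<exists>g. g analytic_on {a} \<and> g a \<noteq> 0 \<and> eventually (\<lambda>z. F z = (z - a) ^ m a * g z) (nhds a)" by blast
  qed
  moreover have "exponential_type F"
  proof -
    obtain M where M: "\<And>R. norm (inverse_sum m R) \<le> M" using inverse_sum_bounded[OF L] by blast
    define B where "B = real (m 0) + 10 * K + norm L + M"
    have "norm (F z) \<le> exp B * exp (B * norm z)" for z
    proof -
      define r where "r = norm z + 1"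
      have r: "0 < r" "norm z \<le> r" by (auto simp: r_def add_nonneg_pos)
      have "norm (log_tail r z - z * (L - inverse_sum m (2 * r))) \<le> norm (log_tail r z) + norm (z * (L - inverse_sum m (2 * r)))"
        by (rule norm_triangle_ineq4)
      also have "norm (z * (L - inverse_sum m (2 * r))) \<le> r * (norm L + M)"
        unfolding norm_mult using r M[of "2 * r"] norm_triangle_ineq4[of L "inverse_sum m (2 * r)"]
        by (intro mult_mono) auto
      finally have "norm (log_tail r z - z * (L - inverse_sum m (2 * r))) \<le> 4 * K * r + r * (norm L + M)"
        using norm_log_tail_le[OF r] by linarith
      then have "Re (log_tail r z - z * (L - inverse_sum m (2 * r))) \<le> 4 * K * r + r * (norm L + M)"
        using complex_Re_le_cmod order_trans by blast
      then have "norm (exp (log_tail r z - z * (L - inverse_sum m (2 * r)))) \<le> exp (4 * K * r + r * (norm L + M))"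
        by simp
      then have "norm (F z) \<le> exp (real (m 0) * r + 6 * K * r) * exp (4 * K * r + r * (norm L + M))"
        unfolding FG[OF r] G_def norm_mult by (intro mult_mono norm_zero_product_le[OF r]) auto
      also have "\<dots> = exp B * exp (B * norm z)" by (simp add: exp_add[symmetric] B_def r_def algebra_simps)
      finally show ?thesis .
    qed
    then show ?thesis unfolding exponential_type_def by blast
  qed
  ultimately show thesis using F limF by (intro that[of F])
qed

end

section \<open>The integral condition\<close>

definition Jensen_sum :: "(complex \<Rightarrow> nat) \<Rightarrow> complex \<Rightarrow> real \<Rightarrow> real" where
  "Jensen_sum m c T = (\<Sum>z | 0 < m z \<and> dist z c \<le> T. real (m z) * ln (T / dist z c))"

lemma finite_zeros_cball:
  assumes "no_finite_limit_points m"
  shows "finite {z. 0 < m z \<and> dist z c \<le> T}"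
  by (rule finite_subset[OF _ finite_zeros_ball[OF assms, of c "T + 1"]]) (auto simp: dist_commute)

lemma has_bochner_integral_inverse_step:
  fixes d T :: real
  assumes "0 < d" "d \<le> T"
  shows "has_bochner_integral lborel (\<lambda>t. 1 / t * indicator {d..<T} t) (ln (T / d))"
proof -
  have "has_bochner_integral lborel (\<lambda>t. 1 / t * indicator {d..T} t) (ln T - ln d)"
    using assms by (intro has_bochner_integral_FTC_Icc_real) (auto intro!: derivative_eq_intros continuous_intros)
  also have "ln T - ln d = ln (T / d)" using assms by (simp add: ln_div)
  also have "has_bochner_integral lborel (\<lambda>t. 1 / t * indicator {d..T} t) (ln (T / d)) \<longleftrightarrow>
      has_bochner_integral lborel (\<lambda>t. 1 / t * indicator {d..<T} t) (ln (T / d))"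
    by (rule has_bochner_integral_discrete_difference[of "{T}"]) (auto simp: indicator_def)
  finally show ?thesis .
qed

text \<open>On \<open>0 < t < T\<close> the quotient \<open>cnt m c t / t\<close> is a sum of
  functions \<open>1 / t\<close> cut off below \<open>dist z c\<close>. They are integrable because
  \<open>c\<close> is not a zero, so every cut-off is positive.\<close>

lemma LBINT_cnt_difference:
  assumes m: "no_finite_limit_points m" and T: "0 < T" and b: "m b = 0" and x: "m x = 0"
  shows "(LBINT t=0..ereal T. (real (cnt m b t) - real (cnt m x t)) / t) = Jensen_sum m b T - Jensen_sum m x T"
proof -
  define A where "A c = {z. 0 < m z \<and> dist z c \<le> T}" for c
  define s where "s c t = (\<Sum>z\<in>A c. real (m z) * (1 / t * indicator {dist z c..<T} t))" for c t
  have fin: "finite (A c)" for c unfolding A_def by (rule finite_zeros_cball[OF m])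
  have int: "has_bochner_integral lborel (s c) (Jensen_sum m c T)" if "m c = 0" for c
    unfolding s_def[abs_def] Jensen_sum_def A_def
  proof (intro has_bochner_integral_sum has_bochner_integral_mult_right has_bochner_integral_inverse_step)
    fix z assume "z \<in> {z. 0 < m z \<and> dist z c \<le> T}"
    then show "0 < dist z c" "dist z c \<le> T" using that by auto
  qed
  have eq: "indicator {0<..<T} t * (real (cnt m c t) / t) = s c t" if "m c = 0" for c t
  proof (cases "t \<in> {0<..<T}")
    case True
    have "{z \<in> A c. dist z c \<le> t} = {z. 0 < m z \<and> dist z c \<le> t}" using True by (auto simp: A_def)
    then have "real (cnt m c t) = (\<Sum>z | z \<in> A c \<and> dist z c \<le> t. real (m z))" by (simp add: cnt_def)
    also have "\<dots> = (\<Sum>z\<in>A c. if dist z c \<le> t then real (m z) else 0)" by (rule sum.inter_filter[OF fin])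
    finally have "real (cnt m c t) / t = (\<Sum>z\<in>A c. (if dist z c \<le> t then real (m z) else 0) / t)"
      by (simp add: sum_divide_distrib)
    also have "\<dots> = s c t" unfolding s_def using True by (intro sum.cong) auto
    finally show ?thesis using True by simp
  next
    case False
    have "s c t = 0" unfolding s_def
    proof (rule sum.neutral, rule ballI)
      fix z assume "z \<in> A c"
      then have "0 < dist z c" using that by (auto simp: A_def)
      then have "0 < t" if "dist z c \<le> t" using that by linarith
      then have "t \<notin> {dist z c..<T}" using False by auto
      then show "real (m z) * (1 / t * indicator {dist z c..<T} t) = 0" by simp
    qed
    then show ?thesis using False by simp
  qed
  have "(LBINT t=0..ereal T. (real (cnt m b t) - real (cnt m x t)) / t) =
      (\<integral>t. indicator {0<..<T} t * ((real (cnt m b t) - real (cnt m x t)) / t) \<partial>lborel)"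
    using T by (simp add: zero_ereal_def interval_integral_Ioo set_lebesgue_integral_def)
  also have "\<dots> = (\<integral>t. s b t - s x t \<partial>lborel)"
    unfolding eq[OF b, symmetric] eq[OF x, symmetric] by (simp add: diff_divide_distrib right_diff_distrib)
  also have "\<dots> = Jensen_sum m b T - Jensen_sum m x T"
    by (rule has_bochner_integral_integral_eq[OF has_bochner_integral_diff[OF int[OF b] int[OF x]]])
  finally show ?thesis .
qed

section \<open>Recentring at the origin\<close>

definition centred_sum :: "(complex \<Rightarrow> nat) \<Rightarrow> complex \<Rightarrow> real \<Rightarrow> real" where
  "centred_sum m c T = (\<Sum>z | 0 < m z \<and> norm z < T. real (m z) * ln (T / dist z c))"

lemma cnt_mono:
  assumes "no_finite_limit_points m" "s \<le> t"
  shows "cnt m c s \<le> cnt m c t"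
  unfolding cnt_def by (rule sum_mono2) (use assms in \<open>auto intro: finite_zeros_cball\<close>)

text \<open>Condition (iii) concerns annuli of width 1; moving the centre of a disc needs wider
  ones, obtained by adding up unit steps.\<close>

lemma cnt_shift_tendsto_0:
  assumes "((\<lambda>t. (real (cnt m 0 (t + 1)) - real (cnt m 0 t)) / t) \<longlongrightarrow> 0) at_top"
  shows "((\<lambda>t. (real (cnt m 0 (t + real N)) - real (cnt m 0 t)) / t) \<longlongrightarrow> 0) at_top"
proof (induction N)
  case (Suc N)
  have "filterlim (\<lambda>t::real. t + real N) at_top at_top" by real_asymp
  from filterlim_compose[OF assms this]
  have "((\<lambda>t. (real (cnt m 0 (t + real N + 1)) - real (cnt m 0 (t + real N))) / (t + real N) * ((t + real N) / t)) \<longlongrightarrow> 0 * 1) at_top"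
    by (rule tendsto_mult) real_asymp
  from tendsto_add[OF this Suc.IH]
  have "((\<lambda>t. (real (cnt m 0 (t + real N + 1)) - real (cnt m 0 (t + real N))) / (t + real N) * ((t + real N) / t)
      + (real (cnt m 0 (t + real N)) - real (cnt m 0 t)) / t) \<longlongrightarrow> 0) at_top" by simp
  moreover have "eventually (\<lambda>t. (real (cnt m 0 (t + real N + 1)) - real (cnt m 0 (t + real N))) / (t + real N) * ((t + real N) / t)
      + (real (cnt m 0 (t + real N)) - real (cnt m 0 t)) / t = (real (cnt m 0 (t + real (Suc N))) - real (cnt m 0 t)) / t) at_top"
    using eventually_gt_at_top[of 0]
  proof eventually_elim
    case (elim t)
    then have "t + real N \<noteq> 0" by (simp add: add_nonneg_eq_0_iff)
    then show ?case by (simp add: add_divide_distrib[symmetric] add.assoc add.commute[of 1])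
  qed
  ultimately show ?case by (simp add: tendsto_cong)
qed simp

text \<open>The two sums differ only over zeros in an annulus of bounded width around radius
  \<open>T\<close>. There the logarithm is at most \<open>2 * norm c / T\<close> in absolute value,
  and by (iii) the number of such zeros is \<open>o(T)\<close>.\<close>

lemma Jensen_sum_minus_centred_sum_tendsto_0:
  assumes m: "no_finite_limit_points m" and c: "m c = 0"
    and iii: "((\<lambda>t. (real (cnt m 0 (t + 1)) - real (cnt m 0 t)) / t) \<longlongrightarrow> 0) at_top"
  shows "((\<lambda>T. Jensen_sum m c T - centred_sum m c T) \<longlongrightarrow> 0) at_top"
proof (rule Lim_null_comparison)
  define N where "N = nat \<lceil>2 * norm c + 1\<rceil>"
  have N: "2 * norm c + 1 \<le> real N" unfolding N_def by linarith
  define g where "g T = 2 * norm c * ((real (cnt m 0 ((T - norm c - 1) + real N)) - real (cnt m 0 (T - norm c - 1))) / (T - norm c - 1) * ((T - norm c - 1) / T))" for T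
  have "filterlim (\<lambda>T::real. T - norm c - 1) at_top at_top" by real_asymp
  from filterlim_compose[OF cnt_shift_tendsto_0[OF iii, of N] this]
  have "(g \<longlongrightarrow> 2 * norm c * (0 * 1)) at_top" unfolding g_def
    by (intro tendsto_mult tendsto_const) (assumption, real_asymp)
  then show "(g \<longlongrightarrow> 0) at_top" by simp
  show "eventually (\<lambda>T. norm (Jensen_sum m c T - centred_sum m c T) \<le> g T) at_top"
    using eventually_gt_at_top[of "2 * norm c + 2"]
  proof eventually_elim
    case (elim T)
    have nc: "0 \<le> norm c" by simp
    have T: "0 < T" "T / 2 \<le> T - norm c" "0 < T - norm c - 1" using elim nc by linarith+
    define A where "A = {z. 0 < m z \<and> dist z c \<le> T}"
    define B where "B = {z. 0 < m z \<and> norm z < T}"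
    \<comment> \<open>The 1 keeps the removed closed disc clear of the symmetric difference even for
      \<open>c = 0\<close>, where a zero with modulus exactly \<open>T\<close> lies in
      \<open>A\<close> but not in \<open>B\<close>.\<close>
    define U where "U = {z. 0 < m z \<and> dist z 0 \<le> T + norm c} - {z. 0 < m z \<and> dist z 0 \<le> T - norm c - 1}"
    have finB: "finite B" by (rule finite_subset[OF _ finite_zeros_cball[OF m, of 0 T]]) (auto simp: B_def)
    have finA: "finite A" unfolding A_def by (rule finite_zeros_cball[OF m])
    have finU: "finite U" unfolding U_def by (intro finite_Diff finite_zeros_cball[OF m])
    define \<phi> where "\<phi> z = real (m z) * ln (T / dist z c)" for z
    have tri: "norm z \<le> dist z c + norm c" "dist z c \<le> norm z + norm c" for z
      using norm_triangle_sub[of z c] norm_triangle_ineq4[of z c] by (auto simp: dist_norm)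
    have "Jensen_sum m c T - centred_sum m c T = sum \<phi> A - sum \<phi> B"
      by (simp add: Jensen_sum_def centred_sum_def A_def B_def \<phi>_def)
    also have "\<dots> = sum \<phi> (A - B) - sum \<phi> (B - A)"
      using sum.Int_Diff[OF finA, of \<phi> B] sum.Int_Diff[OF finB, of \<phi> A] by (simp add: Int_commute)
    finally have "\<bar>Jensen_sum m c T - centred_sum m c T\<bar> \<le> \<bar>sum \<phi> (A - B)\<bar> + \<bar>sum \<phi> (B - A)\<bar>" by linarith
    also have "\<dots> \<le> (\<Sum>z\<in>A - B. \<bar>\<phi> z\<bar>) + (\<Sum>z\<in>B - A. \<bar>\<phi> z\<bar>)" by (intro add_mono sum_abs)
    also have "\<dots> = (\<Sum>z\<in>(A - B) \<union> (B - A). \<bar>\<phi> z\<bar>)"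
      using finA finB by (subst sum.union_disjoint) auto
    also have "\<dots> \<le> (\<Sum>z\<in>(A - B) \<union> (B - A). real (m z) * (2 * norm c / T))"
    proof (rule sum_mono)
      fix z assume z: "z \<in> (A - B) \<union> (B - A)"
      have "\<bar>ln (T / dist z c)\<bar> \<le> 2 * norm c / T"
      proof (cases "z \<in> A - B")
        case True
        then have d: "dist z c \<le> T" "T \<le> norm z" by (auto simp: A_def B_def)
        then have d2: "T - norm c \<le> dist z c" "0 < dist z c" using tri[of z] T by linarith+
        have nonneg: "0 \<le> ln (T / dist z c)" using d d2 by (intro ln_ge_zero) simp
        have "ln (T / dist z c) \<le> T / dist z c - 1" using d2 T by (intro ln_le_minus_one) auto
        also have "\<dots> = (T - dist z c) / dist z c" using d2 by (simp add: diff_divide_distrib)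
        also have "\<dots> \<le> norm c / (T / 2)" using d d2 T by (intro frac_le) auto
        also have "\<dots> = 2 * norm c / T" by simp
        finally show ?thesis using nonneg by (simp only: abs_of_nonneg)
      next
        case False
        then have d: "T < dist z c" "norm z < T" using z by (auto simp: A_def B_def)
        have dp: "0 < dist z c" using d T by linarith
        have eq: "ln (T / dist z c) = - ln (dist z c / T)" using dp T by (simp add: ln_div)
        have nonneg: "0 \<le> ln (dist z c / T)" using d T by (intro ln_ge_zero) simp
        have "ln (dist z c / T) \<le> dist z c / T - 1" by (intro ln_le_minus_one divide_pos_pos dp T(1))
        also have "\<dots> = (dist z c - T) / T" using T by (simp add: diff_divide_distrib)
        also have "\<dots> \<le> 2 * norm c / T" using tri(2)[of z] d T nc by (intro divide_right_mono) linarith+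
        finally show ?thesis unfolding eq abs_minus_cancel using nonneg by (simp only: abs_of_nonneg)
      qed
      then show "\<bar>\<phi> z\<bar> \<le> real (m z) * (2 * norm c / T)"
        unfolding \<phi>_def abs_mult abs_of_nat by (rule mult_left_mono) simp
    qed
    also have "\<dots> \<le> (\<Sum>z\<in>U. real (m z) * (2 * norm c / T))"
    proof (rule sum_mono2[OF finU])
      show "(A - B) \<union> (B - A) \<subseteq> U"
      proof
        fix z assume z: "z \<in> (A - B) \<union> (B - A)"
        then have "norm z \<le> T + norm c" "T - norm c - 1 < norm z" "0 < m z"
          using tri[of z] nc by (auto simp: A_def B_def)
        then show "z \<in> U" by (simp add: U_def)
      qed
    qed (use T in auto)
    also have "\<dots> = (real (cnt m 0 (T + norm c)) - real (cnt m 0 (T - norm c - 1))) * (2 * norm c / T)"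
    proof -
      have "T - norm c - 1 \<le> T + norm c" using nc by linarith
      then have "{z. 0 < m z \<and> dist z 0 \<le> T - norm c - 1} \<subseteq> {z. 0 < m z \<and> dist z 0 \<le> T + norm c}"
        by (auto intro: order_trans)
      from sum.subset_diff[OF this finite_zeros_cball[OF m], of "\<lambda>z. real (m z)"]
      have "(\<Sum>z\<in>U. real (m z)) = real (cnt m 0 (T + norm c)) - real (cnt m 0 (T - norm c - 1))"
        by (simp add: U_def cnt_def)
      then show ?thesis by (simp only: sum_distrib_right[symmetric])
    qed
    also have "\<dots> \<le> (real (cnt m 0 (T - norm c - 1 + real N)) - real (cnt m 0 (T - norm c - 1))) * (2 * norm c / T)"
      using cnt_mono[OF m, of "T + norm c" "T - norm c - 1 + real N" 0] N T by (intro mult_right_mono) auto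
    also have "\<dots> = g T" using T by (simp add: g_def)
    finally show ?case by simp
  qed
qed

text \<open>The second sum does not depend on \<open>c\<close>, so it cancels when two points are
  compared.\<close>

lemma ln_norm_zero_product:
  assumes m: "no_finite_limit_points m" and c: "m c = 0"
  shows "zero_product m T c \<noteq> 0"
    and "0 < T \<Longrightarrow> ln (norm (zero_product m T c)) =
      (\<Sum>z | 0 < m z \<and> norm z < T. real (m z) * ln (dist z c)) - (\<Sum>z\<in>zeros_in m T. real (m z) * ln (norm z))"
proof -
  have fin: "finite (zeros_in m T)" by (rule finite_zeros_in[OF m])
  have nz: "1 - c / a \<noteq> 0" if "a \<in> zeros_in m T" for a
    using that c by (auto simp: zeros_in_def divide_eq_1_iff)
  have c0: "c \<noteq> 0 \<or> m 0 = 0" using c by auto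
  have P: "(\<Prod>a\<in>zeros_in m T. (1 - c / a) ^ m a) \<noteq> 0" using nz fin c by simp
  have C: "c ^ m 0 \<noteq> 0" using c0 by auto
  show "zero_product m T c \<noteq> 0" using P C by (simp add: zero_product_def)
  assume T: "0 < T"
  have "ln (norm (zero_product m T c)) = real (m 0) * ln (norm c) + ln (norm (\<Prod>a\<in>zeros_in m T. (1 - c / a) ^ m a))"
  proof -
    have "0 < norm (c ^ m 0)" "0 < norm (\<Prod>a\<in>zeros_in m T. (1 - c / a) ^ m a)" using P C by simp_all
    moreover have "ln (norm (c ^ m 0)) = real (m 0) * ln (norm c)" using c0 by (auto simp: norm_power ln_realpow)
    ultimately show ?thesis by (simp only: zero_product_def norm_mult ln_mult_pos)
  qed
  also have "ln (norm (\<Prod>a\<in>zeros_in m T. (1 - c / a) ^ m a)) = (\<Sum>a\<in>zeros_in m T. real (m a) * ln (norm (1 - c / a)))"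
    by (rule ln_norm_prod_power[OF fin nz])
  also have "\<dots> = (\<Sum>a\<in>zeros_in m T. real (m a) * ln (dist a c)) - (\<Sum>a\<in>zeros_in m T. real (m a) * ln (norm a))"
    unfolding sum_subtractf[symmetric]
  proof (rule sum.cong[OF refl])
    fix a assume a: "a \<in> zeros_in m T"
    then have a0: "a \<noteq> 0" "a \<noteq> c" using c by (auto simp: zeros_in_def)
    have "1 - c / a = (a - c) / a" using a0 by (simp add: field_simps)
    then have "norm (1 - c / a) = dist a c / norm a" by (simp only: norm_divide dist_norm)
    then have "ln (norm (1 - c / a)) = ln (dist a c) - ln (norm a)" using a0 by (simp add: ln_div)
    then show "real (m a) * ln (norm (1 - c / a)) = real (m a) * ln (dist a c) - real (m a) * ln (norm a)"
      by (simp add: right_diff_distrib)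
  qed
  also have "real (m 0) * ln (norm c) + ((\<Sum>a\<in>zeros_in m T. real (m a) * ln (dist a c)) - (\<Sum>a\<in>zeros_in m T. real (m a) * ln (norm a)))
    = (\<Sum>z | 0 < m z \<and> norm z < T. real (m z) * ln (dist z c)) - (\<Sum>a\<in>zeros_in m T. real (m a) * ln (norm a))"
  proof (cases "m 0 = 0")
    case True
    have "{z. 0 < m z \<and> norm z < T} = zeros_in m T" using True by (auto simp: zeros_in_def intro: ccontr)
    then show ?thesis using True by simp
  next
    case False
    have "{z. 0 < m z \<and> norm z < T} = insert 0 (zeros_in m T)" using False T by (auto simp: zeros_in_def)
    moreover have "0 \<notin> zeros_in m T" by (simp add: zeros_in_def)
    ultimately show ?thesis using fin by (simp add: dist_norm)
  qed
  finally show "ln (norm (zero_product m T c)) =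
      (\<Sum>z | 0 < m z \<and> norm z < T. real (m z) * ln (dist z c)) - (\<Sum>z\<in>zeros_in m T. real (m z) * ln (norm z))" .
qed

text \<open>After recentring, both sums run over the same zeros, so the terms \<open>ln T\<close>
  cancel and only the logarithms of the partial products at \<open>x\<close> and \<open>b\<close>
  remain.\<close>

lemma LBINT_cnt_tendsto:
  assumes m: "no_finite_limit_points m" and b: "m b = 0" and x: "m x = 0"
    and iii: "((\<lambda>t. (real (cnt m 0 (t + 1)) - real (cnt m 0 t)) / t) \<longlongrightarrow> 0) at_top"
    and Fb: "((\<lambda>R. zero_product m R b) \<longlongrightarrow> Fb) at_top" "Fb \<noteq> 0"
    and Fx: "((\<lambda>R. zero_product m R x) \<longlongrightarrow> Fx) at_top" "Fx \<noteq> 0"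
  shows "((\<lambda>T. LBINT t=0..ereal T. (real (cnt m b t) - real (cnt m x t)) / t) \<longlongrightarrow> ln (norm Fx) - ln (norm Fb)) at_top"
proof -
  have "((\<lambda>T. (Jensen_sum m b T - centred_sum m b T) - (Jensen_sum m x T - centred_sum m x T)
      + (ln (norm (zero_product m T x)) - ln (norm (zero_product m T b)))) \<longlongrightarrow> 0 - 0 + (ln (norm Fx) - ln (norm Fb))) at_top"
    by (intro tendsto_add tendsto_diff Jensen_sum_minus_centred_sum_tendsto_0[OF m _ iii] b x tendsto_ln tendsto_norm Fb Fx)
      (use Fb Fx in auto)
  moreover have "eventually (\<lambda>T. (Jensen_sum m b T - centred_sum m b T) - (Jensen_sum m x T - centred_sum m x T)
      + (ln (norm (zero_product m T x)) - ln (norm (zero_product m T b))) =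
      (LBINT t=0..ereal T. (real (cnt m b t) - real (cnt m x t)) / t)) at_top"
    using eventually_gt_at_top[of 0]
  proof eventually_elim
    case (elim T)
    have "centred_sum m c T = (\<Sum>z | 0 < m z \<and> norm z < T. real (m z) * ln T) - (\<Sum>z | 0 < m z \<and> norm z < T. real (m z) * ln (dist z c))"
      if "m c = 0" for c
      unfolding centred_sum_def sum_subtractf[symmetric]
    proof (rule sum.cong[OF refl])
      fix z assume "z \<in> {z. 0 < m z \<and> norm z < T}"
      then have "0 < dist z c" using that by auto
      then show "real (m z) * ln (T / dist z c) = real (m z) * ln T - real (m z) * ln (dist z c)"
        using elim by (simp add: ln_div right_diff_distrib)
    qed
    then show ?case
      using ln_norm_zero_product(2)[OF m b elim] ln_norm_zero_product(2)[OF m x elim] LBINT_cnt_difference[OF m elim b x] b x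
      by simp
  qed
  ultimately show ?thesis by (simp add: tendsto_cong)
qed

section \<open>The characterization\<close>

text \<open>\<tau> is the infimum of the admissible exponents. The point \<open>z1\<close> bounds
  them from below, and the infimum is admissible since each pointwise condition is closed. A
  violation for a smaller exponent lies off the real axis, where the bound does depend on the
  exponent.\<close>

lemma half_plane_type_attained:
  assumes z1: "0 < Im z1" "g z1 \<noteq> 0" and C: "0 < C"
    and bound: "\<And>z. 0 \<le> Im z \<Longrightarrow> norm (g z) \<le> C * exp (B * Im z)"
  obtains \<tau> where "\<And>z. 0 \<le> Im z \<Longrightarrow> norm (g z) \<le> C * exp (\<tau> * Im z)"
    "\<And>\<epsilon>. 0 < \<epsilon> \<Longrightarrow> \<exists>z. 0 < Im z \<and> C * exp ((\<tau> - \<epsilon>) * Im z) < norm (g z)"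
proof -
  define S where "S = {s. \<forall>z. 0 \<le> Im z \<longrightarrow> norm (g z) \<le> C * exp (s * Im z)}"
  have BS: "B \<in> S" using bound by (simp add: S_def)
  have lower: "ln (norm (g z) / C) / Im z \<le> s" if "s \<in> S" "0 < Im z" "g z \<noteq> 0" for s z
  proof -
    have "norm (g z) / C \<le> exp (s * Im z)" using that C by (simp add: S_def divide_le_eq mult.commute)
    then have "ln (norm (g z) / C) \<le> ln (exp (s * Im z))" using that C by (subst ln_le_cancel_iff) auto
    then show ?thesis using that by (simp add: divide_le_eq)
  qed
  have bdd: "bdd_below S" using lower[OF _ z1] by (auto simp: bdd_below_def)
  define \<tau> where "\<tau> = Inf S"
  have "norm (g z) \<le> C * exp (\<tau> * Im z)" if z: "0 \<le> Im z" for z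
  proof (cases "Im z = 0 \<or> g z = 0")
    case True
    then show ?thesis using bound[OF z] C by auto
  next
    case False
    then have "0 < Im z" "g z \<noteq> 0" using z by auto
    have "ln (norm (g z) / C) / Im z \<le> \<tau>" unfolding \<tau>_def
      by (rule cInf_greatest) (use BS lower \<open>0 < Im z\<close> \<open>g z \<noteq> 0\<close> in auto)
    then have "ln (norm (g z) / C) \<le> \<tau> * Im z" using \<open>0 < Im z\<close> by (simp add: divide_le_eq)
    then have "exp (ln (norm (g z) / C)) \<le> exp (\<tau> * Im z)" by simp
    then show ?thesis using \<open>g z \<noteq> 0\<close> C by (simp add: divide_le_eq mult.commute)
  qed
  moreover have "\<exists>z. 0 < Im z \<and> C * exp ((\<tau> - \<epsilon>) * Im z) < norm (g z)" if e: "0 < \<epsilon>" for \<epsilon>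
  proof -
    have "\<tau> - \<epsilon> \<notin> S" using cInf_lower[OF _ bdd, of "\<tau> - \<epsilon>"] e by (auto simp: \<tau>_def)
    then obtain z where z: "0 \<le> Im z" "C * exp ((\<tau> - \<epsilon>) * Im z) < norm (g z)" by (auto simp: S_def not_le)
    moreover have "Im z \<noteq> 0" using z bound[of z] by auto
    ultimately show ?thesis by (intro exI[of _ z]) auto
  qed
  ultimately show thesis by (rule that)
qed

text \<open>The factor \<open>exp (\<i> * \<kappa> * z)\<close> shifts the types of the two
  half-planes in opposite directions, so half their difference makes them equal, while the modulus
  on the real axis changes only by the constant \<open>C\<close>.\<close>

lemma balanced_function_normalization:
  assumes f: "f holomorphic_on UNIV" and zs: "is_zero_set m f" and d: "no_finite_limit_points m" and m0: "m 0 = 0"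
    and C: "0 < C" and bound: "\<And>z. norm (f z) \<le> C * exp (B * \<bar>Im z\<bar>)"
  obtains \<kappa> \<sigma> where "balanced_function (\<lambda>z. exp (\<i> * of_real \<kappa> * z) / of_real C * f z) m \<sigma>"
proof -
  define S where "S = {z. 0 < m z \<and> norm z \<le> 2}"
  have "finite S" using d by (simp add: S_def no_finite_limit_points_def)
  then have "finite (Re ` S \<union> (\<lambda>z. - Re z) ` S)" by simp
  moreover have "infinite {0..1::real}" by (intro infinite_Icc) simp
  \<comment> \<open>One abscissa such that neither \<open>t + \<i>\<close> nor its negative is a
    zero, so that neither half-plane type is minus infinity.\<close>
  ultimately obtain t where t: "t \<in> {0..1}" "t \<notin> Re ` S \<union> (\<lambda>z. - Re z) ` S"
    by (meson finite_subset subsetI)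
  define z1 where "z1 = Complex t 1"
  have n: "norm z1 \<le> 2" using cmod_le[of z1] t by (simp add: z1_def)
  have f1: "f z1 \<noteq> 0"
  proof
    assume "f z1 = 0"
    then have "z1 \<in> S" using is_zero_set_zero_iff[OF zs] n by (simp add: S_def)
    then have "Re z1 \<in> Re ` S" by (rule imageI)
    then show False using t by (simp add: z1_def)
  qed
  have f2: "f (- z1) \<noteq> 0"
  proof
    assume "f (- z1) = 0"
    then have "- z1 \<in> S" using is_zero_set_zero_iff[OF zs] n by (simp add: S_def)
    then have "- Re (- z1) \<in> (\<lambda>z. - Re z) ` S" by (rule imageI)
    then show False using t by (simp add: z1_def)
  qed
  have Im1: "0 < Im z1" by (simp add: z1_def)
  have b1: "norm (f z) \<le> C * exp (B * Im z)" if "0 \<le> Im z" for z using bound[of z] that by simp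
  have b2: "norm (f (- z)) \<le> C * exp (B * Im z)" if "0 \<le> Im z" for z using bound[of "- z"] that by simp
  obtain \<tau>1 where t1: "\<And>z. 0 \<le> Im z \<Longrightarrow> norm (f z) \<le> C * exp (\<tau>1 * Im z)"
    "\<And>\<epsilon>. 0 < \<epsilon> \<Longrightarrow> \<exists>z. 0 < Im z \<and> C * exp ((\<tau>1 - \<epsilon>) * Im z) < norm (f z)"
    using half_plane_type_attained[of z1 f C B, OF Im1 f1 C b1] by blast
  obtain \<tau>2 where t2: "\<And>z. 0 \<le> Im z \<Longrightarrow> norm (f (- z)) \<le> C * exp (\<tau>2 * Im z)"
    "\<And>\<epsilon>. 0 < \<epsilon> \<Longrightarrow> \<exists>z. 0 < Im z \<and> C * exp ((\<tau>2 - \<epsilon>) * Im z) < norm (f (- z))"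
    using half_plane_type_attained[of z1 "\<lambda>z. f (- z)" C B, OF Im1 f2 C b2] by blast
  define \<kappa> \<sigma> where "\<kappa> = (\<tau>1 - \<tau>2) / 2" and "\<sigma> = (\<tau>1 + \<tau>2) / 2"
  have tau: "\<tau>1 = \<sigma> + \<kappa>" "\<tau>2 = \<sigma> - \<kappa>" by (simp_all add: \<kappa>_def \<sigma>_def field_simps)
  define e where "e z = exp (\<i> * of_real \<kappa> * z) / of_real C" for z
  have ne: "norm (e z * f z) = exp (- \<kappa> * Im z) * (norm (f z) / C)" for z
    using C by (simp add: e_def norm_mult norm_divide)
  have up: "norm (e z * f z) \<le> exp (\<sigma> * Im z)" if "0 \<le> Im z" for z
  proof -
    have "norm (f z) / C \<le> exp (\<tau>1 * Im z)" using t1(1)[OF that] C by (simp add: divide_le_eq mult.commute)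
    then have "norm (e z * f z) \<le> exp (- \<kappa> * Im z) * exp (\<tau>1 * Im z)" unfolding ne by (intro mult_left_mono) auto
    also have "\<dots> = exp (\<sigma> * Im z)" by (simp add: exp_add[symmetric] tau algebra_simps)
    finally show ?thesis .
  qed
  have down: "norm (e (- z) * f (- z)) \<le> exp (\<sigma> * Im z)" if "0 \<le> Im z" for z
  proof -
    have "norm (f (- z)) / C \<le> exp (\<tau>2 * Im z)" using t2(1)[OF that] C by (simp add: divide_le_eq mult.commute)
    then have "norm (e (- z) * f (- z)) \<le> exp (- \<kappa> * Im (- z)) * exp (\<tau>2 * Im z)" unfolding ne by (intro mult_left_mono) auto
    also have "\<dots> = exp (\<sigma> * Im z)" by (simp add: exp_add[symmetric] tau algebra_simps)
    finally show ?thesis .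
  qed
  have "balanced_function (\<lambda>z. e z * f z) m \<sigma>"
  proof
    have he: "e holomorphic_on UNIV" unfolding e_def by (intro holomorphic_intros) (use C in auto)
    show "(\<lambda>z. e z * f z) holomorphic_on UNIV" by (intro holomorphic_intros he f)
    show "is_zero_set m (\<lambda>z. e z * f z)"
      by (rule is_zero_set_mult_nonvanishing[OF f he _ zs]) (use C in \<open>auto simp: e_def\<close>)
    show "no_finite_limit_points m" "m 0 = 0" by fact+
    show "norm (e z * f z) \<le> exp (\<sigma> * \<bar>Im z\<bar>)" for z
    proof (cases "0 \<le> Im z")
      case True then show ?thesis using up[OF True] by simp
    next
      case False then show ?thesis using down[of "- z"] by simp
    qed
    fix \<epsilon> :: real assume e0: "0 < \<epsilon>"
    obtain z where z: "0 < Im z" "C * exp ((\<tau>1 - \<epsilon>) * Im z) < norm (f z)" using t1(2)[OF e0] by blast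
    have "exp ((\<sigma> - \<epsilon>) * Im z) = exp (- \<kappa> * Im z) * exp ((\<tau>1 - \<epsilon>) * Im z)"
      by (simp add: exp_add[symmetric] tau algebra_simps)
    also have "\<dots> < norm (e z * f z)" unfolding ne
      using z C by (intro mult_strict_left_mono) (auto simp: less_divide_eq mult.commute)
    finally show "\<exists>z. 0 < Im z \<and> exp ((\<sigma> - \<epsilon>) * Im z) < norm (e z * f z)" using z(1) by blast
    obtain w where w: "0 < Im w" "C * exp ((\<tau>2 - \<epsilon>) * Im w) < norm (f (- w))" using t2(2)[OF e0] by blast
    have "exp ((\<sigma> - \<epsilon>) * Im w) = exp (- \<kappa> * Im (- w)) * exp ((\<tau>2 - \<epsilon>) * Im w)"
      by (simp add: exp_add[symmetric] tau algebra_simps)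
    also have "\<dots> < norm (e (- w) * f (- w))" unfolding ne
      using w C by (intro mult_strict_left_mono) (auto simp: less_divide_eq mult.commute)
    finally show "\<exists>z. 0 < Im z \<and> exp ((\<sigma> - \<epsilon>) * Im z) < norm (e (- z) * f (- z))" using w(1) by blast
  qed
  then show thesis unfolding e_def by (rule that)
qed

text \<open>\<open>cnt\<close> uses closed discs and counts the origin, \<open>num_zeros\<close>
  uses open ones and omits it; a shift by 1 bridges the difference.\<close>

lemma cnt_num_zeros_bounds:
  assumes m: "no_finite_limit_points m" and t: "0 \<le> t"
  shows "real (m 0) + num_zeros m t \<le> real (cnt m 0 t)" and "real (cnt m 0 t) \<le> real (m 0) + num_zeros m (t + 1)"
proof -
  define A where "A = {z. 0 < m z \<and> dist z 0 \<le> t}"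
  have fin: "finite A" unfolding A_def by (rule finite_zeros_cball[OF m])
  have A: "real (cnt m 0 t) = real (m 0) + (\<Sum>z\<in>A - {0}. real (m z))"
  proof (cases "0 < m 0")
    case True
    then have "0 \<in> A" using t by (simp add: A_def)
    then show ?thesis using sum.remove[OF fin, of 0 "\<lambda>z. real (m z)"] by (simp add: cnt_def A_def)
  next
    case False
    then have "A - {0} = A" by (auto simp: A_def)
    then show ?thesis using False by (simp add: cnt_def A_def)
  qed
  show "real (m 0) + num_zeros m t \<le> real (cnt m 0 t)"
    unfolding A num_zeros_def using fin by (intro add_left_mono sum_mono2) (auto simp: A_def zeros_in_def)
  show "real (cnt m 0 t) \<le> real (m 0) + num_zeros m (t + 1)"
    unfolding A num_zeros_def by (intro add_left_mono sum_mono2[OF finite_zeros_in[OF m]]) (auto simp: A_def zeros_in_def)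
qed

text \<open>Outside the unit disc division by the power of \<open>z\<close> cannot increase the
  modulus; inside, the quotient is bounded by compactness.\<close>

lemma divide_zero_at_origin:
  assumes f: "f holomorphic_on UNIV" and zs: "is_zero_set m f"
    and type: "exponential_type f" and bdd: "\<And>x::real. norm (f (of_real x)) \<le> M"
  obtains h where "h holomorphic_on UNIV" "is_zero_set (m(0 := 0)) h" "\<And>z. f z = z ^ m 0 * h z"
    "exponential_type h" "\<exists>M. \<forall>x::real. norm (h (of_real x)) \<le> M"
proof -
  obtain h where h: "h holomorphic_on UNIV" "\<And>z. f z = (z - 0) ^ m 0 * h z" "is_zero_set (m(0 := 0)) h"
    using is_zero_set_divide[OF f zs, of 0] by blast
  have "compact (h ` cball 0 1)"
    by (intro compact_continuous_image holomorphic_on_imp_continuous_on holomorphic_on_subset[OF h(1)]) auto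
  then obtain D where D: "0 < D" "\<And>z. norm z \<le> 1 \<Longrightarrow> norm (h z) \<le> D"
    using compact_imp_bounded[of "h ` cball 0 1"] unfolding bounded_pos by auto
  have le: "norm (h z) \<le> norm (f z)" if "1 \<le> norm z" for z
  proof -
    have "1 * norm (h z) \<le> norm z ^ m 0 * norm (h z)" using that by (intro mult_right_mono one_le_power) auto
    then show ?thesis by (simp add: h(2) norm_mult norm_power)
  qed
  obtain A B where AB: "\<And>z. norm (f z) \<le> A * exp (B * norm z)" using type unfolding exponential_type_def by blast
  have A0: "0 \<le> A" using order_trans[OF norm_ge_zero AB[of 0]] by simp
  have "norm (h z) \<le> (A + D) * exp (\<bar>B\<bar> * norm z)" for z
  proof (cases "1 \<le> norm z")
    case True
    have "norm (h z) \<le> A * exp (B * norm z)" using le[OF True] AB[of z] by linarith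
    also have "\<dots> \<le> (A + D) * exp (\<bar>B\<bar> * norm z)" using A0 D by (intro mult_mono) (auto intro!: mult_right_mono)
    finally show ?thesis .
  next
    case False
    have "norm (h z) \<le> D * 1" using D(2)[of z] False by simp
    also have "\<dots> \<le> (A + D) * exp (\<bar>B\<bar> * norm z)" using A0 D by (intro mult_mono) auto
    finally show ?thesis .
  qed
  then have "exponential_type h" unfolding exponential_type_def by blast
  moreover have "norm (h (of_real x)) \<le> max M D" for x :: real
    using le[of "of_real x"] bdd[of x] D(2)[of "of_real x"] by (cases "1 \<le> norm (complex_of_real x)") auto
  ultimately show thesis using h by (intro that[of h]) auto
qed

text \<open>The zero at the origin affects neither \<open>zeros_in\<close> nor
  \<open>num_zeros\<close>, so the results for balanced functions transfer. The factor
  \<open>exp (\<i> * \<kappa> * z)\<close> between the product and \<open>f\<close> stays, but has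
  modulus 1 on the real axis.\<close>

lemma bounded_exponential_type_zeros:
  assumes f: "f holomorphic_on UNIV" and zs: "is_zero_set m f" and d: "no_finite_limit_points m"
    and type: "exponential_type f" and bdd: "\<And>x::real. norm (f (of_real x)) \<le> M"
  shows "\<exists>L. (inverse_sum m \<longlongrightarrow> L) at_top"
    and "\<exists>K>0. \<forall>r>0. num_zeros m r \<le> K * r"
    and "\<exists>\<beta>\<ge>0. \<forall>e>0. eventually (\<lambda>R. \<bar>num_zeros m R - \<beta> * R\<bar> \<le> e * R) at_top"
    and "\<exists>c \<kappa>. c \<noteq> 0 \<and> (\<forall>z. ((\<lambda>R. zero_product m R z) \<longlongrightarrow> exp (\<i> * of_real \<kappa> * z) * f z / c) at_top)"
proof -
  obtain h where h: "h holomorphic_on UNIV" "is_zero_set (m(0 := 0)) h" "\<And>z. f z = z ^ m 0 * h z"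
    "exponential_type h" "\<exists>M. \<forall>x::real. norm (h (of_real x)) \<le> M"
    using divide_zero_at_origin[OF f zs type bdd] by blast
  define m1 where "m1 = m(0 := 0)"
  have d1: "no_finite_limit_points m1"
    unfolding no_finite_limit_points_def
  proof
    fix r :: real
    show "finite {z. 0 < m1 z \<and> norm z \<le> r}"
      by (rule finite_subset[of _ "{z. 0 < m z \<and> norm z \<le> r}"]) (use d in \<open>auto simp: m1_def no_finite_limit_points_def\<close>)
  qed
  have Z: "zeros_in m1 R = zeros_in m R" for R by (auto simp: zeros_in_def m1_def)
  have num: "num_zeros m1 = num_zeros m"
    unfolding num_zeros_def[abs_def] Z by (intro ext sum.cong refl) (auto simp: m1_def zeros_in_def)
  obtain M' where M': "\<And>x::real. norm (h (of_real x)) \<le> M'" using h(5) by blast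
  obtain C B where CB: "0 < C" "\<And>z. norm (h z) \<le> C * exp (B * \<bar>Im z\<bar>)"
    using exponential_type_bounded_on_reals[OF h(1,4) M'] by blast
  obtain \<kappa> \<sigma> where bal: "balanced_function (\<lambda>z. exp (\<i> * of_real \<kappa> * z) / of_real C * h z) m1 \<sigma>"
    using balanced_function_normalization[OF h(1) h(2)[folded m1_def] d1 _ CB] by (auto simp: m1_def)
  interpret balanced_function "\<lambda>z. exp (\<i> * of_real \<kappa> * z) / of_real C * h z" m1 \<sigma> by (rule bal)
  have "inverse_sum m = inverse_sum m1"
    unfolding inverse_sum_def[abs_def] Z by (intro ext sum.cong refl) (auto simp: m1_def zeros_in_def)
  then show "\<exists>L. (inverse_sum m \<longlongrightarrow> L) at_top" using inverse_sum_tendsto by auto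
  show "\<exists>K>0. \<forall>r>0. num_zeros m r \<le> K * r" using num_zeros_le_linear unfolding num .
  have "0 \<le> 2 * \<sigma> / pi" using sigma_nonneg by simp
  then show "\<exists>\<beta>\<ge>0. \<forall>e>0. eventually (\<lambda>R. \<bar>num_zeros m R - \<beta> * R\<bar> \<le> e * R) at_top"
    using num_zeros_eventually_near unfolding num by blast
  have h0: "h 0 \<noteq> 0" using is_zero_set_zero_iff[OF h(2), of 0] by simp
  have "((\<lambda>R. zero_product m R z) \<longlongrightarrow> exp (\<i> * of_real \<kappa> * z) * f z / h 0) at_top" for z
  proof -
    have "(\<Prod>a\<in>zeros_in m1 R. (1 - z / a) ^ m1 a) = (\<Prod>a\<in>zeros_in m R. (1 - z / a) ^ m a)" for R
      unfolding Z by (intro prod.cong refl) (auto simp: m1_def zeros_in_def)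
    then have "((\<lambda>R. z ^ m 0 * (\<Prod>a\<in>zeros_in m R. (1 - z / a) ^ m a)) \<longlongrightarrow>
       z ^ m 0 * ((exp (\<i> * of_real \<kappa> * z) / of_real C * h z) / (exp (\<i> * of_real \<kappa> * 0) / of_real C * h 0))) at_top"
      using zero_product_tendsto[of z] by (intro tendsto_mult tendsto_const) simp
    then show ?thesis using CB(1) by (simp add: zero_product_def h(3) mult_ac)
  qed
  then show "\<exists>c \<kappa>. c \<noteq> 0 \<and> (\<forall>z. ((\<lambda>R. zero_product m R z) \<longlongrightarrow> exp (\<i> * of_real \<kappa> * z) * f z / c) at_top)"
    using h0 by blast
qed

lemma Limsup_LBINT_cnt:
  assumes m: "no_finite_limit_points m" and b: "m b = 0" and x: "m x = 0"
    and iii: "((\<lambda>t. (real (cnt m 0 (t + 1)) - real (cnt m 0 t)) / t) \<longlongrightarrow> 0) at_top"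
    and F: "\<And>z. ((\<lambda>R. zero_product m R z) \<longlongrightarrow> F z) at_top" and "F b \<noteq> 0" "F x \<noteq> 0"
  shows "Limsup at_top (\<lambda>T. ereal (LBINT t=0..ereal T. (real (cnt m b t) - real (cnt m x t)) / t)) = ereal (ln (norm (F x)) - ln (norm (F b)))"
  by (rule lim_imp_Limsup) (use LBINT_cnt_tendsto[OF m b x iii F _ F] assms(6,7) in auto)

text \<open>The integral in (iv) is the upper limit of its truncations, meaningful before
  convergence is known; in both directions of the proof it turns out to be a limit. Real zeros
  \<open>x\<close> are left out: there the true integral is minus infinity, while the Bochner
  integral of a function that is not integrable defaults to 0.\<close>

theorem theorem2:
  fixes m :: "complex \<Rightarrow> nat"
  assumes "no_finite_limit_points m"
  shows "(\<exists>f. f holomorphic_on UNIV \<and> exponential_type f \<and>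
              (\<exists>M. \<forall>x::real. norm (f (of_real x)) \<le> M) \<and> is_zero_set m f)
     \<longleftrightarrow>
     ((\<exists>L::complex. ((\<lambda>R::real. \<Sum>z\<in>{z. 0 < m z \<and> 0 < norm z \<and> norm z < R}. of_nat (m z) / z)
                       \<longlongrightarrow> L) at_top)
      \<and> (\<lambda>t. real (cnt m 0 t)) \<in> O[at_top](\<lambda>t. t)
      \<and> (\<lambda>t. real (cnt m 0 (t + 1)) - real (cnt m 0 t)) \<in> o[at_top](\<lambda>t. t)
      \<and> (\<exists>b::real. m (of_real b) = 0 \<and>
           (\<exists>C::real. \<forall>x::real. m (of_real x) = 0 \<longrightarrow>
              Limsup at_top (\<lambda>T::real. ereal (LBINT t=0..ereal T.
                 (real (cnt m (of_real b) t) - real (cnt m (of_real x) t)) / t)) \<le> ereal C)))"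
    (is "?lhs \<longleftrightarrow> ?i \<and> ?ii \<and> ?iii \<and> ?iv")
proof
  note d = assms
  have i_iff: "?i \<longleftrightarrow> (\<exists>L. (inverse_sum m \<longlongrightarrow> L) at_top)"
    unfolding inverse_sum_def[abs_def] zeros_in_def ..
  {
    assume ?lhs
    then obtain f M where f: "f holomorphic_on UNIV" "exponential_type f" "\<And>x::real. norm (f (of_real x)) \<le> M" "is_zero_set m f"
      by blast
    note zs = bounded_exponential_type_zeros[OF f(1,4) d f(2,3)]
    have ?i unfolding i_iff by (rule zs(1))
    moreover obtain K where K: "0 < K" "\<And>r. 0 < r \<Longrightarrow> num_zeros m r \<le> K * r" using zs(2) by blast
    have ?ii
    proof (rule bigoI[of _ "real (m 0) + 2 * K"])
      show "eventually (\<lambda>t. norm (real (cnt m 0 t)) \<le> (real (m 0) + 2 * K) * norm t) at_top"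
        using eventually_ge_at_top[of 1]
      proof eventually_elim
        case (elim t)
        have "real (cnt m 0 t) \<le> real (m 0) + num_zeros m (t + 1)" by (rule cnt_num_zeros_bounds(2)[OF d]) (use elim in simp)
        also have "\<dots> \<le> real (m 0) * t + K * (t + 1)"
          using K(2)[of "t + 1"] elim by (intro add_mono) (auto simp: mult_le_cancel_left1)
        also have "\<dots> \<le> real (m 0) * t + K * (2 * t)" using elim K(1) by (intro add_left_mono mult_left_mono) auto
        finally show ?case using elim by (simp add: algebra_simps)
      qed
    qed
    moreover have iii: ?iii
    proof (rule landau_o.smallI)
      fix c :: real assume c: "0 < c"
      obtain \<beta> where \<beta>: "0 \<le> \<beta>" "\<And>e. 0 < e \<Longrightarrow> eventually (\<lambda>R. \<bar>num_zeros m R - \<beta> * R\<bar> \<le> e * R) at_top"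
        using zs(3) by blast
      have near: "eventually (\<lambda>R. \<bar>num_zeros m R - \<beta> * R\<bar> \<le> c / 4 * R) at_top" by (rule \<beta>(2)) (use c in simp)
      have "filterlim (\<lambda>R::real. R + 2) at_top at_top" by real_asymp
      then have "eventually (\<lambda>R. \<bar>num_zeros m (R + 2) - \<beta> * (R + 2)\<bar> \<le> c / 4 * (R + 2)) at_top"
        using near unfolding filterlim_iff by blast
      then show "eventually (\<lambda>t. norm (real (cnt m 0 (t + 1)) - real (cnt m 0 t)) \<le> c * norm t) at_top"
        using near eventually_gt_at_top[of 0] eventually_ge_at_top[of "(2 * \<beta> + c / 2) / (c / 2)"]
      proof eventually_elim
        case (elim t)
        have "real (cnt m 0 (t + 1)) - real (cnt m 0 t) \<le> num_zeros m (t + 2) - num_zeros m t"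
        proof -
          have e: "t + 1 + 1 = t + 2" by simp
          show ?thesis
            using cnt_num_zeros_bounds(2)[OF d, of "t + 1", unfolded e] cnt_num_zeros_bounds(1)[OF d, of t] elim by linarith
        qed
        also have "\<dots> \<le> (\<beta> * (t + 2) + c / 4 * (t + 2)) - (\<beta> * t - c / 4 * t)"
          using elim(1,2) unfolding abs_le_iff by (intro diff_mono) linarith+
        also have "\<dots> = 2 * \<beta> + c / 2 + c / 2 * t" by (simp add: field_simps)
        also have "2 * \<beta> + c / 2 \<le> c / 2 * t" using elim(4) c by (simp add: divide_le_eq mult.commute)
        finally have "real (cnt m 0 (t + 1)) - real (cnt m 0 t) \<le> c * t" by simp
        moreover have "cnt m 0 t \<le> cnt m 0 (t + 1)" by (rule cnt_mono[OF d]) simp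
        ultimately show ?case using elim by simp
      qed
    qed
    moreover have ?iv
    proof -
      obtain c \<kappa> where c: "c \<noteq> 0" and lim: "\<And>z. ((\<lambda>R. zero_product m R z) \<longlongrightarrow> exp (\<i> * of_real \<kappa> * z) * f z / c) at_top"
        using zs(4) by blast
      define F where "F z = exp (\<i> * of_real \<kappa> * z) * f z / c" for z
      have "finite (Re ` {z. 0 < m z \<and> norm z \<le> 1})" using d by (simp add: no_finite_limit_points_def)
      moreover have "infinite {0..1::real}" by (intro infinite_Icc) simp
      ultimately obtain b where b: "b \<in> {0..1}" "b \<notin> Re ` {z. 0 < m z \<and> norm z \<le> 1}"
        by (meson finite_subset subsetI)
      have mb: "m (of_real b) = 0"
      proof (rule ccontr)
        assume "m (of_real b) \<noteq> 0"
        then have "complex_of_real b \<in> {z. 0 < m z \<and> norm z \<le> 1}" using b(1) by simp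
        then have "Re (complex_of_real b) \<in> Re ` {z. 0 < m z \<and> norm z \<le> 1}" by (rule imageI)
        then show False using b(2) by simp
      qed
      have nz: "F z \<noteq> 0" if "m z = 0" for z using is_zero_set_zero_iff[OF f(4), of z] that c by (simp add: F_def)
      have "Limsup at_top (\<lambda>T::real. ereal (LBINT t=0..ereal T. (real (cnt m (of_real b) t) - real (cnt m (of_real x) t)) / t))
          \<le> ereal (ln (M / norm c) - ln (norm (F (of_real b))))" if x: "m (of_real x) = 0" for x :: real
      proof -
        have "norm (F (of_real x)) \<le> M / norm c"
          using f(3)[of x] c by (simp add: F_def norm_mult norm_divide divide_right_mono)
        then have "ln (norm (F (of_real x))) \<le> ln (M / norm c)"
          using nz[OF x] by (subst ln_le_cancel_iff) (auto intro: less_le_trans[of 0 "norm (F (of_real x))"])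
        then show ?thesis
          using Limsup_LBINT_cnt[OF d mb x smalloD_tendsto[OF iii] lim[folded F_def] nz[OF mb] nz[OF x]] by simp
      qed
      then show ?thesis using mb by blast
    qed
    ultimately show "?i \<and> ?ii \<and> ?iii \<and> ?iv" by blast
  }
  {
    assume R: "?i \<and> ?ii \<and> ?iii \<and> ?iv"
    obtain L where L: "(inverse_sum m \<longlongrightarrow> L) at_top" using R unfolding i_iff by blast
    obtain K0 where K0: "0 < K0" "eventually (\<lambda>t. norm (real (cnt m 0 t)) \<le> K0 * norm t) at_top"
      using R by (elim conjE landau_o.bigE)
    obtain t0 where t0: "\<And>t. t0 \<le> t \<Longrightarrow> norm (real (cnt m 0 t)) \<le> K0 * norm t"
      using K0(2) by (auto simp: eventually_at_top_linorder)
    obtain r0 where r0: "0 < r0" "\<And>r. r \<le> r0 \<Longrightarrow> zeros_in m r = {}" using zeros_in_empty[OF d] by blast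
    define t1 where "t1 = max t0 0"
    \<comment> \<open>Condition (ii) speaks only of large radii. Up to \<open>r0\<close> there are
      no zeros, and between \<open>r0\<close> and \<open>t1\<close> the count is at most
      \<open>num_zeros m t1\<close>, which the second summand covers because
      \<open>r > r0\<close>.\<close>
    define K where "K = K0 + num_zeros m t1 / r0"
    have K: "0 \<le> K" using K0 r0 num_zeros_nonneg[of m t1] by (simp add: K_def)
    have dens: "num_zeros m r \<le> K * r" if r: "0 < r" for r
    proof -
      consider "r \<le> r0" | "r0 < r" "t1 \<le> r" | "r0 < r" "r < t1" by linarith
      then show ?thesis
      proof cases
        case 1
        then show ?thesis using r0(2)[OF 1] K r by (simp add: num_zeros_def)
      next
        case 2
        have "num_zeros m r \<le> K0 * r"
          using cnt_num_zeros_bounds(1)[OF d, of r] t0[of r] 2 r by (simp add: t1_def)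
        also have "\<dots> \<le> K * r" using r r0 num_zeros_nonneg[of m t1] by (intro mult_right_mono) (auto simp: K_def)
        finally show ?thesis .
      next
        case 3
        have "num_zeros m r \<le> num_zeros m t1" by (rule num_zeros_mono[OF d]) (use 3 in simp)
        also have "\<dots> = num_zeros m t1 / r0 * r0" using r0 by simp
        also have "\<dots> \<le> K * r" using 3 r0 K0 num_zeros_nonneg[of m t1] by (intro mult_mono) (auto simp: K_def)
        finally show ?thesis .
      qed
    qed
    interpret linear_zero_density m K by unfold_locales (use d K dens in auto)
    obtain F where F: "F holomorphic_on UNIV" "is_zero_set m F" "exponential_type F"
      "\<And>z. ((\<lambda>R. zero_product m R z) \<longlongrightarrow> F z) at_top"
      using Lindelof_product[OF L] by blast
    obtain b C where b: "m (of_real b) = 0" and C: "\<And>x::real. m (of_real x) = 0 \<Longrightarrow>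
       Limsup at_top (\<lambda>T::real. ereal (LBINT t=0..ereal T. (real (cnt m (of_real b) t) - real (cnt m (of_real x) t)) / t)) \<le> ereal C"
      using R by blast
    have iii: "((\<lambda>t. (real (cnt m 0 (t + 1)) - real (cnt m 0 t)) / t) \<longlongrightarrow> 0) at_top"
      using R by (intro smalloD_tendsto) blast
    have nz: "F z \<noteq> 0" if "m z = 0" for z using is_zero_set_zero_iff[OF F(2), of z] that by simp
    have "norm (F (of_real x)) \<le> norm (F (of_real b)) * exp C" for x :: real
    proof (cases "m (of_real x) = 0")
      \<comment> \<open>Condition (iv) says nothing at a real zero, but \<open>F\<close> vanishes
        there.\<close>
      case False
      then have "F (of_real x) = 0" using is_zero_set_zero_iff[OF F(2)] by simp
      then show ?thesis by simp
    next
      case True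
      have "ln (norm (F (of_real x))) - ln (norm (F (of_real b))) \<le> C"
        using C[OF True] Limsup_LBINT_cnt[OF d b True iii F(4) nz[OF b] nz[OF True]] by simp
      then have "exp (ln (norm (F (of_real x)))) \<le> exp (ln (norm (F (of_real b))) + C)" by simp
      then show ?thesis using nz[OF b] nz[OF True] by (simp add: exp_add)
    qed
    then show ?lhs using F by blast
  }
qed

end
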